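(* Let $q\in(-1,1]$. For $\rho_1,\rho_2\in(-1,1)$, $y,z\in S(q)$ and $n\ge 0$ put $$g_n(y,z,\rho_1,\rho_2,q)=\int_{S(q)}H_n(x|q)\,\phi(x|y,z,\rho_1,\rho_2,q)\,dx ,$$ where $\phi(\cdot|y,z,\rho_1,\rho_2,q)$ is the (re-scaled Askey–Wilson) density defined in the context. (i) For all $\rho_1,\rho_2\in(-1,1)\setminus\{0\}$ and all $x,y,z\in S(q)$, $$\phi(x|y,z,\rho_1,\rho_2,q)=f_N(x|q)\sum_{n=0}^{\infty}\frac{H_n(x|q)}{[n]_q!}\,g_n(y,z,\rho_1,\rho_2,q),$$ where $g_n$ is a polynomial of order $n$ in $(y,z)$. (ii) Moreover, the polynomial $g_n$ has the following structure: for all $n\ge 1$, $$g_n(y,z,\rho_1,\rho_2,q)=\sum_{i=0}^{n}\binom{n}{i}_q\rho_1^{i}\rho_2^{n-i}\,\Theta_{i,n-i}(y,z,\rho_1\rho_2|q),$$ where $\Theta_{k,l}(y,z,\rho_1\rho_2|q)$ is a polynomial in $y$ of order $k$ and in $z$ of order $l$ (depending on $\rho_1,\rho_2$ only through the product $\rho_1\rho_2$). Moreover $\Theta_{0,n}(y,z,0|q)=H_n(z|q)$ and $\Theta_{n,0}(y,z,0|q)=H_n(y|q)$.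
   Context: Convention $0^0=1$. $[n]_q=1+q+\dots+q^{n-1}$, $[0]_q=0$, $[n]_q!=\prod_{i=1}^n[i]_q$, $[0]_q!=1$, $\binom{n}{k}_q=\frac{[n]_q!}{[k]_q![n-k]_q!}$ for $0\le k\le n$ (and $0$ otherwise). $(a)_\infty=\prod_{i\ge0}(1-aq^i)$, and $(a,b)_\infty=(a)_\infty(b)_\infty$. $S(q)=[-2/\sqrt{1-q},\,2/\sqrt{1-q}]$ for $|q|<1$, and $S(1)=\mathbb R$. $q$-Hermite polynomials: $H_{-1}(x|q)=0$, $H_0(x|q)=1$, $H_{n+1}(x|q)=xH_n(x|q)-[n]_qH_{n-1}(x|q)$ for $n\ge 0$. $q$-Normal density: for $|q|<1$ and $x\in S(q)$, $$f_N(x|q)=\frac{\sqrt{1-q}}{2\pi\sqrt{4-(1-q)x^2}}\prod_{k=0}^\infty\big((1+q^k)^2-(1-q)x^2q^k\big)\prod_{k=0}^\infty(1-q^{k+1})$$ (value $0$ at the endpoints of $S(q)$, since the $k=0$ factor is $4-(1-q)x^2$), $f_N(x|q)=0$ for $x\notin S(q)$; $f_N(x|1)=\frac1{\sqrt{2\pi}}e^{-x^2/2}$. The density $\phi$: for $|q|<1$ and $x,y,z\in S(q)$, $$\phi(x|y,z,\rho_1,\rho_2,q)=f_N(x|q)\frac{(\rho_1^2,\rho_2^2)_\infty}{(\rho_1^2\rho_2^2)_\infty}\prod_{k=0}^\infty\frac{w_k(y,z,\rho_1\rho_2,q)}{w_k(x,y,\rho_1,q)\,w_k(x,z,\rho_2,q)},$$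 where $w_k(s,t,\rho,q)=(1-\rho^2q^{2k})^2-(1-q)\rho q^k(1+\rho^2q^{2k})st+(1-q)\rho^2(s^2+t^2)q^{2k}$. For $q=1$, $\phi(\cdot|y,z,\rho_1,\rho_2,1)$ is the density of the normal law with mean $\frac{y\rho_1(1-\rho_2^2)+z\rho_2(1-\rho_1^2)}{1-\rho_1^2\rho_2^2}$ and variance $\frac{(1-\rho_1^2)(1-\rho_2^2)}{1-\rho_1^2\rho_2^2}$.
   Formalization: "Order k in y and l in z" fails for ρ=ρ1ρ2≠0: Θ_{1,0}=(y-ρz)/(1-ρ²) is forced. Proved instead: Θ_{k,l} has total degree k+l and contains y^k z^l for every ρ in (-1,1), with degrees exactly k in y and l in z when ρ=0. *)

theory Defs
  imports "HOL-Probability.Probability" "HOL-Computational_Algebra.Polynomial"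
begin

definition q_int :: "nat \<Rightarrow> real \<Rightarrow> real" where
  "q_int n q = (\<Sum>i<n. q ^ i)"

definition q_fact :: "nat \<Rightarrow> real \<Rightarrow> real" where
  "q_fact n q = (\<Prod>i=1..n. q_int i q)"

definition q_binomial :: "nat \<Rightarrow> nat \<Rightarrow> real \<Rightarrow> real" where
  "q_binomial n k q =
     (if k \<le> n then q_fact n q / (q_fact k q * q_fact (n - k) q) else 0)"

definition q_poch_inf :: "real \<Rightarrow> real \<Rightarrow> real" where
  "q_poch_inf a q = prodinf (\<lambda>i. 1 - a * q ^ i)"

definition S :: "real \<Rightarrow> real set" where
  "S q = (if q = 1 then UNIV else {- 2 / sqrt (1 - q) .. 2 / sqrt (1 - q)})"

text \<open>The recurrence starts from \<open>H\<^sub>-\<^sub>1 = 0\<close>, which gives \<open>H\<^sub>1(x|q) = x\<close>.\<close>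

fun q_Hermite :: "nat \<Rightarrow> real \<Rightarrow> real \<Rightarrow> real" where
  "q_Hermite 0 x q = 1"
| "q_Hermite (Suc 0) x q = x"
| "q_Hermite (Suc (Suc n)) x q = x * q_Hermite (Suc n) x q - q_int (Suc n) q * q_Hermite n x q"

text \<open>The densities are meant for \<open>-1 < q \<le> 1\<close>, so \<open>q \<noteq> 1\<close> is the case \<open>\<bar>q\<bar> < 1\<close>.
  At the endpoints of \<open>S q\<close> the \<open>k = 0\<close> factor of the first infinite product vanishes, so
  the value there is 0.\<close>

definition q_normal :: "real \<Rightarrow> real \<Rightarrow> real" where
  "q_normal x q =
     (if q = 1 then std_normal_density x
      else if x \<in> S q then
        sqrt (1 - q) / (2 * pi * sqrt (4 - (1 - q) * x\<^sup>2))
          * prodinf (\<lambda>k. (1 + q ^ k)\<^sup>2 - (1 - q) * x\<^sup>2 * q ^ k)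
          * prodinf (\<lambda>k. 1 - q ^ (k + 1))
      else 0)"

definition w :: "nat \<Rightarrow> real \<Rightarrow> real \<Rightarrow> real \<Rightarrow> real \<Rightarrow> real" where
  "w k s t \<rho> q =
     (1 - \<rho>\<^sup>2 * q ^ (2 * k))\<^sup>2
     - (1 - q) * \<rho> * q ^ k * (1 + \<rho>\<^sup>2 * q ^ (2 * k)) * s * t
     + (1 - q) * \<rho>\<^sup>2 * (s\<^sup>2 + t\<^sup>2) * q ^ (2 * k)"

text \<open>The second parameter of \<^const>\<open>normal_density\<close> is the standard deviation.\<close>

definition phi :: "real \<Rightarrow> real \<Rightarrow> real \<Rightarrow> real \<Rightarrow> real \<Rightarrow> real \<Rightarrow> real" where
  "phi x y z \<rho>1 \<rho>2 q =
     (if q = 1 then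
        normal_density
          ((y * \<rho>1 * (1 - \<rho>2\<^sup>2) + z * \<rho>2 * (1 - \<rho>1\<^sup>2)) / (1 - \<rho>1\<^sup>2 * \<rho>2\<^sup>2))
          (sqrt ((1 - \<rho>1\<^sup>2) * (1 - \<rho>2\<^sup>2) / (1 - \<rho>1\<^sup>2 * \<rho>2\<^sup>2)))
          x
      else
        q_normal x q
          * (q_poch_inf (\<rho>1\<^sup>2) q * q_poch_inf (\<rho>2\<^sup>2) q / q_poch_inf (\<rho>1\<^sup>2 * \<rho>2\<^sup>2) q)
          * prodinf (\<lambda>k. w k y z (\<rho>1 * \<rho>2) q / (w k x y \<rho>1 q * w k x z \<rho>2 q)))"

definition g :: "nat \<Rightarrow> real \<Rightarrow> real \<Rightarrow> real \<Rightarrow> real \<Rightarrow> real \<Rightarrow> real" where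
  "g n y z \<rho>1 \<rho>2 q =
     set_lebesgue_integral lborel (S q) (\<lambda>x. q_Hermite n x q * phi x y z \<rho>1 \<rho>2 q)"

text \<open>A polynomial in \<open>(y, z)\<close> is an element of \<open>real poly poly\<close>: the outer variable is \<open>y\<close>,
  the inner variable is \<open>z\<close>.\<close>

definition coeff2 :: "real poly poly \<Rightarrow> nat \<Rightarrow> nat \<Rightarrow> real" where
  "coeff2 p i j = coeff (coeff p i) j"

definition poly2 :: "real poly poly \<Rightarrow> real \<Rightarrow> real \<Rightarrow> real" where
  "poly2 p y z = poly (poly p [:y:]) z"

lemma poly2_altdef:
  "poly2 p y z = (\<Sum>i\<le>degree p. \<Sum>j\<le>degree (coeff p i). coeff2 p i j * y ^ i * z ^ j)"
  by (simp add: poly2_def coeff2_def poly_altdef[of p] poly_altdef[of "coeff p _"] poly_sum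
      poly_const_pow sum_distrib_right sum_distrib_left algebra_simps)

text \<open>Total degree exactly \<open>n\<close>; in particular \<open>p \<noteq> 0\<close>, also for \<open>n = 0\<close>.\<close>

definition has_total_degree :: "real poly poly \<Rightarrow> nat \<Rightarrow> bool" where
  "has_total_degree p n \<longleftrightarrow>
     (\<forall>i j. coeff2 p i j \<noteq> 0 \<longrightarrow> i + j \<le> n) \<and> (\<exists>i j. i + j = n \<and> coeff2 p i j \<noteq> 0)"

text \<open>Degree \<open>k\<close> in \<open>y\<close> and degree \<open>l\<close> in \<open>z\<close>, with the leading monomial
  \<open>y\<^sup>k z\<^sup>l\<close> present.\<close>

definition has_bidegree :: "real poly poly \<Rightarrow> nat \<Rightarrow> nat \<Rightarrow> bool" where
  "has_bidegree p k l \<longleftrightarrow>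
     (\<forall>i j. coeff2 p i j \<noteq> 0 \<longrightarrow> i \<le> k \<and> j \<le> l) \<and> coeff2 p k l \<noteq> 0"

text \<open>The order condition for \<open>\<Theta>\<^sub>k\<^sub>,\<^sub>l(y,z,\<rho>|q)\<close>, \<open>P \<rho>\<close> being that polynomial: for every \<open>\<rho>\<close>
  the total degree is \<open>k + l\<close> and \<open>y\<^sup>k z\<^sup>l\<close> occurs, and for \<open>\<rho> = 0\<close> the degree is \<open>k\<close> in \<open>y\<close>
  and \<open>l\<close> in \<open>z\<close>.  Separate degrees \<open>k\<close> and \<open>l\<close> are impossible for \<open>\<rho> \<noteq> 0\<close>, since necessarily
  \<open>\<Theta>\<^sub>1\<^sub>,\<^sub>0(y,z,\<rho>|q) = (y - \<rho> z) / (1 - \<rho>\<^sup>2)\<close>.\<close>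

definition has_order :: "(real \<Rightarrow> real poly poly) \<Rightarrow> nat \<Rightarrow> nat \<Rightarrow> bool" where
  "has_order P k l \<longleftrightarrow>
     (\<forall>\<rho>\<in>{-1<..<1}. has_total_degree (P \<rho>) (k + l) \<and> coeff2 (P \<rho>) k l \<noteq> 0) \<and>
     has_bidegree (P 0) k l"

end

theory Submission
  imports Defs
begin

text \<open>Put \<open>A\<^sub>a\<^sub>,\<^sub>b(y,z,r) = \<Sum>c. r\<^sup>c / [c]! H\<^sub>a\<^sub>+\<^sub>c(y) H\<^sub>b\<^sub>+\<^sub>c(z)\<close>. The three-term recurrence gives
    \<open>y A\<^sub>a\<^sub>,\<^sub>b = A\<^sub>a\<^sub>+\<^sub>1\<^sub>,\<^sub>b + [a] A\<^sub>a\<^sub>-\<^sub>1\<^sub>,\<^sub>b + q\<^sup>a r A\<^sub>a\<^sub>,\<^sub>b\<^sub>+\<^sub>1\<close>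
  and its mirror image in \<open>z\<close>. These two relations determine every \<open>A\<^sub>a\<^sub>,\<^sub>b\<close> from \<open>A\<^sub>0\<^sub>,\<^sub>0\<close>, so that
  \<open>A\<^sub>a\<^sub>,\<^sub>b = \<Theta>\<^sub>a\<^sub>,\<^sub>b A\<^sub>0\<^sub>,\<^sub>0\<close> with polynomials \<open>\<Theta>\<^sub>a\<^sub>,\<^sub>b\<close>, and they relate \<open>A\<^sub>0\<^sub>,\<^sub>0(r)\<close> to \<open>A\<^sub>0\<^sub>,\<^sub>0(q r)\<close> (to the
  derivative of \<open>A\<^sub>0\<^sub>,\<^sub>0\<close> if \<open>q = 1\<close>), which yields the Mehler formula; for \<open>\<bar>q\<bar> < 1\<close> it says that
  \<open>A\<^sub>0\<^sub>,\<^sub>0\<close> is \<open>(r\<^sup>2)\<^sub>\<infinity>\<close> times the product of the \<open>1 / w\<^sub>k\<close>. Hence for \<open>\<bar>q\<bar> < 1\<close> the density is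
    \<open>\<phi>(x) = f\<^sub>N(x) A\<^sub>0\<^sub>,\<^sub>0(x,y,\<rho>1) A\<^sub>0\<^sub>,\<^sub>0(x,z,\<rho>2) / A\<^sub>0\<^sub>,\<^sub>0(y,z,\<rho>1\<rho>2)\<close>.
  Summing an absolutely convergent triple series in two ways expands this product as
    \<open>\<Sum>n. H\<^sub>n(x) / [n]! \<Sum>i\<le>n. [n choose i] \<rho>1\<^sup>i \<rho>2\<^sup>n\<^sup>-\<^sup>i A\<^sub>i\<^sub>,\<^sub>n\<^sub>-\<^sub>i(y,z,\<rho>1\<rho>2)\<close>,
  and orthogonality of the \<open>H\<^sub>n\<close> identifies the coefficients with \<open>g\<^sub>n\<close>. For \<open>q = 1\<close> both \<open>g\<^sub>n\<close>
  and the polynomial on the right satisfy the same three-term recurrence.\<close>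

section \<open>q-numbers and q-Hermite polynomials\<close>

text \<open>After the growth bounds, a term of the triple series is a geometric weight times square
  roots of three q-binomial coefficients. These are bounded for \<open>|q| < 1\<close> but not at
  \<open>q = 1\<close>, where absolute convergence can fail for parameters close to 1; this forces a
  separate Gaussian case. There the normal density of variance \<open>1 - t^2\<close> is the
  standard density times a single Mehler kernel, so one kernel replaces the quotient of three, and
  uniqueness for the three-term recurrence ties its coefficients to the polynomials. Division by
  \<open>A 0 0\<close> is needed throughout, and its series does not show that it is nonzero; the
  Mehler formula does. Orthogonality for \<open>|q| < 1\<close> is proved by truncating the infinite
  weight to \<open>N\<close> factors, for which the trigonometric moments have a closed form, and
  letting \<open>N\<close> tend to infinity. Termwise integration needs coefficients smaller than
  \<open>sqrt (qf n)\<close> by a geometric factor, which is why growth is always measured against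
  \<open>s ^ n * sqrt (qf n)\<close> with \<open>s > 1\<close> at choice.\<close>

locale q_param =
  fixes q :: real
  assumes q_gt: "-1 < q" and q_le: "q \<le> 1"
begin

abbreviation qi :: "nat \<Rightarrow> real" where "qi n \<equiv> q_int n q"
abbreviation qf :: "nat \<Rightarrow> real" where "qf n \<equiv> q_fact n q"
abbreviation qb :: "nat \<Rightarrow> nat \<Rightarrow> real" where "qb n k \<equiv> q_binomial n k q"
abbreviation H :: "nat \<Rightarrow> real \<Rightarrow> real" where "H n x \<equiv> q_Hermite n x q"

lemma abs_q_le: "\<bar>q\<bar> \<le> 1"
  using q_gt q_le by simp

lemma abs_q_power_le: "\<bar>q ^ n\<bar> \<le> 1"
  using abs_q_le by (simp add: power_abs power_le_one)

lemma q_int_0 [simp]: "qi 0 = 0"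
  and q_int_1 [simp]: "qi (Suc 0) = 1"
  and q_int_Suc: "qi (Suc n) = qi n + q ^ n"
  by (simp_all add: q_int_def)

lemma q_int_add: "qi (m + n) = qi m + q ^ m * qi n"
  by (induction n) (simp_all add: q_int_Suc algebra_simps power_add)

lemma q_int_geometric: "(1 - q) * qi n = 1 - q ^ n"
  by (simp add: q_int_def one_diff_power_eq)

text \<open>For negative \<open>q\<close> the summands alternate in sign, so positivity is read off
  from \<open>(1 - q) * qi n = 1 - q ^ n\<close> rather than from the sum.\<close>

lemma q_int_pos: "0 < n \<Longrightarrow> 0 < qi n"
proof (cases "q = 1")
  case True
  then show "0 < n \<Longrightarrow> 0 < qi n" by (simp add: q_int_def)
next
  case False
  assume "0 < n"
  have "q ^ n < 1"
  proof -
    have "\<bar>q\<bar> < 1" using q_gt q_le False by simp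
    then have "\<bar>q\<bar> ^ n < 1" using \<open>0 < n\<close> by (intro power_less_one_iff[THEN iffD2]) auto
    then show ?thesis by (metis abs_ge_self le_less_trans power_abs)
  qed
  then have "0 < (1 - q) * qi n" by (simp add: q_int_geometric)
  then show "0 < qi n" using q_le False by (simp add: zero_less_mult_iff)
qed

lemma q_int_Suc_pos [simp]: "0 < qi (Suc n)"
  by (rule q_int_pos) simp

lemma q_int_Suc_neq_0 [simp]: "qi (Suc n) \<noteq> 0"
  using q_int_Suc_pos[of n] by linarith

lemma q_int_nonneg [simp]: "0 \<le> qi n"
  by (cases n) (auto intro: less_imp_le)

lemma q_int_le: "qi n \<le> real n"
proof (induction n)
  case (Suc n)
  have "q ^ n \<le> 1" using abs_q_power_le[of n] by linarith
  with Suc show ?case by (simp add: q_int_Suc)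
qed simp

lemma q_fact_0 [simp]: "qf 0 = 1"
  and q_fact_Suc: "qf (Suc n) = qi (Suc n) * qf n"
  by (simp_all add: q_fact_def prod.nat_ivl_Suc' mult.commute)

lemma q_fact_pos [simp]: "0 < qf n"
  by (induction n) (simp_all add: q_fact_Suc)

lemma q_fact_nonneg [simp]: "0 \<le> qf n"
  by (simp add: less_imp_le)

lemma q_fact_neq_0 [simp]: "qf n \<noteq> 0"
  using q_fact_pos[of n] by linarith

lemma q_binomial_0 [simp]: "qb n 0 = 1"
  and q_binomial_self [simp]: "qb n n = 1"
  and q_binomial_gt [simp]: "n < k \<Longrightarrow> qb n k = 0"
  by (simp_all add: q_binomial_def)

lemma q_binomial_nonneg [simp]: "0 \<le> qb n k"
  by (simp add: q_binomial_def less_imp_le)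

lemma q_binomial_symmetric: "k \<le> n \<Longrightarrow> qb n (n - k) = qb n k"
  by (simp add: q_binomial_def mult.commute)

lemma q_binomial_Suc_Suc: "qb (Suc n) (Suc k) = qb n k + q ^ Suc k * qb n (Suc k)"
proof (cases "Suc k \<le> n")
  case True
  then obtain m where n: "n = Suc k + m" using le_Suc_ex by blast
  have *: "qi (Suc n) = qi (Suc k) + q ^ Suc k * qi (Suc m)"
    unfolding n by (subst q_int_add[symmetric]) simp
  show ?thesis using True
    by (simp add: q_binomial_def n q_fact_Suc[of "Suc (k + m)"] q_fact_Suc[of m] q_fact_Suc[of k]
        *[unfolded n, simplified] Suc_diff_le divide_simps) (simp add: algebra_simps)
next
  case False
  then consider "n = k" | "n < k" by linarith
  then show ?thesis by cases auto
qed

text \<open>The other Pascal rule, reflected by \<open>k\<close> to \<open>n - k\<close>. Its power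
  of \<open>q\<close> sits on the term with lower index \<open>k\<close>, as is needed when the
  factor of index \<open>n\<close> is appended to the product in the q-binomial theorem.\<close>

lemma q_binomial_Suc_Suc': "k \<le> n \<Longrightarrow> qb (Suc n) (Suc k) = q ^ (n - k) * qb n k + qb n (Suc k)"
proof (cases "k = n")
  case False
  assume "k \<le> n"
  with False obtain m where n: "n = Suc k + m" using le_Suc_ex[of "Suc k" n] by auto
  have "qb (Suc n) (Suc k) = qb (Suc n) (Suc m)"
    using q_binomial_symmetric[of "Suc k" "Suc n"] by (simp add: n)
  also have "\<dots> = qb n m + q ^ Suc m * qb n (Suc m)" by (rule q_binomial_Suc_Suc)
  also have "qb n m = qb n (Suc k)" using q_binomial_symmetric[of m n] by (simp add: n)
  also have "qb n (Suc m) = qb n k" using q_binomial_symmetric[of k n] by (simp add: n)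
  finally show ?thesis by (simp add: n)
qed simp

lemma q_binomial_absorb: "qi (Suc k) * qb (Suc n) (Suc k) = qi (Suc n) * qb n k"
  by (simp add: q_binomial_def q_fact_Suc)

text \<open>At \<open>n = 0\<close> the truncated index \<open>n - 1\<close> is harmless because
  \<open>qi 0 = 0\<close>. This encodes that the polynomial of index -1 is zero; the later
  recurrences use the same device.\<close>

lemma Hermite_Suc: "H (Suc n) x = x * H n x - qi n * H (n - 1) x"
  by (cases n) simp_all

lemma Hermite_mult: "x * H n x = H (Suc n) x + qi n * H (n - 1) x"
  by (simp add: Hermite_Suc)

text \<open>Gauss's q-binomial formula. It gives the coefficients of \<open>lin1\<close> and
  \<open>lin2\<close>, and read backwards it turns the leading coefficient of \<open>G\<close> into
  a product that is visibly nonzero.\<close>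

lemma q_binomial_theorem:
  "(\<Prod>i<n. a + q ^ i * b) = (\<Sum>k\<le>n. q ^ (k choose 2) * qb n k * b ^ k * a ^ (n - k))"
proof (induction n)
  case (Suc n)
  let ?c = "\<lambda>n k. q ^ (k choose 2) * qb n k * b ^ k"
  have "(\<Sum>k\<le>Suc n. ?c (Suc n) k * a ^ (Suc n - k)) =
        a ^ Suc n + (\<Sum>k\<le>n. ?c (Suc n) (Suc k) * a ^ (n - k))"
    by (subst sum.atMost_Suc_shift) (simp add: numeral_2_eq_2)
  also have "(\<Sum>k\<le>n. ?c (Suc n) (Suc k) * a ^ (n - k)) =
     (\<Sum>k\<le>n. q ^ n * b * (?c n k * a ^ (n - k))) + (\<Sum>k\<le>n. ?c n (Suc k) * a ^ (n - k))"
    unfolding sum.distrib[symmetric]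
  proof (intro sum.cong refl)
    fix k assume "k \<in> {..n}"
    then have k: "k \<le> n" by simp
    have "(Suc k choose 2) = (k choose 2) + k" by (simp add: numeral_2_eq_2)
    moreover have "q ^ n = q ^ k * q ^ (n - k)" using k by (simp flip: power_add)
    ultimately show "?c (Suc n) (Suc k) * a ^ (n - k) =
        q ^ n * b * (?c n k * a ^ (n - k)) + ?c n (Suc k) * a ^ (n - k)"
      by (simp add: q_binomial_Suc_Suc'[OF k] algebra_simps power_add)
  qed
  also have "(\<Sum>k\<le>n. ?c n (Suc k) * a ^ (n - k)) = (\<Sum>k\<le>n. a * (?c n k * a ^ (n - k))) - a ^ Suc n"
  proof -
    have "(\<Sum>k\<le>Suc n. ?c n k * a ^ (Suc n - k)) = (\<Sum>k\<le>n. ?c n k * a ^ (Suc n - k))"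
      by simp
    also have "\<dots> = (\<Sum>k\<le>n. a * (?c n k * a ^ (n - k)))"
      by (intro sum.cong) (simp_all add: Suc_diff_le)
    finally show ?thesis by (subst (asm) sum.atMost_Suc_shift) (simp add: algebra_simps numeral_2_eq_2)
  qed
  finally have "(\<Sum>k\<le>Suc n. ?c (Suc n) k * a ^ (Suc n - k)) =
      (a + q ^ n * b) * (\<Sum>k\<le>n. ?c n k * a ^ (n - k))"
    unfolding sum_distrib_left[symmetric] by (simp only: ring_distribs)
  then show ?case using Suc by (simp add: mult.commute)
qed (simp add: numeral_2_eq_2)

end

section \<open>Growth of the q-Hermite polynomials\<close>

lemma convergent_prod_one_plus:
  fixes f :: "nat \<Rightarrow> real"
  assumes "summable (\<lambda>n. \<bar>f n - 1\<bar>)"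
  shows "convergent_prod f"
  using assms by (intro abs_convergent_prod_imp_convergent_prod summable_imp_abs_convergent_prod) simp

lemma convergent_prod_lessThan_LIMSEQ:
  fixes f :: "nat \<Rightarrow> real"
  assumes "convergent_prod f"
  shows "(\<lambda>n. \<Prod>i<n. f i) \<longlonglongrightarrow> prodinf f"
  using convergent_prod_LIMSEQ[OF assms] unfolding lessThan_Suc_atMost[symmetric]
  by (rule filterlim_sequentially_Suc[THEN iffD1])

text \<open>A convergent product of nonzero factors has a nonzero limit, so the partial products and
  their inverses both converge and hence are bounded.\<close>

lemma convergent_prod_pos_bounds:
  fixes f :: "nat \<Rightarrow> real"
  assumes f: "convergent_prod f" and pos: "\<And>n. 0 < f n"
  obtains c C where "0 < c" "0 < C" "\<And>n. c \<le> (\<Prod>i<n. f i)" "\<And>n. (\<Prod>i<n. f i) \<le> C"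
proof -
  let ?p = "\<lambda>n. \<Prod>i<n. f i"
  have p_pos: "0 < ?p n" for n by (intro prod_pos) (use pos in auto)
  have lim: "?p \<longlonglongrightarrow> prodinf f" by (rule convergent_prod_lessThan_LIMSEQ[OF f])
  have nz: "prodinf f \<noteq> 0"
    using pos by (intro prodinf_nonzero[OF f]) (auto simp: less_imp_neq[symmetric])
  from lim have "Bseq ?p" by (intro convergent_imp_Bseq convergentI)
  then obtain C where C: "0 < C" "\<And>n. norm (?p n) \<le> C" by (auto simp: Bseq_def)
  from lim nz have "(\<lambda>n. inverse (?p n)) \<longlonglongrightarrow> inverse (prodinf f)" by (rule tendsto_inverse)
  then have "Bseq (\<lambda>n. inverse (?p n))" by (intro convergent_imp_Bseq convergentI)
  then obtain D where D: "0 < D" "\<And>n. norm (inverse (?p n)) \<le> D" by (auto simp: Bseq_def)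
  have "inverse D \<le> ?p n" for n
    using D(2)[of n] p_pos[of n] D(1) by (simp add: field_simps)
  moreover have "?p n \<le> C" for n using C(2)[of n] p_pos[of n] by simp
  ultimately show ?thesis using that[of "inverse D" C] C(1) D(1) by simp
qed

text \<open>Lets a factor \<open>n + 1\<close> be absorbed into a slightly larger geometric rate.
  The constant is chosen so that Bernoulli's inequality suffices.\<close>

lemma Suc_le_geometric:
  fixes s :: real
  assumes "1 < s"
  shows "\<exists>C>0. \<forall>n. real (Suc n) \<le> C * s ^ n"
proof (intro exI[of _ "1 + 1 / (s - 1)"] conjI allI)
  show "0 < 1 + 1 / (s - 1)" using assms by (simp add: add_pos_nonneg)
  fix n
  have "real (Suc n) \<le> (1 + 1 / (s - 1)) * (1 + real n * (s - 1))"
  proof -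
    have "(1 + 1 / (s - 1)) * (1 + real n * (s - 1)) = 1 + real n * (s - 1) + 1 / (s - 1) + real n"
      using assms by (simp add: field_simps)
    moreover have "0 \<le> real n * (s - 1)" "0 \<le> 1 / (s - 1)" using assms by auto
    ultimately show ?thesis by simp
  qed
  also have "\<dots> \<le> (1 + 1 / (s - 1)) * s ^ n"
    using Bernoulli_inequality[of "s - 1" n] assms by (intro mult_left_mono) auto
  finally show "real (Suc n) \<le> (1 + 1 / (s - 1)) * s ^ n" .
qed

section \<open>Trigonometric form and uniform growth of the polynomials for
  \<open>|q| < 1\<close>\<close>

locale q_param_lt = q_param +
  assumes q_lt: "q < 1"
begin

text \<open>The scale for which \<open>x = 2 * cos t / \<kappa>\<close> runs through
  \<open>S q\<close>.\<close>

definition \<kappa> :: real where "\<kappa> = sqrt (1 - q)"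

lemma kappa_pos [simp]: "0 < \<kappa>" and kappa_sq: "\<kappa>\<^sup>2 = 1 - q" and kappa_neq_0 [simp]: "\<kappa> \<noteq> 0"
  using q_lt by (simp_all add: \<kappa>_def)

lemma abs_q_lt: "\<bar>q\<bar> < 1"
  using q_gt q_lt by simp

lemma S_eq: "S q = {- 2 / \<kappa> .. 2 / \<kappa>}"
  using q_lt by (simp add: S_def \<kappa>_def)

lemma S_iff: "x \<in> S q \<longleftrightarrow> \<bar>\<kappa> * x\<bar> \<le> 2"
  using kappa_pos by (auto simp: S_eq field_simps abs_le_iff simp del: kappa_pos)

lemma S_param:
  assumes "x \<in> S q"
  obtains t where "x = 2 * cos t / \<kappa>"
proof
  show "x = 2 * cos (arccos (\<kappa> * x / 2)) / \<kappa>"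
    using assms by (subst cos_arccos) (auto simp: S_iff abs_le_iff)
qed

lemma summable_abs_q_power: "summable (\<lambda>n. \<bar>q\<bar> ^ n)"
  using abs_q_lt by (intro summable_geometric) simp

lemma q_power_less_1: "q ^ Suc n < 1"
proof -
  have "\<bar>q\<bar> ^ Suc n < 1"
    using abs_q_lt by (intro power_less_one_iff[THEN iffD2]) auto
  then show ?thesis by (metis abs_ge_self le_less_trans power_abs)
qed

lemma convergent_prod_euler: "convergent_prod (\<lambda>k. 1 - q ^ (k + 1))"
proof (rule convergent_prod_one_plus)
  show "summable (\<lambda>n. \<bar>1 - q ^ (n + 1) - 1\<bar>)"
    using summable_mult[OF summable_abs_q_power, of "\<bar>q\<bar>"] by (simp add: abs_mult power_abs)
qed

lemma prod_euler_eq: "(\<Prod>k<n. 1 - q ^ (k + 1)) = (1 - q) ^ n * qf n"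
proof (induction n)
  case (Suc n)
  then show ?case
    using q_int_geometric[of "Suc n"] by (simp add: q_fact_Suc mult_ac del: power_Suc) (simp add: mult_ac)
qed simp

text \<open>\<open>(1 - q) ^ n * qf n\<close> is a partial product of Euler's product, whose factors
  are positive and whose limit is nonzero.\<close>

lemma q_fact_bounds:
  obtains c C where "0 < c" "0 < C" "\<And>n. c \<le> (1 - q) ^ n * qf n" "\<And>n. (1 - q) ^ n * qf n \<le> C"
proof -
  have "0 < 1 - q ^ (n + 1)" for n using q_power_less_1[of n] by simp
  from convergent_prod_pos_bounds[OF convergent_prod_euler this] that show ?thesis
    unfolding prod_euler_eq by blast
qed

text \<open>The powers of \<open>1 - q\<close> cancel in the quotient of factorials. This bound is
  what makes the triple series converge absolutely.\<close>

lemma q_binomial_bounded: "\<exists>K>0. \<forall>n k. qb n k \<le> K"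
proof -
  obtain c C where c: "0 < c" "0 < C" "\<And>n. c \<le> (1 - q) ^ n * qf n" "\<And>n. (1 - q) ^ n * qf n \<le> C"
    by (rule q_fact_bounds) blast
  have "qb n k \<le> C / (c * c)" if "k \<le> n" for n k
  proof -
    have "(1 - q) ^ n = (1 - q) ^ k * (1 - q) ^ (n - k)" using that by (simp flip: power_add)
    then have "qb n k = ((1 - q) ^ n * qf n) / (((1 - q) ^ k * qf k) * ((1 - q) ^ (n - k) * qf (n - k)))"
      using that q_lt by (simp add: q_binomial_def)
    also have "\<dots> \<le> C / (c * c)"
      using c q_lt by (intro frac_le mult_mono) (auto intro: less_imp_le)
    finally show ?thesis .
  qed
  moreover have "qb n k \<le> C / (c * c)" if "\<not> k \<le> n" for n k
    using that c by (simp add: q_binomial_def)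
  ultimately have "qb n k \<le> C / (c * c)" for n k by (cases "k \<le> n") auto
  then show ?thesis using c(1,2) by (intro exI[of _ "C / (c * c)"]) simp
qed

text \<open>The Rogers-Szego form. Both sides satisfy the same three-term recurrence; on the cosine
  side it follows from the Pascal rule and the addition theorem.\<close>

lemma Hermite_cos:
  "\<kappa> ^ n * H n (2 * cos t / \<kappa>) = (\<Sum>j\<le>n. qb n j * cos ((real n - 2 * real j) * t))"
proof -
  let ?c = "\<lambda>n. \<Sum>j\<le>n. qb n j * cos ((real n - 2 * real j) * t)"
  let ?h = "\<lambda>n. \<kappa> ^ n * H n (2 * cos t / \<kappa>)"
  have rec: "?c (Suc (Suc n)) = 2 * cos t * ?c (Suc n) - (1 - q) * qi (Suc n) * ?c n" for n
  proof -
    define N where "N = Suc n"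
    define C where "C = (\<lambda>j. cos ((real (Suc N) - 2 * real j) * t))"
    have "?c (Suc N) = C 0 + (\<Sum>j\<le>N. qb (Suc N) (Suc j) * C (Suc j))"
      by (subst sum.atMost_Suc_shift) (simp add: C_def)
    also have "(\<Sum>j\<le>N. qb (Suc N) (Suc j) * C (Suc j)) =
        (\<Sum>j\<le>N. qb N j * C (Suc j) + qb N (Suc j) * C (Suc j) - (1 - q) * qi N * (qb n j * C (Suc j)))"
    proof (intro sum.cong refl)
      fix j
      \<comment> \<open>Rewriting the Pascal weight in this way splits off a term in which
        \<open>q_binomial_absorb\<close> lowers \<open>N\<close> to \<open>n\<close>; it becomes the
        \<open>qi\<close> part of the recurrence.\<close>
      have "q ^ Suc j = 1 - (1 - q) * qi (Suc j)" by (simp only: q_int_geometric)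
      then have "q ^ Suc j * qb N (Suc j) = qb N (Suc j) - (1 - q) * (qi (Suc j) * qb N (Suc j))"
        by (simp only: left_diff_distrib mult_1 mult.assoc)
      also have "qi (Suc j) * qb N (Suc j) = qi N * qb n j" unfolding N_def by (rule q_binomial_absorb)
      finally have "qb (Suc N) (Suc j) = qb N j + (qb N (Suc j) - (1 - q) * (qi N * qb n j))"
        by (simp only: q_binomial_Suc_Suc)
      then show "qb (Suc N) (Suc j) * C (Suc j) =
          qb N j * C (Suc j) + qb N (Suc j) * C (Suc j) - (1 - q) * qi N * (qb n j * C (Suc j))"
        by (simp only: ring_distribs mult.assoc)
    qed
    also have "\<dots> = (\<Sum>j\<le>N. qb N j * C (Suc j)) + (\<Sum>j\<le>N. qb N (Suc j) * C (Suc j))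
        - (1 - q) * qi N * (\<Sum>j\<le>N. qb n j * C (Suc j))"
      by (simp only: sum.distrib sum_subtractf sum_distrib_left)
    also have "(\<Sum>j\<le>N. qb n j * C (Suc j)) = ?c n"
      by (simp add: N_def C_def algebra_simps)
    also have "(\<Sum>j\<le>N. qb N (Suc j) * C (Suc j)) = (\<Sum>j\<le>N. qb N j * C j) - C 0"
    proof -
      have "(\<Sum>j\<le>Suc N. qb N j * C j) = C 0 + (\<Sum>j\<le>N. qb N (Suc j) * C (Suc j))"
        by (subst sum.atMost_Suc_shift) simp
      then show ?thesis by simp
    qed
    finally have "?c (Suc N) = (\<Sum>j\<le>N. qb N j * (C j + C (Suc j))) - (1 - q) * qi N * ?c n"
      by (simp add: sum.distrib algebra_simps)
    also have "(\<Sum>j\<le>N. qb N j * (C j + C (Suc j))) = 2 * cos t * ?c N"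
      unfolding sum_distrib_left
    proof (intro sum.cong refl)
      fix j
      have "C j + C (Suc j) = 2 * cos t * cos ((real N - 2 * real j) * t)"
        using cos_add[of "(real N - 2 * real j) * t" t] cos_diff[of "(real N - 2 * real j) * t" t]
        by (simp add: C_def algebra_simps)
      then show "qb N j * (C j + C (Suc j)) = 2 * cos t * (qb N j * cos ((real N - 2 * real j) * t))"
        by simp
    qed
    finally show ?thesis by (simp add: N_def)
  qed
  have "?h n = ?c n \<and> ?h (Suc n) = ?c (Suc n)"
  proof (induction n)
    case (Suc n)
    have "?h (Suc (Suc n)) = 2 * cos t * ?h (Suc n) - \<kappa>\<^sup>2 * qi (Suc n) * ?h n"
      by (simp add: algebra_simps power2_eq_square)
    then show ?case using Suc rec[of n] by (simp add: kappa_sq)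
  qed (simp add: atMost_Suc)
  then show ?thesis by blast
qed

text \<open>The cosine sum has \<open>n + 1\<close> terms of size at most \<open>K\<close>, and
  \<open>\<kappa> ^ n\<close> is comparable to \<open>1 / sqrt (qf n)\<close>. The constant does not
  depend on \<open>x\<close>, as termwise integration over \<open>S q\<close> requires.\<close>

lemma Hermite_growth_uniform:
  assumes "1 < s"
  shows "\<exists>C>0. \<forall>x\<in>S q. \<forall>n. \<bar>H n x\<bar> \<le> C * s ^ n * sqrt (qf n)"
proof -
  obtain c where c: "0 < c" "\<And>n. c \<le> (1 - q) ^ n * qf n"
    by (rule q_fact_bounds) blast
  obtain K where K: "0 < K" "\<And>n k. qb n k \<le> K" using q_binomial_bounded by blast
  obtain D where D: "0 < D" "\<And>n. real (Suc n) \<le> D * s ^ n" using Suc_le_geometric[OF assms] by blast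
  have "\<bar>H n x\<bar> \<le> K * D / sqrt c * s ^ n * sqrt (qf n)" if "x \<in> S q" for x n
  proof -
    from that obtain t where x: "x = 2 * cos t / \<kappa>" by (rule S_param)
    have "\<kappa> ^ n * \<bar>H n x\<bar> = \<bar>\<Sum>j\<le>n. qb n j * cos ((real n - 2 * real j) * t)\<bar>"
      unfolding x Hermite_cos[symmetric] by (simp add: abs_mult abs_of_pos)
    also have "\<dots> \<le> (\<Sum>j\<le>n. K)"
    proof (rule order_trans[OF sum_abs sum_mono])
      fix j
      have "\<bar>qb n j\<bar> * \<bar>cos ((real n - 2 * real j) * t)\<bar> \<le> K * 1"
        using K by (intro mult_mono) auto
      then show "\<bar>qb n j * cos ((real n - 2 * real j) * t)\<bar> \<le> K" by (simp add: abs_mult)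
    qed
    also have "\<dots> = K * real (Suc n)" by simp
    also have "\<dots> \<le> K * (D * s ^ n)" using D(2)[of n] K(1) by (intro mult_left_mono) auto
    also have "\<dots> = K * D * s ^ n" by simp
    finally have *: "\<kappa> ^ n * \<bar>H n x\<bar> \<le> K * D * s ^ n" .
    have "sqrt c \<le> sqrt ((1 - q) ^ n * qf n)" using c(2) by simp
    also have "\<dots> = \<kappa> ^ n * sqrt (qf n)" by (simp add: real_sqrt_mult real_sqrt_power \<kappa>_def)
    finally have "K * D * s ^ n * sqrt c \<le> K * D * s ^ n * (\<kappa> ^ n * sqrt (qf n))"
      using K D assms by (intro mult_left_mono) auto
    moreover have "\<kappa> ^ n * \<bar>H n x\<bar> * sqrt c \<le> K * D * s ^ n * sqrt c"
      using * c by (intro mult_right_mono) auto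
    ultimately have "\<kappa> ^ n * \<bar>H n x\<bar> * sqrt c \<le> K * D * s ^ n * (\<kappa> ^ n * sqrt (qf n))"
      by (rule order_trans[rotated])
    then have "\<kappa> ^ n * (\<bar>H n x\<bar> * sqrt c) \<le> \<kappa> ^ n * (K * D * s ^ n * sqrt (qf n))"
      by (simp only: mult.assoc mult.left_commute[of "\<kappa> ^ n"])
    moreover have "0 < \<kappa> ^ n" by simp
    ultimately have "\<bar>H n x\<bar> * sqrt c \<le> K * D * s ^ n * sqrt (qf n)" by (rule mult_left_le_imp_le)
    then show ?thesis using c(1) by (simp add: field_simps)
  qed
  then show ?thesis using K D c by (intro exI[of _ "K * D / sqrt c"]) auto
qed

end

text \<open>For \<open>a n = |H n x| / sqrt (n!)\<close> the recurrence gives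
  \<open>a (n + 2) \<le> (s - 1) * a (n + 1) + a n\<close> as soon as
  \<open>|x| \<le> (s - 1) * sqrt (n + 2)\<close>, and \<open>(s - 1) * s + 1 \<le> s^2\<close> then
  propagates a geometric bound. The threshold, and so the constant, depends on
  \<open>x\<close>.\<close>

lemma Hermite_growth_one:
  fixes x s :: real
  assumes s: "1 < s"
  shows "\<exists>C>0. \<forall>n. \<bar>q_Hermite n x 1\<bar> \<le> C * s ^ n * sqrt (q_fact n 1)"
proof -
  interpret q_param 1 by unfold_locales auto
  define a where "a n = \<bar>H n x\<bar> / sqrt (qf n)" for n
  obtain N where N: "(x / (s - 1))\<^sup>2 \<le> real N" using real_arch_simple by blast
  \<comment> \<open>Covers all indices before the recurrence takes hold; the summand 1 keeps it
    positive.\<close>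
  define C where "C = 1 + (\<Sum>n\<le>Suc N. a n)"
  have a_nonneg: "0 \<le> a n" for n by (simp add: a_def less_imp_le)
  have qi: "qi n = real n" for n by (simp add: q_int_def)
  have rec: "a (Suc (Suc n)) \<le> (s - 1) * a (Suc n) + a n" if "N \<le> n" for n
  proof -
    have r: "\<bar>x\<bar> \<le> (s - 1) * sqrt (real (Suc (Suc n)))"
    proof -
      have "(x / (s - 1))\<^sup>2 \<le> real (Suc (Suc n))" using N that by linarith
      then have "sqrt ((x / (s - 1))\<^sup>2) \<le> sqrt (real (Suc (Suc n)))" by (rule real_sqrt_le_mono)
      then have "\<bar>x\<bar> / (s - 1) \<le> sqrt (real (Suc (Suc n)))" using s by (simp add: abs_divide)
      moreover have "0 < s - 1" using s by simp
      ultimately have "\<bar>x\<bar> \<le> sqrt (real (Suc (Suc n))) * (s - 1)" by (simp only: pos_divide_le_eq)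
      then show ?thesis by (simp only: mult.commute)
    qed
    have "\<bar>H (Suc (Suc n)) x\<bar> \<le> \<bar>x\<bar> * \<bar>H (Suc n) x\<bar> + real (Suc n) * \<bar>H n x\<bar>"
    proof -
      have "\<bar>real (Suc n) * H n x\<bar> = real (Suc n) * \<bar>H n x\<bar>" by (simp add: abs_mult)
      then show ?thesis
        using abs_triangle_ineq4[of "x * H (Suc n) x" "real (Suc n) * H n x"] by (simp add: qi abs_mult)
    qed
    also have "\<dots> \<le> (s - 1) * sqrt (real (Suc (Suc n))) * \<bar>H (Suc n) x\<bar> + real (Suc n) * \<bar>H n x\<bar>"
      by (intro add_right_mono mult_right_mono r) simp
    finally have 1: "\<bar>H (Suc (Suc n)) x\<bar> \<le> \<dots>" .
    define u v where "u = sqrt (real (Suc (Suc n)))" and "v = sqrt (real (Suc n))"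
    have uv: "0 < u" "0 < v" "v \<le> u" "real (Suc n) = v * v" by (auto simp: u_def v_def)
    define f where "f = sqrt (qf n)"
    have f: "0 < f" by (simp add: f_def)
    have f1: "sqrt (qf (Suc n)) = v * f" by (simp add: q_fact_Suc real_sqrt_mult qi v_def f_def)
    have f2: "sqrt (qf (Suc (Suc n))) = u * (v * f)"
      by (simp add: q_fact_Suc[of "Suc n"] f1[symmetric] real_sqrt_mult qi u_def)
    have "a (Suc (Suc n)) \<le> ((s - 1) * u * \<bar>H (Suc n) x\<bar> + v * v * \<bar>H n x\<bar>) / (u * (v * f))"
      unfolding a_def f2 using 1[folded u_def, unfolded uv(4)] uv(1,2) f by (intro divide_right_mono) auto
    also have "\<dots> = (s - 1) * (\<bar>H (Suc n) x\<bar> / (v * f)) + (v / u) * (\<bar>H n x\<bar> / f)"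
      using uv f by (simp add: field_simps)
    also have "\<dots> \<le> (s - 1) * (\<bar>H (Suc n) x\<bar> / (v * f)) + 1 * (\<bar>H n x\<bar> / f)"
      using uv f by (intro add_left_mono mult_right_mono) auto
    finally show ?thesis by (simp add: a_def f1 f_def)
  qed
  have C: "0 < C" unfolding C_def by (intro add_pos_nonneg sum_nonneg a_nonneg) simp
  have "a n \<le> C * s ^ n" for n
  proof (induction n rule: less_induct)
    case (less n)
    show ?case
    proof (cases "n \<le> Suc N")
      case True
      then have "a n \<le> (\<Sum>n\<le>Suc N. a n)" by (intro member_le_sum) (auto intro: a_nonneg)
      then have "a n \<le> C * 1" by (simp add: C_def)
      also have "\<dots> \<le> C * s ^ n" using C s by (intro mult_left_mono) auto
      finally show ?thesis .
    next
      case False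
      then have "n = Suc (Suc (n - 2)) \<and> N \<le> n - 2" by linarith
      then obtain m where n: "n = Suc (Suc m)" "N \<le> m" by blast
      have "a n \<le> (s - 1) * a (Suc m) + a m" using rec[OF n(2)] n(1) by simp
      also have "\<dots> \<le> (s - 1) * (C * s ^ Suc m) + C * s ^ m"
        using less[of "Suc m"] less[of m] s n(1) by (intro add_mono mult_left_mono) auto
      also have "\<dots> = C * s ^ m * ((s - 1) * s + 1)" by (simp add: algebra_simps)
      also have "\<dots> \<le> C * s ^ m * s\<^sup>2"
        using C s by (intro mult_left_mono) (auto simp: power2_eq_square algebra_simps)
      finally show ?thesis by (simp add: n power2_eq_square mult_ac)
    qed
  qed
  then have "\<bar>H n x\<bar> \<le> C * s ^ n * sqrt (qf n)" for n
    by (simp add: a_def pos_divide_le_eq)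
  with C show ?thesis by blast
qed

context q_param
begin

lemma Hermite_growth:
  assumes "x \<in> S q" "1 < s"
  shows "\<exists>C>0. \<forall>n. \<bar>H n x\<bar> \<le> C * s ^ n * sqrt (qf n)"
proof (cases "q = 1")
  case True
  then show ?thesis using Hermite_growth_one[OF assms(2)] by simp
next
  case False
  then interpret q_param_lt q using q_le by unfold_locales simp
  show ?thesis using Hermite_growth_uniform[OF assms(2)] assms(1) by blast
qed

text \<open>The comparison is with \<open>sqrt (qf n)\<close>, not \<open>sqrt (qf (a + n))\<close>.
  Each unit of shift costs a factor \<open>sqrt (qi (Suc n))\<close>, at most \<open>n + 1\<close>,
  which one of the two factors \<open>u\<close> in \<open>s = u * u\<close> absorbs.\<close>

lemma Hermite_growth_shift:
  assumes "x \<in> S q" "1 < s"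
  shows "\<exists>C>0. \<forall>n. \<bar>H (a + n) x\<bar> \<le> C * s ^ n * sqrt (qf n)"
  using assms(2)
proof (induction a arbitrary: s)
  case 0
  then show ?case using Hermite_growth[OF assms(1)] by simp
next
  case (Suc a)
  define u where "u = sqrt s"
  have u: "1 < u" "u * u = s" using Suc.prems by (auto simp: u_def)
  obtain C where C: "0 < C" "\<And>n. \<bar>H (a + n) x\<bar> \<le> C * u ^ n * sqrt (qf n)" using Suc.IH[OF u(1)] by blast
  obtain D where D: "0 < D" "\<And>n. real (Suc n) \<le> D * u ^ n" using Suc_le_geometric[OF u(1)] by blast
  have "\<bar>H (Suc a + n) x\<bar> \<le> C * u * D * s ^ n * sqrt (qf n)" for n
  proof -
    have "sqrt (qi (Suc n)) \<le> sqrt (real (Suc n))" using q_int_le by (intro real_sqrt_le_mono)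
    also have "\<dots> \<le> real (Suc n)" by (intro real_le_lsqrt) (auto simp: power2_eq_square)
    also have "\<dots> \<le> D * u ^ n" by (rule D)
    finally have *: "sqrt (qi (Suc n)) \<le> D * u ^ n" .
    have "\<bar>H (Suc a + n) x\<bar> \<le> C * u ^ Suc n * sqrt (qf (Suc n))" using C(2)[of "Suc n"] by simp
    also have "\<dots> = C * u ^ Suc n * sqrt (qf n) * sqrt (qi (Suc n))" by (simp add: q_fact_Suc real_sqrt_mult)
    also have "\<dots> \<le> C * u ^ Suc n * sqrt (qf n) * (D * u ^ n)"
      using * C u by (intro mult_left_mono) (auto intro: less_imp_le)
    also have "\<dots> = C * u * D * (u * u) ^ n * sqrt (qf n)" by (simp add: power_mult_distrib)
    finally show ?thesis by (simp add: u)
  qed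
  then show ?case using C D u by (intro exI[of _ "C * u * D"]) auto
qed

end

section \<open>Mehler kernels\<close>

lemma exists_power_mult_less_1:
  fixes c :: real
  assumes "c < 1"
  shows "\<exists>s>1. s ^ k * c < 1"
proof -
  have "((\<lambda>s. s ^ k * c) \<longlongrightarrow> 1 ^ k * c) (at_right 1)"
    by (intro tendsto_intros)
  then have "\<forall>\<^sub>F s in at_right 1. s ^ k * c < 1"
    by (rule order_tendstoD) (use assms in simp)
  then have "\<forall>\<^sub>F s in at_right 1. 1 < s \<and> s ^ k * c < 1"
    using eventually_at_right_less by (rule eventually_conj[rotated])
  then show ?thesis using eventually_happens[of _ "at_right (1::real)"] by auto
qed

text \<open>The index only rescales the parameter, so the product of all \<open>w k\<close> arises
  by iterating one functional equation from \<open>r\<close> to \<open>r * q\<close>.\<close>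

lemma w_eq_w_0: "w k y z r q = w 0 y z (r * q ^ k) q"
  by (simp add: w_def power_mult_distrib power_mult power_even_eq algebra_simps)

section \<open>Recurrences and q-difference equation of the kernels\<close>

context q_param
begin

definition A_term :: "nat \<Rightarrow> nat \<Rightarrow> real \<Rightarrow> real \<Rightarrow> real \<Rightarrow> nat \<Rightarrow> real" where
  "A_term a b y z r c = r ^ c / qf c * H (a + c) y * H (b + c) z"

definition A :: "nat \<Rightarrow> nat \<Rightarrow> real \<Rightarrow> real \<Rightarrow> real \<Rightarrow> real" where
  "A a b y z r = (\<Sum>c. A_term a b y z r c)"

lemma A_commute: "A a b y z r = A b a z y r"
  by (simp add: A_def A_term_def mult_ac)

lemma abs_mult_q_power_less_1: "\<bar>r\<bar> < 1 \<Longrightarrow> \<bar>r * q ^ k\<bar> < 1"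
  using abs_q_power_le[of k] mult_left_mono[of "\<bar>q ^ k\<bar>" 1 "\<bar>r\<bar>"] by (simp add: abs_mult)

lemma summable_A_term_abs:
  assumes "y \<in> S q" "z \<in> S q" "\<bar>r\<bar> < 1"
  shows "summable (\<lambda>c. \<bar>A_term a b y z r c\<bar>)"
proof -
  obtain s where s: "1 < s" "s ^ 2 * \<bar>r\<bar> < 1" using exists_power_mult_less_1[OF assms(3)] by blast
  obtain C where C: "0 < C" "\<And>n. \<bar>H (a + n) y\<bar> \<le> C * s ^ n * sqrt (qf n)"
    using Hermite_growth_shift[OF assms(1) s(1)] by blast
  obtain D where D: "0 < D" "\<And>n. \<bar>H (b + n) z\<bar> \<le> D * s ^ n * sqrt (qf n)"
    using Hermite_growth_shift[OF assms(2) s(1)] by blast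
  show ?thesis
  proof (rule summable_comparison_test')
    show "summable (\<lambda>c. C * D * (s ^ 2 * \<bar>r\<bar>) ^ c)"
      using s by (intro summable_mult summable_geometric) auto
    fix c
    have "\<bar>A_term a b y z r c\<bar> = \<bar>r\<bar> ^ c / qf c * (\<bar>H (a + c) y\<bar> * \<bar>H (b + c) z\<bar>)"
      by (simp add: A_term_def abs_mult power_abs)
    also have "\<dots> \<le> \<bar>r\<bar> ^ c / qf c * ((C * s ^ c * sqrt (qf c)) * (D * s ^ c * sqrt (qf c)))"
      using C D s by (intro mult_left_mono mult_mono) auto
    also have "\<dots> = C * D * (s ^ 2 * \<bar>r\<bar>) ^ c * ((sqrt (qf c) * sqrt (qf c)) / qf c)"
      by (simp only: power_mult_distrib power2_eq_square) (simp add: mult_ac)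
    also have "\<dots> = C * D * (s ^ 2 * \<bar>r\<bar>) ^ c" by simp
    finally show "norm \<bar>A_term a b y z r c\<bar> \<le> C * D * (s ^ 2 * \<bar>r\<bar>) ^ c" by simp
  qed
qed

lemma sums_A:
  assumes "y \<in> S q" "z \<in> S q" "\<bar>r\<bar> < 1"
  shows "A_term a b y z r sums A a b y z r"
  using summable_rabs_cancel[OF summable_A_term_abs[OF assms]]
  by (simp add: A_def[abs_def] summable_sums)

lemma A_rec1:
  assumes "y \<in> S q" "z \<in> S q" "\<bar>r\<bar> < 1"
  shows "y * A a b y z r = A (Suc a) b y z r + qi a * A (a - 1) b y z r + q ^ a * r * A a (Suc b) y z r"
proof -
  note A = sums_A[OF assms]
  \<comment> \<open>The contribution of \<open>qi c\<close> in
    \<open>qi (a + c) = qi a + q ^ a * qi c\<close>. Cancelling it against \<open>qf c\<close>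
    shifts the index by one; the term \<open>c = 0\<close> vanishes since
    \<open>qi 0 = 0\<close>.\<close>
  define B where "B c = r ^ c / qf c * qi c * H (a + c - 1) y * H (b + c) z" for c
  have "(\<lambda>c. B (Suc c)) sums (r * A a (Suc b) y z r)"
    using sums_mult[OF A[of a "Suc b"], of r]
    by (simp add: B_def A_term_def q_fact_Suc mult_ac)
  then have B: "B sums (r * A a (Suc b) y z r)"
    by (subst (asm) sums_Suc_iff) (simp add: B_def)
  have "(\<lambda>c. A_term (Suc a) b y z r c + qi a * A_term (a - 1) b y z r c + q ^ a * B c) sums
      (A (Suc a) b y z r + qi a * A (a - 1) b y z r + q ^ a * (r * A a (Suc b) y z r))"
    by (intro sums_add sums_mult A B)
  also have "(\<lambda>c. A_term (Suc a) b y z r c + qi a * A_term (a - 1) b y z r c + q ^ a * B c) =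
      (\<lambda>c. y * A_term a b y z r c)"
  proof
    fix c
    have "y * H (a + c) y = H (Suc a + c) y + qi (a + c) * H (a + c - 1) y"
      using Hermite_mult[of y "a + c"] by simp
    also have "\<dots> = H (Suc a + c) y + qi a * H (a - 1 + c) y + q ^ a * qi c * H (a + c - 1) y"
      unfolding q_int_add[of a c] by (cases a) (simp_all add: algebra_simps)
    finally have *: "y * H (a + c) y = \<dots>" .
    have "y * A_term a b y z r c = r ^ c / qf c * (y * H (a + c) y) * H (b + c) z"
      by (simp add: A_term_def)
    then show "A_term (Suc a) b y z r c + qi a * A_term (a - 1) b y z r c + q ^ a * B c =
        y * A_term a b y z r c"
      unfolding * by (simp only: A_term_def B_def ring_distribs mult_ac)
  qed
  finally show ?thesis using sums_unique2[OF sums_mult[OF A]] by (simp add: mult.assoc)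
qed

lemma A_rec2:
  assumes "y \<in> S q" "z \<in> S q" "\<bar>r\<bar> < 1"
  shows "z * A a b y z r = A a (Suc b) y z r + qi b * A a (b - 1) y z r + q ^ b * r * A (Suc a) b y z r"
  using A_rec1[OF assms(2,1,3), of b a] by (simp only: A_commute[of _ _ z y])

text \<open>Four instances of the two recurrences leave only \<open>A 1 1\<close> and
  \<open>A 0 0\<close> once \<open>A 1 0\<close>, \<open>A 0 1\<close> and \<open>A 2 0\<close> are
  eliminated.\<close>

lemma A_11:
  assumes "y \<in> S q" "z \<in> S q" "\<bar>r\<bar> < 1"
  shows "(1 - q * r\<^sup>2) * (1 - r\<^sup>2) * A 1 1 y z r = ((z - r * y) * (y - r * z) + r * (1 - r\<^sup>2)) * A 0 0 y z r"
proof -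
  have 1: "y * A 0 0 y z r = A 1 0 y z r + r * A 0 1 y z r"
    using A_rec1[OF assms, of 0 0] by simp
  have 2: "z * A 0 0 y z r = A 0 1 y z r + r * A 1 0 y z r"
    using A_rec2[OF assms, of 0 0] by simp
  have 3: "y * A 1 0 y z r = A 2 0 y z r + A 0 0 y z r + q * r * A 1 1 y z r"
    using A_rec1[OF assms, of 1 0] by (simp add: numeral_2_eq_2)
  have 4: "z * A 1 0 y z r = A 1 1 y z r + r * A 2 0 y z r"
    using A_rec2[OF assms, of 1 0] by (simp add: numeral_2_eq_2)
  show ?thesis using 1 2 3 4 by algebra
qed

text \<open>Termwise, \<open>r ^ c - (r * q) ^ c = (1 - q) * qi c * r ^ c\<close>: the q-difference
  acts like a derivative and raises both indices.\<close>

lemma A_q_difference: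
  assumes "y \<in> S q" "z \<in> S q" "\<bar>r\<bar> < 1"
  shows "A a b y z r - A a b y z (r * q) = (1 - q) * r * A (Suc a) (Suc b) y z r"
proof -
  have rq: "\<bar>r * q\<bar> < 1" using abs_mult_q_power_less_1[OF assms(3), of 1] by simp
  let ?D = "\<lambda>c. A_term a b y z r c - A_term a b y z (r * q) c"
  have D: "?D c = (1 - q) * qi c * A_term a b y z r c" for c
    by (simp add: q_int_geometric) (simp add: A_term_def power_mult_distrib algebra_simps diff_divide_distrib)
  have "(\<lambda>c. ?D (Suc c)) = (\<lambda>c. (1 - q) * r * A_term (Suc a) (Suc b) y z r c)"
    unfolding D by (rule ext) (simp add: A_term_def q_fact_Suc)
  then have "(\<lambda>c. ?D (Suc c)) sums ((1 - q) * r * A (Suc a) (Suc b) y z r)"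
    by (simp only: sums_mult sums_A[OF assms])
  moreover have "?D 0 = 0" by (simp add: A_term_def)
  ultimately have "?D sums ((1 - q) * r * A (Suc a) (Suc b) y z r)"
    by (subst (asm) sums_Suc_iff) simp
  moreover have "?D sums (A a b y z r - A a b y z (r * q))"
    by (intro sums_diff sums_A assms rq)
  ultimately show ?thesis by (rule sums_unique2[symmetric])
qed

text \<open>Once \<open>A 1 1\<close> is expressed by \<open>A 0 0\<close>, the remaining
  coefficient is precisely the factor \<open>w 0\<close> of the density.\<close>

lemma A_00_functional_equation:
  assumes "y \<in> S q" "z \<in> S q" "\<bar>r\<bar> < 1"
  shows "A 0 0 y z (r * q) * (1 - r\<^sup>2) * (1 - q * r\<^sup>2) = w 0 y z r q * A 0 0 y z r"
proof -
  have "A 0 0 y z (r * q) = A 0 0 y z r - (1 - q) * r * A 1 1 y z r"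
    using A_q_difference[OF assms, of 0 0] by simp
  then show ?thesis using A_11[OF assms] by (simp add: w_def) algebra
qed

lemma A_00_powser:
  "A 0 0 y z r = (\<Sum>c. H c y * H c z / qf c * r ^ c)"
  by (simp add: A_def A_term_def mult_ac)

lemma summable_A_00:
  assumes "y \<in> S q" "z \<in> S q" "\<bar>r\<bar> < 1"
  shows "summable (\<lambda>c. H c y * H c z / qf c * r ^ c)"
  using sums_summable[OF sums_A[OF assms, of 0 0]] by (simp add: A_term_def[abs_def] mult_ac)

lemma A_00_at_0: "A 0 0 y z 0 = 1"
  unfolding A_00_powser by (subst powser_zero) simp

lemma isCont_A_00:
  assumes "y \<in> S q" "z \<in> S q"
  shows "isCont (A 0 0 y z) 0"
proof -
  have "isCont (\<lambda>r. \<Sum>c. H c y * H c z / qf c * r ^ c) 0"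
    by (rule isCont_powser[of _ "1 / 2"]) (use summable_A_00[OF assms, of "1 / 2"] in auto)
  moreover have "(\<lambda>r. \<Sum>c. H c y * H c z / qf c * r ^ c) = A 0 0 y z"
    by (rule ext) (simp only: A_00_powser)
  ultimately show ?thesis by (simp only:)
qed

end

section \<open>The Mehler formula for \<open>|q| < 1\<close>\<close>

context q_param_lt
begin

text \<open>With \<open>Y = \<kappa> * y\<close> and \<open>Z = \<kappa> * z\<close>, completing the
  square gives two nonnegative terms. The second vanishes only for \<open>|Z| = 2\<close>, and then
  the first does not, because \<open>|r * Y| \<le> 2 * |r| < 1 + r^2\<close>.\<close>

lemma w_0_pos:
  assumes "y \<in> S q" "z \<in> S q" "\<bar>r\<bar> < 1"
  shows "0 < w 0 y z r q"
proof -
  define Y Z where "Y = \<kappa> * y" and "Z = \<kappa> * z"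
  have YZ: "\<bar>Y\<bar> \<le> 2" "\<bar>Z\<bar> \<le> 2" using assms(1,2) by (simp_all add: S_iff Y_def Z_def)
  have w: "w 0 y z r q = (r * Y - (1 + r\<^sup>2) * Z / 2)\<^sup>2 + (1 - r\<^sup>2)\<^sup>2 * (1 - Z\<^sup>2 / 4)"
    unfolding w_def Y_def Z_def kappa_sq[symmetric]
    by (simp add: power2_eq_square algebra_simps) (simp add: field_simps)
  have "Z\<^sup>2 \<le> 2\<^sup>2" using power_mono[OF YZ(2), of 2] by simp
  have r: "0 < 1 - r\<^sup>2" using assms(3) by (simp add: abs_square_less_1)
  show ?thesis
  proof (cases "Z\<^sup>2 = 4")
    case False
    then have "0 < 1 - Z\<^sup>2 / 4" using \<open>Z\<^sup>2 \<le> 2\<^sup>2\<close> by simp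
    then show ?thesis unfolding w using r by (intro add_nonneg_pos mult_pos_pos) auto
  next
    case True
    then have Z: "\<bar>Z\<bar> = 2" using power2_eq_iff_nonneg[of "\<bar>Z\<bar>" 2] by simp
    have "\<bar>r * Y\<bar> \<le> \<bar>r\<bar> * 2" using YZ(1) by (simp add: abs_mult mult_left_mono)
    also have "\<dots> < 1 + r\<^sup>2"
    proof -
      have "0 < (1 - \<bar>r\<bar>)\<^sup>2" using assms(3) by simp
      then show ?thesis by (simp add: power2_eq_square algebra_simps)
    qed
    also have "\<dots> = \<bar>(1 + r\<^sup>2) * Z / 2\<bar>" using Z by (simp add: abs_mult add_nonneg_nonneg)
    finally have "r * Y - (1 + r\<^sup>2) * Z / 2 \<noteq> 0" by auto
    then show ?thesis unfolding w using True by simp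
  qed
qed

lemma w_pos:
  assumes "y \<in> S q" "z \<in> S q" "\<bar>r\<bar> < 1"
  shows "0 < w k y z r q"
  using w_0_pos[OF assms(1,2) abs_mult_q_power_less_1[OF assms(3)]] by (simp flip: w_eq_w_0)

lemma convergent_prod_w:
  assumes "\<bar>r\<bar> < 1"
  shows "convergent_prod (\<lambda>k. w k y z r q)"
proof (rule convergent_prod_one_plus)
  \<comment> \<open>Bounds the cofactor of \<open>s = r * q ^ k\<close> in
    \<open>w k y z r q - 1\<close>, using \<open>|s| \<le> 1\<close>.\<close>
  define D where "D = 3 + 2 * \<bar>(1 - q) * (y * z)\<bar> + \<bar>(1 - q) * (y\<^sup>2 + z\<^sup>2)\<bar>"
  show "summable (\<lambda>k. \<bar>w k y z r q - 1\<bar>)"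
  proof (rule summable_comparison_test')
    show "summable (\<lambda>k. D * \<bar>q\<bar> ^ k)" by (intro summable_mult summable_abs_q_power)
    fix k
    define s where "s = r * q ^ k"
    have s: "\<bar>s\<bar> \<le> 1" using abs_mult_q_power_less_1[OF assms, of k] by (simp add: s_def)
    have s2: "s\<^sup>2 \<le> 1" using s by (simp add: abs_square_le_1)
    have "w k y z r q - 1 = s * (s * (s\<^sup>2 - 2) - (1 + s\<^sup>2) * ((1 - q) * (y * z)) + s * ((1 - q) * (y\<^sup>2 + z\<^sup>2)))"
      unfolding w_eq_w_0[of k] s_def[symmetric]
      by (simp add: w_def power2_eq_square algebra_simps)
    also have "\<bar>\<dots>\<bar> \<le> \<bar>s\<bar> * D"
      unfolding abs_mult[of s] D_def
    proof (intro mult_left_mono order_trans[OF abs_triangle_ineq] order_trans[OF abs_triangle_ineq4] add_mono)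
      have "\<bar>s\<bar> * \<bar>s\<^sup>2 - 2\<bar> \<le> 1 * 3" using s s2 zero_le_power2[of s] by (intro mult_mono) linarith+
      then show "\<bar>s * (s\<^sup>2 - 2)\<bar> \<le> 3" by (simp add: abs_mult)
      have "\<bar>1 + s\<^sup>2\<bar> * \<bar>(1 - q) * (y * z)\<bar> \<le> 2 * \<bar>(1 - q) * (y * z)\<bar>"
        using s2 zero_le_power2[of s] by (intro mult_right_mono) linarith+
      then show "\<bar>(1 + s\<^sup>2) * ((1 - q) * (y * z))\<bar> \<le> 2 * \<bar>(1 - q) * (y * z)\<bar>"
        by (simp only: abs_mult)
      show "\<bar>s * ((1 - q) * (y\<^sup>2 + z\<^sup>2))\<bar> \<le> \<bar>(1 - q) * (y\<^sup>2 + z\<^sup>2)\<bar>"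
        unfolding abs_mult[of s] using s by (intro mult_left_le_one_le) auto
    qed simp
    also have "\<dots> \<le> \<bar>q\<bar> ^ k * D"
    proof (rule mult_right_mono)
      show "\<bar>s\<bar> \<le> \<bar>q\<bar> ^ k" using assms by (simp add: s_def abs_mult power_abs mult_left_le_one_le)
    qed (simp add: D_def)
    finally show "norm \<bar>w k y z r q - 1\<bar> \<le> D * \<bar>q\<bar> ^ k" by (simp add: mult.commute)
  qed
qed

lemma convergent_prod_poch: "convergent_prod (\<lambda>i. 1 - a * q ^ i)"
proof (rule convergent_prod_one_plus)
  show "summable (\<lambda>i. \<bar>1 - a * q ^ i - 1\<bar>)"
    using summable_mult[OF summable_abs_q_power, of "\<bar>a\<bar>"] by (simp add: abs_mult power_abs)
qed

lemma q_poch_inf_pos: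
  assumes "\<bar>a\<bar> < 1"
  shows "0 < q_poch_inf a q"
proof -
  have pos: "0 < 1 - a * q ^ i" for i using abs_mult_q_power_less_1[OF assms, of i] by auto
  have "prodinf (\<lambda>i. 1 - a * q ^ i) \<noteq> 0"
    using pos by (intro prodinf_nonzero convergent_prod_poch) (metis less_irrefl)
  moreover have "0 \<le> prodinf (\<lambda>i. 1 - a * q ^ i)"
  proof (rule LIMSEQ_le_const[OF convergent_prod_lessThan_LIMSEQ[OF convergent_prod_poch]])
    have "0 \<le> (\<Prod>i<n. 1 - a * q ^ i)" for n by (rule prod_nonneg) (use pos in \<open>blast intro: less_imp_le\<close>)
    then show "\<exists>N. \<forall>n\<ge>N. 0 \<le> (\<Prod>i<n. 1 - a * q ^ i)" by blast
  qed
  ultimately show ?thesis by (simp add: q_poch_inf_def)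
qed

text \<open>Iterate the functional equation towards \<open>r = 0\<close>.\<close>

lemma Mehler_lt:
  assumes "y \<in> S q" "z \<in> S q" "\<bar>r\<bar> < 1"
  shows "A 0 0 y z r * prodinf (\<lambda>k. w k y z r q) = q_poch_inf (r\<^sup>2) q"
proof -
  have "A 0 0 y z r * (\<Prod>k<n. w k y z r q) = (\<Prod>i<2*n. 1 - r\<^sup>2 * q ^ i) * A 0 0 y z (r * q ^ n)" for n
  proof (induction n)
    case (Suc n)
    have "A 0 0 y z r * (\<Prod>k<Suc n. w k y z r q) =
        (\<Prod>i<2*n. 1 - r\<^sup>2 * q ^ i) * (w n y z r q * A 0 0 y z (r * q ^ n))"
      using Suc by simp
    \<comment> \<open>One step contributes the factors with exponents \<open>2 * n\<close> and
      \<open>2 * n + 1\<close>, so \<open>n\<close> steps exhaust the first \<open>2 * n\<close>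
      factors of the product for \<open>r^2\<close>.\<close>
    also have "w n y z r q * A 0 0 y z (r * q ^ n) =
        A 0 0 y z (r * q ^ Suc n) * ((1 - r\<^sup>2 * q ^ (2 * n)) * (1 - r\<^sup>2 * q ^ Suc (2 * n)))"
      using A_00_functional_equation[OF assms(1,2) abs_mult_q_power_less_1[OF assms(3)], of n]
      by (simp add: w_eq_w_0[of n] power_mult_distrib mult_ac flip: power_mult)
    finally show ?case by (simp add: mult_ac)
  qed simp
  moreover have "(\<lambda>n. A 0 0 y z r * (\<Prod>k<n. w k y z r q)) \<longlonglongrightarrow> A 0 0 y z r * prodinf (\<lambda>k. w k y z r q)"
    by (intro tendsto_mult tendsto_const convergent_prod_lessThan_LIMSEQ convergent_prod_w assms)
  moreover have "(\<lambda>n. (\<Prod>i<2*n. 1 - r\<^sup>2 * q ^ i) * A 0 0 y z (r * q ^ n)) \<longlonglongrightarrow> q_poch_inf (r\<^sup>2) q * 1"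
  proof (intro tendsto_mult)
    have "strict_mono (\<lambda>n::nat. 2 * n)" by (simp add: strict_mono_def)
    from LIMSEQ_subseq_LIMSEQ[OF convergent_prod_lessThan_LIMSEQ[OF convergent_prod_poch] this]
    show "(\<lambda>n. \<Prod>i<2*n. 1 - r\<^sup>2 * q ^ i) \<longlonglongrightarrow> q_poch_inf (r\<^sup>2) q"
      by (simp add: q_poch_inf_def o_def)
    have "(\<lambda>n. r * q ^ n) \<longlonglongrightarrow> r * 0"
      using abs_q_lt by (intro tendsto_mult tendsto_const LIMSEQ_power_zero) simp
    then show "(\<lambda>n. A 0 0 y z (r * q ^ n)) \<longlonglongrightarrow> 1"
      using isCont_tendsto_compose[OF isCont_A_00[OF assms(1,2)], of "\<lambda>n. r * q ^ n"]
      by (simp add: A_00_at_0)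
  qed
  ultimately show ?thesis using LIMSEQ_unique by fastforce
qed

lemma prodinf_w_neq_0:
  assumes "y \<in> S q" "z \<in> S q" "\<bar>r\<bar> < 1"
  shows "prodinf (\<lambda>k. w k y z r q) \<noteq> 0"
  by (intro prodinf_nonzero convergent_prod_w assms) (use w_pos[OF assms] in \<open>metis less_irrefl\<close>)

lemma A_00_eq_lt:
  assumes "y \<in> S q" "z \<in> S q" "\<bar>r\<bar> < 1"
  shows "A 0 0 y z r = q_poch_inf (r\<^sup>2) q / prodinf (\<lambda>k. w k y z r q)"
  using Mehler_lt[OF assms] prodinf_w_neq_0[OF assms] by (simp add: field_simps)

lemma A_00_neq_0_lt:
  assumes "y \<in> S q" "z \<in> S q" "\<bar>r\<bar> < 1"
  shows "A 0 0 y z r \<noteq> 0"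
proof -
  have "\<bar>r\<^sup>2\<bar> < 1" using assms(3) by (simp add: abs_square_less_1)
  from q_poch_inf_pos[OF this] show ?thesis using Mehler_lt[OF assms] by auto
qed

end

section \<open>The Mehler formula at \<open>q = 1\<close> and nonvanishing of the kernel\<close>

context q_param
begin

text \<open>For \<open>q = 1\<close> the functional equation degenerates to a linear differential equation in \<open>r\<close>.\<close>

lemma Mehler_one:
  assumes q: "q = 1" and r: "\<bar>r\<bar> < 1"
  shows "A 0 0 y z r = exp ((r * (y * z) - r\<^sup>2 * (y\<^sup>2 + z\<^sup>2) / 2) / (1 - r\<^sup>2)) / sqrt (1 - r\<^sup>2)"
proof -
  have S: "y \<in> S q" "z \<in> S q" by (simp_all add: S_def q)
  have qi: "qi n = real n" for n by (simp add: q_int_def q)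
  \<comment> \<open>\<open>E\<close> is the reciprocal of the claimed value and \<open>L\<close> the
    logarithmic derivative that \<open>A_11\<close> yields at \<open>q = 1\<close>. Their signs make
    the derivative of \<open>A 0 0 y z x * E x\<close> zero, and this product is 1 at
    \<open>x = 0\<close>.\<close>
  define E where "E = (\<lambda>r. exp (- (r * (y * z) - r\<^sup>2 * (y\<^sup>2 + z\<^sup>2) / 2) / (1 - r\<^sup>2)) * sqrt (1 - r\<^sup>2))"
  define L where "L r = ((z - r * y) * (y - r * z) + r * (1 - r\<^sup>2)) / (1 - r\<^sup>2)\<^sup>2" for r :: real
  have nz: "0 < 1 - x\<^sup>2" if "\<bar>x\<bar> < 1" for x :: real using that by (simp add: abs_square_less_1)
  have F: "(A 0 0 y z has_real_derivative L x * A 0 0 y z x) (at x)" if x: "\<bar>x\<bar> < 1" for x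
  proof -
    obtain K where K: "\<bar>x\<bar> < K" "K < 1" using dense[OF x] by blast
    have "((\<lambda>r. \<Sum>c. H c y * H c z / qf c * r ^ c) has_real_derivative
        (\<Sum>c. diffs (\<lambda>c. H c y * H c z / qf c) c * x ^ c)) (at x)"
      by (rule termdiffs_strong[of _ K]) (use K summable_A_00[OF S, of K] in auto)
    \<comment> \<open>The factor \<open>c + 1\<close> produced by differentiation cancels in
      \<open>qf (Suc c)\<close>.\<close>
    also have "(\<Sum>c. diffs (\<lambda>c. H c y * H c z / qf c) c * x ^ c) = A 1 1 y z x"
      unfolding A_def
      by (intro suminf_cong) (simp add: diffs_def A_term_def q_fact_Suc qi del: of_nat_Suc)
    also have "\<dots> = L x * A 0 0 y z x"
    proof -
      define u N where "u = 1 - x\<^sup>2" and "N = (z - x * y) * (y - x * z) + x * (1 - x\<^sup>2)"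
      have "u * u * A 1 1 y z x = N * A 0 0 y z x" using A_11[OF S x] by (simp add: u_def N_def q)
      moreover have "0 < u" using nz[OF x] by (simp add: u_def)
      moreover have "L x = N / (u * u)" by (simp add: L_def N_def u_def power2_eq_square)
      moreover from \<open>0 < u\<close> have "N / (u * u) * a = N * a / (u * u)" "b = u * u * b / (u * u)" for a b
        by simp_all
      ultimately show ?thesis by metis
    qed
    finally have "((\<lambda>r. \<Sum>c. H c y * H c z / qf c * r ^ c) has_real_derivative L x * A 0 0 y z x) (at x)" .
    moreover have "(\<lambda>r. \<Sum>c. H c y * H c z / qf c * r ^ c) = A 0 0 y z"
      by (rule ext) (simp only: A_00_powser)
    ultimately show ?thesis by (simp only:)
  qed
  have E: "(E has_real_derivative - L x * E x) (at x)" if x: "\<bar>x\<bar> < 1" for x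
  proof -
    define u where "u = 1 - x\<^sup>2"
    have u: "0 < u" using nz[OF x] by (simp add: u_def)
    let ?N = "\<lambda>x. - (x * (y * z) - x\<^sup>2 * (y\<^sup>2 + z\<^sup>2) / 2)"
    have N: "((\<lambda>x. ?N x / (1 - x\<^sup>2)) has_real_derivative
        ((- y * z + x * (y\<^sup>2 + z\<^sup>2)) * u + ?N x * (2 * x)) / u\<^sup>2) (at x)"
    proof -
      have n: "(?N has_real_derivative - y * z + x * (y\<^sup>2 + z\<^sup>2)) (at x)"
        by (auto intro!: derivative_eq_intros simp: algebra_simps)
      have d: "((\<lambda>x. 1 - x\<^sup>2) has_real_derivative - (2 * x)) (at x)"
        by (auto intro!: derivative_eq_intros)
      have "1 - x\<^sup>2 \<noteq> 0" using u by (simp add: u_def)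
      from DERIV_divide[OF n d this] show ?thesis by (simp add: u_def power2_eq_square)
    qed
    have Q: "((\<lambda>x. sqrt (1 - x\<^sup>2)) has_real_derivative - x / sqrt u) (at x)"
      using u unfolding u_def by (auto intro!: derivative_eq_intros simp: field_simps)
    have "(E has_real_derivative
        exp (?N x / u) * (((- y * z + x * (y\<^sup>2 + z\<^sup>2)) * u + ?N x * (2 * x)) / u\<^sup>2) * sqrt u
         + (- x / sqrt u) * exp (?N x / u)) (at x)"
      unfolding E_def u_def[symmetric]
      using DERIV_mult[OF DERIV_fun_exp[OF N] Q] by (simp add: u_def)
    also have "- x / sqrt u = - x / u * sqrt u"
      using u by (simp add: field_simps)
    also have "exp (?N x / u) * (((- y * z + x * (y\<^sup>2 + z\<^sup>2)) * u + ?N x * (2 * x)) / u\<^sup>2) * sqrt u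
         + (- x / u * sqrt u) * exp (?N x / u) =
        ((((- y * z + x * (y\<^sup>2 + z\<^sup>2)) * u + ?N x * (2 * x)) - x * u) / u\<^sup>2) * (exp (?N x / u) * sqrt u)"
      using u by (simp add: field_simps power2_eq_square)
    also have "((- y * z + x * (y\<^sup>2 + z\<^sup>2)) * u + ?N x * (2 * x)) - x * u =
        - ((z - x * y) * (y - x * z) + x * u)"
      by (simp add: u_def power2_eq_square algebra_simps)
    finally show ?thesis by (simp only: E_def L_def u_def minus_divide_left)
  qed
  have "((\<lambda>x. A 0 0 y z x * E x) has_real_derivative 0) (at x within {-1<..<1})" if "x \<in> {-1<..<1}" for x
  proof -
    from that have x: "\<bar>x\<bar> < 1" by auto
    from DERIV_mult[OF F[OF x] E[OF x]] show ?thesis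
      by (auto intro: has_field_derivative_at_within simp: algebra_simps)
  qed
  then have "\<exists>c. \<forall>x\<in>{-1<..<1}. A 0 0 y z x * E x = c"
    by (intro has_field_derivative_zero_constant) auto
  then obtain c where c: "\<And>x. \<bar>x\<bar> < 1 \<Longrightarrow> A 0 0 y z x * E x = c"
    by (auto simp: abs_less_iff)
  from c[of 0] have "c = 1" by (simp add: A_00_at_0 E_def)
  with c[OF r] have *: "A 0 0 y z r * E r = 1" by simp
  show ?thesis using * nz[OF r] unfolding E_def
    by (simp add: exp_minus minus_divide_left[symmetric] field_simps)
qed

lemma A_00_neq_0:
  assumes "y \<in> S q" "z \<in> S q" "\<bar>r\<bar> < 1"
  shows "A 0 0 y z r \<noteq> 0"
proof (cases "q = 1")
  case True
  have "r\<^sup>2 < 1" using assms(3) by (simp add: abs_square_less_1)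
  then show ?thesis using Mehler_one[OF True assms(3)] by simp
next
  case False
  then interpret q_param_lt q using q_le by unfold_locales simp
  show ?thesis by (rule A_00_neq_0_lt[OF assms])
qed

end

section \<open>The polynomials \<open>\<Theta>\<^sub>k\<^sub>,\<^sub>l\<close>\<close>

lemma poly2_simps [simp]:
  "poly2 0 y z = 0" "poly2 1 y z = 1"
  "poly2 (p + p') y z = poly2 p y z + poly2 p' y z"
  "poly2 (p - p') y z = poly2 p y z - poly2 p' y z"
  "poly2 (p * p') y z = poly2 p y z * poly2 p' y z"
  "poly2 (smult s p) y z = poly s z * poly2 p y z"
  "poly2 (pCons s p) y z = poly s z + y * poly2 p y z"
  by (simp_all add: poly2_def)

lemma poly2_sum: "poly2 (\<Sum>i\<in>I. p i) y z = (\<Sum>i\<in>I. poly2 (p i) y z)"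
  by (induction I rule: infinite_finite_induct) simp_all

lemma coeff2_simps [simp]:
  "coeff2 0 i j = 0"
  "coeff2 1 i j = (if i = 0 \<and> j = 0 then 1 else 0)"
  "coeff2 (p + p') i j = coeff2 p i j + coeff2 p' i j"
  "coeff2 (p - p') i j = coeff2 p i j - coeff2 p' i j"
  "coeff2 (smult [:c:] p) i j = c * coeff2 p i j"
  by (simp_all add: coeff2_def)

lemma coeff2_sum: "coeff2 (\<Sum>k\<in>I. p k) i j = (\<Sum>k\<in>I. coeff2 (p k) i j)"
  by (simp add: coeff2_def coeff_sum)

text \<open>The factor encodes \<open>y + c * z\<close>; its mirror below encodes
  \<open>c * y + z\<close>.\<close>

lemma coeff2_mult_linear_y:
  "coeff2 ([:[:0, c:], 1:] * p) i j =
     (if i = 0 then 0 else coeff2 p (i - 1) j) + (if j = 0 then 0 else c * coeff2 p i (j - 1))"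
  by (cases i; cases j) (simp_all add: coeff2_def)

lemma coeff2_mult_linear_z:
  "coeff2 ([:[:0, 1:], [:c:]:] * p) i j =
     (if i = 0 then 0 else c * coeff2 p (i - 1) j) + (if j = 0 then 0 else coeff2 p i (j - 1))"
  by (cases i; cases j) (simp_all add: coeff2_def)

text \<open>The solved form of the recurrences for \<open>A\<close>: eliminating the neighbour
  \<open>(a, b + 1)\<close> leaves the factor \<open>1 - q ^ (a + b) * r^2\<close> to divide by. The
  linear factors are \<open>y - q ^ a * r * z\<close> and, on the edge \<open>a = 0\<close>,
  \<open>z - q ^ b * r * y\<close>. Truncated indices occur only next to a vanishing
  \<open>q_int 0 q\<close>.\<close>

fun Theta :: "real \<Rightarrow> real \<Rightarrow> nat \<Rightarrow> nat \<Rightarrow> real poly poly" where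
  "Theta q r 0 0 = 1"
| "Theta q r 0 (Suc b) = smult [:1 / (1 - q ^ b * r\<^sup>2):]
     ([:[:0, 1:], [:- (q ^ b * r):]:] * Theta q r 0 b - smult [:q_int b q:] (Theta q r 0 (b - 1)))"
| "Theta q r (Suc a) b = smult [:1 / (1 - q ^ (a + b) * r\<^sup>2):]
     ([:[:0, - (q ^ a * r):], 1:] * Theta q r a b - smult [:q_int a q:] (Theta q r (a - 1) b)
       + smult [:q ^ a * r * q_int b q:] (Theta q r a (b - 1)))"

text \<open>With \<open>c = - r\<close>, \<open>lin1\<close> and \<open>lin2\<close> are the
  products of the linear factors of \<open>Theta\<close> at \<open>z = 1\<close>: the former
  collects \<open>y - q ^ i * r * z\<close>, the latter \<open>z - q ^ j * r * y\<close>.\<close>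

definition lin1 :: "real \<Rightarrow> real \<Rightarrow> nat \<Rightarrow> real poly" where
  "lin1 q c a = (\<Prod>i<a. [:q ^ i * c, 1:])"

definition lin2 :: "real \<Rightarrow> real \<Rightarrow> nat \<Rightarrow> real poly" where
  "lin2 q c b = (\<Prod>j<b. [:1, q ^ j * c:])"

text \<open>The homogeneous part of degree \<open>a + b\<close> of \<open>Theta q r a b\<close>, dehomogenised by \<open>z = 1\<close>.\<close>

definition Theta_top :: "real \<Rightarrow> real \<Rightarrow> nat \<Rightarrow> nat \<Rightarrow> real poly" where
  "Theta_top q r a b = smult (1 / (\<Prod>k<a + b. 1 - q ^ k * r\<^sup>2)) (lin1 q (- r) a * lin2 q (- r) b)"

lemma coeff2_Theta_Suc1:
  "coeff2 (Theta q r (Suc a) b) i j = 1 / (1 - q ^ (a + b) * r\<^sup>2) *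
     ((if i = 0 then 0 else coeff2 (Theta q r a b) (i - 1) j)
      + (if j = 0 then 0 else - (q ^ a * r) * coeff2 (Theta q r a b) i (j - 1))
      - q_int a q * coeff2 (Theta q r (a - 1) b) i j
      + q ^ a * r * q_int b q * coeff2 (Theta q r a (b - 1)) i j)"
  by (simp only: Theta.simps coeff2_simps coeff2_mult_linear_y)

lemma coeff2_Theta_Suc2:
  "coeff2 (Theta q r 0 (Suc b)) i j = 1 / (1 - q ^ b * r\<^sup>2) *
     ((if i = 0 then 0 else - (q ^ b * r) * coeff2 (Theta q r 0 b) (i - 1) j)
      + (if j = 0 then 0 else coeff2 (Theta q r 0 b) i (j - 1))
      - q_int b q * coeff2 (Theta q r 0 (b - 1)) i j)"
  by (simp only: Theta.simps coeff2_simps coeff2_mult_linear_z)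

lemma Theta_top_0: "Theta_top q r 0 0 = 1"
  by (simp add: Theta_top_def lin1_def lin2_def)

lemma coeff_Theta_top_Suc1:
  "coeff (Theta_top q r (Suc a) b) i = 1 / (1 - q ^ (a + b) * r\<^sup>2) *
     ((if i = 0 then 0 else coeff (Theta_top q r a b) (i - 1)) - q ^ a * r * coeff (Theta_top q r a b) i)"
proof -
  have "Theta_top q r (Suc a) b = smult (1 / (1 - q ^ (a + b) * r\<^sup>2)) ([:- (q ^ a * r), 1:] * Theta_top q r a b)"
    by (simp add: Theta_top_def lin1_def mult_ac del: mult_pCons_left mult_pCons_right)
  then show ?thesis by (cases i) (simp_all add: algebra_simps)
qed

lemma coeff_Theta_top_Suc2:
  "coeff (Theta_top q r 0 (Suc b)) i = 1 / (1 - q ^ b * r\<^sup>2) *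
     (coeff (Theta_top q r 0 b) i - (if i = 0 then 0 else q ^ b * r * coeff (Theta_top q r 0 b) (i - 1)))"
proof -
  have "Theta_top q r 0 (Suc b) = smult (1 / (1 - q ^ b * r\<^sup>2)) ([:1, - (q ^ b * r):] * Theta_top q r 0 b)"
    by (simp add: Theta_top_def lin1_def lin2_def mult_ac del: mult_pCons_left mult_pCons_right)
  then show ?thesis by (cases i) (simp_all add: algebra_simps)
qed

lemma coeff_Theta_top_eq_0: "a + b < i \<Longrightarrow> coeff (Theta_top q r a b) i = 0"
proof (induction a arbitrary: i)
  case 0
  then show ?case
  proof (induction b arbitrary: i)
    case (Suc b)
    then show ?case by (simp add: coeff_Theta_top_Suc2)
  qed (simp add: Theta_top_0)
next
  case (Suc a)
  then show ?case by (simp add: coeff_Theta_top_Suc1)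
qed

lemma coeff2_Theta_eq_0: "a + b < i + j \<Longrightarrow> coeff2 (Theta q r a b) i j = 0"
proof (induction q r a b arbitrary: i j rule: Theta.induct)
  case (2 q r b)
  then show ?case by (simp add: coeff2_Theta_Suc2 del: Theta.simps)
next
  case (3 q r a b)
  then show ?case by (simp add: coeff2_Theta_Suc1 del: Theta.simps)
qed auto

text \<open>At \<open>r = 0\<close> the linear factors are \<open>y\<close> and \<open>z\<close> and
  the mixed term disappears, so the degrees in the two variables separate.\<close>

lemma coeff2_Theta_0_eq_0: "a < i \<or> b < j \<Longrightarrow> coeff2 (Theta q 0 a b) i j = 0"
proof (induction q "0::real" a b arbitrary: i j rule: Theta.induct)
  case (2 q b)
  then show ?case
    by (auto simp: coeff2_Theta_Suc2 2(1)[OF disjI1] 2(1)[OF disjI2] 2(2)[OF disjI1] 2(2)[OF disjI2] simp del: Theta.simps One_nat_def)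
next
  case (3 q a b)
  then show ?case
    by (auto simp: coeff2_Theta_Suc1 3(1)[OF disjI1] 3(1)[OF disjI2] 3(2)[OF disjI1] 3(2)[OF disjI2]
      3(3)[OF disjI1] simp del: Theta.simps One_nat_def)
qed auto

text \<open>In top degree only the linear factor of each recursion step contributes; the remaining
  terms have total degree lower by two.\<close>

lemma coeff2_Theta_top: "i + j = a + b \<Longrightarrow> coeff2 (Theta q r a b) i j = coeff (Theta_top q r a b) i"
proof (induction q r a b arbitrary: i j rule: Theta.induct)
  case (1 q r)
  then show ?case by (simp add: Theta_top_0)
next
  case (2 q r b)
  have "coeff2 (Theta q r 0 (b - 1)) i j = 0"
    using 2(3) by (intro coeff2_Theta_eq_0) simp
  \<comment> \<open>The one-variable recurrence keeps this coefficient even for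
    \<open>j = 0\<close>, where the two-variable one has no such term; there
    \<open>i = b + 1\<close> exceeds the degree.\<close>
  moreover have "coeff (Theta_top q r 0 b) i = 0" if "j = 0"
    using 2(3) that by (intro coeff_Theta_top_eq_0) simp
  moreover have "coeff2 (Theta q r 0 b) (i - 1) j = coeff (Theta_top q r 0 b) (i - 1)" if "i \<noteq> 0"
    using 2(1)[of "i - 1" j] 2(3) that by simp
  moreover have "coeff2 (Theta q r 0 b) i (j - 1) = coeff (Theta_top q r 0 b) i" if "j \<noteq> 0"
    using 2(1)[of i "j - 1"] 2(3) that by simp
  ultimately show ?case
    by (cases "i = 0"; cases "j = 0") (simp_all add: coeff2_Theta_Suc2 coeff_Theta_top_Suc2 algebra_simps del: Theta.simps)
next
  case (3 q r a b)
  have "coeff2 (Theta q r (a - 1) b) i j = 0" "coeff2 (Theta q r a (b - 1)) i j = 0"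
    using 3(4) by (simp_all add: coeff2_Theta_eq_0)
  moreover have "coeff (Theta_top q r a b) i = 0" if "j = 0"
    using 3(4) that by (intro coeff_Theta_top_eq_0) simp
  moreover have "coeff2 (Theta q r a b) (i - 1) j = coeff (Theta_top q r a b) (i - 1)" if "i \<noteq> 0"
    using 3(1)[of "i - 1" j] 3(4) that by simp
  moreover have "coeff2 (Theta q r a b) i (j - 1) = coeff (Theta_top q r a b) i" if "j \<noteq> 0"
    using 3(1)[of i "j - 1"] 3(4) that by simp
  ultimately show ?case
    by (cases "i = 0"; cases "j = 0") (simp_all add: coeff2_Theta_Suc1 coeff_Theta_top_Suc1 algebra_simps del: Theta.simps)
qed

section \<open>Leading coefficients, and \<open>Theta\<close> as the quotient of kernels\<close>

context q_param
begin

lemma coeff_lin2: "coeff (lin2 q c b) s = q ^ (s choose 2) * qb b s * c ^ s"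
proof -
  have "lin2 q c b = (\<Sum>k\<le>b. monom (q ^ (k choose 2) * qb b k * c ^ k) k)"
  proof (rule poly_eq_poly_eq_iff[THEN iffD1, OF ext])
    fix x
    have "poly (lin2 q c b) x = (\<Prod>j<b. 1 + q ^ j * (c * x))"
      by (simp add: lin2_def poly_prod mult_ac)
    also have "\<dots> = poly (\<Sum>k\<le>b. monom (q ^ (k choose 2) * qb b k * c ^ k) k) x"
      unfolding q_binomial_theorem by (simp add: poly_sum poly_monom power_mult_distrib mult_ac)
    finally show "poly (lin2 q c b) x = \<dots>" .
  qed
  then show ?thesis by (simp add: coeff_sum)
qed

lemma coeff_lin1:
  assumes "s \<le> a"
  shows "coeff (lin1 q c a) (a - s) = q ^ (s choose 2) * qb a s * c ^ s"
proof -
  have "lin1 q c a = (\<Sum>k\<le>a. monom (q ^ (k choose 2) * qb a k * c ^ k) (a - k))"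
  proof (rule poly_eq_poly_eq_iff[THEN iffD1, OF ext])
    fix x
    have "poly (lin1 q c a) x = (\<Prod>i<a. x + q ^ i * c)"
      by (simp add: lin1_def poly_prod algebra_simps)
    also have "\<dots> = poly (\<Sum>k\<le>a. monom (q ^ (k choose 2) * qb a k * c ^ k) (a - k)) x"
      unfolding q_binomial_theorem by (simp add: poly_sum poly_monom)
    finally show "poly (lin1 q c a) x = \<dots>" .
  qed
  then have "coeff (lin1 q c a) (a - s) =
      (\<Sum>k\<le>a. coeff (monom (q ^ (k choose 2) * qb a k * c ^ k) (a - k)) (a - s))"
    by (simp only: coeff_sum)
  also have "\<dots> = (\<Sum>k\<le>a. if k = s then q ^ (k choose 2) * qb a k * c ^ k else 0)"
    by (intro sum.cong) (use assms in auto)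
  finally show ?thesis using assms by simp
qed

lemma abs_mult_less_1: "\<bar>a\<bar> < 1 \<Longrightarrow> \<bar>b\<bar> < 1 \<Longrightarrow> \<bar>a * b\<bar> < 1" for a b :: real
  using abs_mult_less[of a 1 b 1] by (simp add: abs_mult)

lemma one_minus_q_power_pos: "\<bar>r\<bar> < 1 \<Longrightarrow> 0 < 1 - q ^ k * r\<^sup>2"
  using abs_mult_q_power_less_1[of "r\<^sup>2" k] by (simp add: abs_square_less_1 mult.commute abs_less_iff)

text \<open>The signs of \<open>(- r) ^ s\<close> from the two products combine to squares, so up to
  a positive factor the coefficient of \<open>y^a z^b\<close> is a sum of nonnegative terms, of
  which \<open>s = 0\<close> gives 1.\<close>

lemma coeff_Theta_top_pos:
  assumes "\<bar>r\<bar> < 1"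
  shows "0 < coeff (Theta_top q r a b) a"
proof -
  let ?f = "\<lambda>s. (q ^ (s choose 2) * (- r) ^ s)\<^sup>2 * qb a s * qb b s"
  have "coeff (lin1 q (- r) a * lin2 q (- r) b) a =
      (\<Sum>i\<le>a. coeff (lin1 q (- r) a) i * coeff (lin2 q (- r) b) (a - i))"
    by (rule coeff_mult)
  also have "\<dots> = (\<Sum>s\<le>a. coeff (lin1 q (- r) a) (a - s) * coeff (lin2 q (- r) b) s)"
    by (rule sum.reindex_bij_witness[of _ "\<lambda>s. a - s" "\<lambda>s. a - s"]) auto
  also have "\<dots> = (\<Sum>s\<le>a. ?f s)"
    by (intro sum.cong) (simp_all add: coeff_lin2 coeff_lin1 power2_eq_square mult_ac)
  also have "\<dots> \<ge> ?f 0"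
    by (intro member_le_sum) auto
  finally have *: "1 \<le> coeff (lin1 q (- r) a * lin2 q (- r) b) a"
    by (simp add: numeral_2_eq_2)
  have "0 < (\<Prod>k<a + b. 1 - q ^ k * r\<^sup>2)"
    using one_minus_q_power_pos[OF assms] by (intro prod_pos) auto
  with * show ?thesis by (simp add: Theta_top_def)
qed

lemma has_order_Theta: "has_order (\<lambda>r. Theta q r k l) k l"
proof -
  have top: "coeff2 (Theta q r k l) k l \<noteq> 0" if "\<bar>r\<bar> < 1" for r
    using coeff_Theta_top_pos[OF that] coeff2_Theta_top[of k l k l] by (metis less_irrefl)
  have "has_total_degree (Theta q r k l) (k + l)" if "\<bar>r\<bar> < 1" for r
    unfolding has_total_degree_def using top[OF that] coeff2_Theta_eq_0[of k l] by (metis not_le)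
  moreover have "has_bidegree (Theta q 0 k l) k l"
    unfolding has_bidegree_def using top[of 0] coeff2_Theta_0_eq_0[of k _ l] by (metis abs_zero not_le zero_less_one)
  ultimately show ?thesis unfolding has_order_def using top by (simp add: abs_less_iff)
qed

definition G :: "nat \<Rightarrow> real \<Rightarrow> real \<Rightarrow> real poly poly" where
  "G n \<rho>1 \<rho>2 = (\<Sum>i=0..n. smult [:qb n i * \<rho>1 ^ i * \<rho>2 ^ (n - i):] (Theta q (\<rho>1 * \<rho>2) i (n - i)))"

lemma poly2_G:
  "poly2 (G n \<rho>1 \<rho>2) y z = (\<Sum>i=0..n. qb n i * \<rho>1 ^ i * \<rho>2 ^ (n - i) * poly2 (Theta q (\<rho>1 * \<rho>2) i (n - i)) y z)"
  by (simp add: G_def poly2_sum)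

text \<open>The coefficient of \<open>y\<^sup>n\<close> is \<open>\<Prod>j<n. \<rho>1 (1 - q\<^sup>j \<rho>2\<^sup>2) / (1 - q\<^sup>j \<rho>1\<^sup>2 \<rho>2\<^sup>2)\<close>.\<close>

lemma has_total_degree_G:
  assumes "\<bar>\<rho>1\<bar> < 1" "\<bar>\<rho>2\<bar> < 1" "\<rho>1 \<noteq> 0"
  shows "has_total_degree (G n \<rho>1 \<rho>2) n"
proof -
  define r where "r = \<rho>1 * \<rho>2"
  have r: "\<bar>r\<bar> < 1" using assms by (simp add: r_def abs_mult_less_1)
  define D where "D = (\<Prod>k<n. 1 - q ^ k * r\<^sup>2)"
  have D: "0 < D" unfolding D_def using one_minus_q_power_pos[OF r] by (intro prod_pos) auto
  \<comment> \<open>\<open>lin1\<close> is monic of degree \<open>i\<close>, so the power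
    \<open>n\<close> is reached only together with the top coefficient of \<open>lin2\<close>, of
    index \<open>n - i\<close>.\<close>
  have top: "coeff (Theta_top q r i (n - i)) n = q ^ ((n - i) choose 2) * (- r) ^ (n - i) / D" if le: "i \<le> n" for i
  proof -
    let ?P = "lin1 q (- r) i" and ?Q = "lin2 q (- r) (n - i)"
    have P: "coeff ?P i = 1" using coeff_lin1[of 0 i "- r"] by (simp add: numeral_2_eq_2)
    have degP: "degree ?P \<le> i"
      unfolding lin1_def by (rule order_trans[OF degree_prod_sum_le]) simp_all
    have "coeff (?P * ?Q) n = (\<Sum>k\<le>n. if k = i then coeff ?P k * coeff ?Q (n - k) else 0)"
      unfolding coeff_mult
    proof (intro sum.cong refl)
      fix k assume "k \<in> {..n}"
      then consider "k = i" | "i < k" | "n - i < n - k" "k \<noteq> i" using le by (cases k i rule: linorder_cases) auto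
      then show "coeff ?P k * coeff ?Q (n - k) = (if k = i then coeff ?P k * coeff ?Q (n - k) else 0)"
        by cases (use degP in \<open>auto simp: coeff_lin2 intro: coeff_eq_0\<close>)
    qed
    also have "\<dots> = coeff ?Q (n - i)" using that P by simp
    finally show ?thesis using that
      by (simp add: Theta_top_def D_def coeff_lin2 mult_ac)
  qed
  have "coeff2 (G n \<rho>1 \<rho>2) n 0 = (\<Sum>i=0..n. qb n i * \<rho>1 ^ i * \<rho>2 ^ (n - i) * coeff (Theta_top q r i (n - i)) n)"
    by (simp add: G_def coeff2_sum coeff2_Theta_top r_def)
  also have "\<dots> = (\<Sum>i=0..n. qb n i * \<rho>1 ^ i * \<rho>2 ^ (n - i) * (q ^ ((n - i) choose 2) * (- r) ^ (n - i) / D))"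
    by (intro sum.cong) (simp_all add: top)
  \<comment> \<open>Reflecting the index gives the q-binomial theorem with
    \<open>a = \<rho>1\<close> and \<open>b = - r * \<rho>2\<close>.\<close>
  also have "\<dots> = (\<Sum>k\<le>n. q ^ (k choose 2) * qb n k * (- r * \<rho>2) ^ k * \<rho>1 ^ (n - k)) / D"
    unfolding sum_divide_distrib
  proof (rule sum.reindex_bij_witness[of _ "\<lambda>s. n - s" "\<lambda>s. n - s"])
    fix i assume "i \<in> {0..n}"
    then have "qb n (n - i) = qb n i" "n - (n - i) = i" by (simp_all add: q_binomial_symmetric)
    then show "q ^ (n - i choose 2) * qb n (n - i) * (- r * \<rho>2) ^ (n - i) * \<rho>1 ^ (n - (n - i)) / D =
        qb n i * \<rho>1 ^ i * \<rho>2 ^ (n - i) * (q ^ (n - i choose 2) * (- r) ^ (n - i) / D)"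
      by (simp only: power_mult_distrib) simp
  qed auto
  also have "\<dots> = (\<Prod>j<n. \<rho>1 + q ^ j * (- r * \<rho>2)) / D"
    by (simp only: q_binomial_theorem)
  also have "\<dots> = (\<Prod>j<n. \<rho>1 * (1 - q ^ j * \<rho>2\<^sup>2)) / D"
    by (simp add: r_def power2_eq_square algebra_simps)
  also have "\<dots> \<noteq> 0"
    using D assms(3) one_minus_q_power_pos[OF assms(2)] by (auto simp: less_le)
  finally have "coeff2 (G n \<rho>1 \<rho>2) n 0 \<noteq> 0" .
  moreover have "coeff2 (G n \<rho>1 \<rho>2) i j = 0" if "n < i + j" for i j
    using that by (auto simp: G_def coeff2_sum coeff2_Theta_eq_0 intro!: sum.neutral)
  ultimately show ?thesis unfolding has_total_degree_def
    by (metis add.right_neutral not_le)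
qed

lemma poly2_Theta_0:
  "poly2 (Theta q 0 n 0) y z = H n y" "poly2 (Theta q 0 0 n) y z = H n z"
proof -
  show "poly2 (Theta q 0 n 0) y z = H n y"
  proof (induction n rule: less_induct)
    case (less n)
    show ?case
    proof (cases n)
      case (Suc m)
      then show ?thesis using less[of m] less[of "m - 1"] by (simp add: Hermite_Suc)
    qed simp
  qed
  show "poly2 (Theta q 0 0 n) y z = H n z"
  proof (induction n rule: less_induct)
    case (less n)
    show ?case
    proof (cases n)
      case (Suc m)
      then show ?thesis using less[of m] less[of "m - 1"] by (simp add: Hermite_Suc)
    qed simp
  qed
qed

text \<open>Subtracting \<open>q ^ a * r\<close> times the recurrence in \<open>z\<close> from the
  one in \<open>y\<close> eliminates \<open>A a (Suc b)\<close>.\<close>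

lemma A_rec_solved:
  assumes "y \<in> S q" "z \<in> S q" "\<bar>r\<bar> < 1"
  shows "(1 - q ^ (a + b) * r\<^sup>2) * A (Suc a) b y z r =
    (y - q ^ a * r * z) * A a b y z r - qi a * A (a - 1) b y z r + q ^ a * r * qi b * A a (b - 1) y z r"
proof -
  have "(y - q ^ a * r * z) * A a b y z r = y * A a b y z r - q ^ a * r * (z * A a b y z r)"
    by (simp add: algebra_simps)
  then show ?thesis
    unfolding A_rec1[OF assms, of a b] A_rec2[OF assms, of a b]
    by (simp add: power_add power2_eq_square algebra_simps)
qed

text \<open>The kernels obey the recursion that defines \<open>Theta\<close>; on the edge
  \<open>a = 0\<close> this uses the exchange of \<open>y\<close> and \<open>z\<close>.\<close>

lemma A_eq_Theta:
  assumes yz: "y \<in> S q" "z \<in> S q" and r: "\<bar>r\<bar> < 1"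
  shows "A a b y z r = poly2 (Theta q r a b) y z * A 0 0 y z r"
proof -
  have eq: "u = (1 / d) * v" if "d * u = v" "0 < d" for d u v :: real
    using that by (simp add: field_simps)
  note pos = one_minus_q_power_pos[OF r]
  have A0: "A 0 b y z r = poly2 (Theta q r 0 b) y z * A 0 0 y z r" for b
  proof (induction b rule: less_induct)
    case (less b)
    show ?case
    proof (cases b)
      case (Suc c)
      have "(1 - q ^ c * r\<^sup>2) * A 0 (Suc c) y z r =
          (z - q ^ c * r * y) * A 0 c y z r - qi c * A 0 (c - 1) y z r"
        using A_rec_solved[OF yz(2,1) r, of c 0] by (simp only: A_commute[of _ _ z y]) simp
      note eq[OF this pos]
      also have "A 0 c y z r = poly2 (Theta q r 0 c) y z * A 0 0 y z r" using less[of c] Suc by simp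
      also have "A 0 (c - 1) y z r = poly2 (Theta q r 0 (c - 1)) y z * A 0 0 y z r" using less[of "c - 1"] Suc by simp
      finally show ?thesis unfolding Suc by (simp add: algebra_simps)
    qed simp
  qed
  show ?thesis
  proof (induction a arbitrary: b rule: less_induct)
    case (less a)
    show ?case
    proof (cases a)
      case (Suc c)
      note eq[OF A_rec_solved[OF yz r, of c b] pos]
      also have "A c b y z r = poly2 (Theta q r c b) y z * A 0 0 y z r" using less[of c] Suc by simp
      also have "A (c - 1) b y z r = poly2 (Theta q r (c - 1) b) y z * A 0 0 y z r" using less[of "c - 1"] Suc by simp
      also have "A c (b - 1) y z r = poly2 (Theta q r c (b - 1)) y z * A 0 0 y z r" using less[of c "b - 1"] Suc by simp
      finally show ?thesis unfolding Suc by (simp add: algebra_simps)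
    next
      case 0
      show ?thesis unfolding 0 by (rule A0)
    qed
  qed
qed

lemma poly2_G_A:
  assumes "y \<in> S q" "z \<in> S q" "\<bar>\<rho>1 * \<rho>2\<bar> < 1"
  shows "poly2 (G n \<rho>1 \<rho>2) y z * A 0 0 y z (\<rho>1 * \<rho>2) =
    (\<Sum>i\<le>n. qb n i * \<rho>1 ^ i * \<rho>2 ^ (n - i) * A i (n - i) y z (\<rho>1 * \<rho>2))"
  by (simp add: poly2_G sum_distrib_right atLeast0AtMost A_eq_Theta[OF assms, of _ "n - _"] mult.assoc)

text \<open>\<open>Theta\<close> is built along one path through the index grid. That both original
  recurrences hold everywhere is inherited from the series \<open>A\<close> by cancelling
  \<open>A 0 0\<close>, without a consistency check on polynomials.\<close>

lemma Theta_rec: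
  assumes "y \<in> S q" "z \<in> S q" "\<bar>r\<bar> < 1"
  defines "\<theta> \<equiv> \<lambda>a b. poly2 (Theta q r a b) y z"
  shows "y * \<theta> a b = \<theta> (Suc a) b + qi a * \<theta> (a - 1) b + q ^ a * r * \<theta> a (Suc b)"
    and "z * \<theta> a b = \<theta> a (Suc b) + qi b * \<theta> a (b - 1) + q ^ b * r * \<theta> (Suc a) b"
proof -
  have \<theta>: "A a b y z r = \<theta> a b * A 0 0 y z r" for a b
    unfolding \<theta>_def by (rule A_eq_Theta[OF assms(1-3)])
  note nz = A_00_neq_0[OF assms(1-3)]
  have "(y * \<theta> a b) * A 0 0 y z r = (\<theta> (Suc a) b + qi a * \<theta> (a - 1) b + q ^ a * r * \<theta> a (Suc b)) * A 0 0 y z r"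
    using A_rec1[OF assms(1-3), of a b] unfolding \<theta>[of a b] \<theta>[of "Suc a" b] \<theta>[of "a - 1" b] \<theta>[of a "Suc b"]
    by (simp only: ring_distribs mult.assoc)
  then show "y * \<theta> a b = \<theta> (Suc a) b + qi a * \<theta> (a - 1) b + q ^ a * r * \<theta> a (Suc b)"
    using nz by (simp only: mult_cancel_right) simp
  have "(z * \<theta> a b) * A 0 0 y z r = (\<theta> a (Suc b) + qi b * \<theta> a (b - 1) + q ^ b * r * \<theta> (Suc a) b) * A 0 0 y z r"
    using A_rec2[OF assms(1-3), of a b] unfolding \<theta>[of a b] \<theta>[of "Suc a" b] \<theta>[of a "b - 1"] \<theta>[of a "Suc b"]
    by (simp only: ring_distribs mult.assoc)
  then show "z * \<theta> a b = \<theta> a (Suc b) + qi b * \<theta> a (b - 1) + q ^ b * r * \<theta> (Suc a) b"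
    using nz by (simp only: mult_cancel_right) simp
qed

end

section \<open>Product of two Mehler kernels\<close>

lemma has_sum_geometric_nat:
  fixes u :: real
  assumes "0 \<le> u" "u < 1"
  shows "((\<lambda>n. u ^ n) has_sum (1 / (1 - u))) UNIV"
  using assms by (intro norm_summable_imp_has_sum geometric_sums) (simp_all add: summable_geometric)

lemma summable_on_geometric3:
  fixes u v w :: real
  assumes "0 \<le> u" "u < 1" "0 \<le> v" "v < 1" "0 \<le> w" "w < 1"
  shows "(\<lambda>(a, b, c). u ^ a * (v ^ b * w ^ c)) summable_on UNIV"
proof -
  have vw: "(\<lambda>(b, c). v ^ b * w ^ c) summable_on Sigma UNIV (\<lambda>_. UNIV)"
  proof (rule summable_on_SigmaI)
    show "((\<lambda>c. case (b, c) of (b, c) \<Rightarrow> v ^ b * w ^ c) has_sum v ^ b * (1 / (1 - w))) UNIV" for b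
      unfolding prod.case by (intro has_sum_cmult_right has_sum_geometric_nat assms)
    show "(\<lambda>b. v ^ b * (1 / (1 - w))) summable_on UNIV"
      using assms by (intro summable_on_cmult_left has_sum_imp_summable[OF has_sum_geometric_nat])
  qed (use assms in auto)
  have "(\<lambda>(a, bc). u ^ a * (case bc of (b, c) \<Rightarrow> v ^ b * w ^ c)) summable_on Sigma UNIV (\<lambda>_. UNIV)"
  proof (rule summable_on_SigmaI)
    show "((\<lambda>bc. case (a, bc) of (a, bc) \<Rightarrow> u ^ a * (case bc of (b, c) \<Rightarrow> v ^ b * w ^ c)) has_sum
        u ^ a * infsum (\<lambda>(b, c). v ^ b * w ^ c) UNIV) UNIV" for a
      using has_sum_cmult_right[OF has_sum_infsum[OF vw], of "u ^ a"] by (simp add: UNIV_Times_UNIV)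
    show "(\<lambda>a. u ^ a * infsum (\<lambda>(b, c). v ^ b * w ^ c) UNIV) summable_on UNIV"
      using assms by (intro summable_on_cmult_left has_sum_imp_summable[OF has_sum_geometric_nat])
  qed (use assms in auto)
  then show ?thesis by (simp add: case_prod_unfold UNIV_Times_UNIV)
qed

section \<open>Sums against q-binomial coefficients, and the triple series\<close>

context q_param
begin

lemma sum_q_binomial_Suc:
  "(\<Sum>i\<le>Suc n. qb (Suc n) i * f i) = (\<Sum>i\<le>n. qb n i * f (Suc i)) + (\<Sum>i\<le>n. q ^ i * qb n i * f i)"
proof -
  have "(\<Sum>i\<le>Suc n. qb (Suc n) i * f i) = f 0 + (\<Sum>i\<le>n. qb (Suc n) (Suc i) * f (Suc i))"
    by (subst sum.atMost_Suc_shift) simp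
  also have "\<dots> = (\<Sum>i\<le>n. qb n i * f (Suc i)) + (f 0 + (\<Sum>i\<le>n. q ^ Suc i * qb n (Suc i) * f (Suc i)))"
    by (simp add: q_binomial_Suc_Suc sum.distrib algebra_simps)
  also have "f 0 + (\<Sum>i\<le>n. q ^ Suc i * qb n (Suc i) * f (Suc i)) = (\<Sum>i\<le>Suc n. q ^ i * qb n i * f i)"
    by (subst sum.atMost_Suc_shift) simp
  finally show ?thesis by simp
qed

lemma sum_q_binomial_absorb:
  "(\<Sum>i\<le>n. qb n i * (qi i * f (i - 1))) = qi n * (\<Sum>i\<le>n - 1. qb (n - 1) i * f i)"
proof (cases n)
  case (Suc m)
  have "(\<Sum>i\<le>Suc m. qb (Suc m) i * (qi i * f (i - 1))) = (\<Sum>i\<le>m. qi (Suc i) * qb (Suc m) (Suc i) * f i)"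
    by (subst sum.atMost_Suc_shift) (simp add: mult_ac)
  also have "\<dots> = qi (Suc m) * (\<Sum>i\<le>m. qb m i * f i)"
    by (simp only: q_binomial_absorb sum_distrib_left mult.assoc)
  finally show ?thesis by (simp add: Suc)
qed simp

text \<open>As a function of \<open>n\<close> the sum satisfies the recurrence of
  \<open>H n x\<close>: \<open>A_rec1\<close> produces three sums, two of which merge by the Pascal
  rule while the third drops to \<open>n - 1\<close> by absorption.\<close>

lemma sum_q_binomial_A:
  assumes "x \<in> S q" "z \<in> S q" "\<bar>r\<bar> < 1"
  shows "(\<Sum>i\<le>n. qb n i * (r ^ (n - i) * A i (n - i) x z r)) = H n x * A 0 0 x z r"
proof -
  define X where "X n = (\<Sum>i\<le>n. qb n i * (r ^ (n - i) * A i (n - i) x z r))" for n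
  have rec: "x * X n = X (Suc n) + qi n * X (n - 1)" for n
  proof -
    have "x * X n = (\<Sum>i\<le>n. qb n i * (r ^ (n - i) * (x * A i (n - i) x z r)))"
      by (simp add: X_def sum_distrib_left mult_ac)
    also have "\<dots> = (\<Sum>i\<le>n. qb n i * (r ^ (Suc n - Suc i) * A (Suc i) (Suc n - Suc i) x z r))
        + (\<Sum>i\<le>n. q ^ i * qb n i * (r ^ (Suc n - i) * A i (Suc n - i) x z r))
        + (\<Sum>i\<le>n. qb n i * (qi i * (r ^ (n - 1 - (i - 1)) * A (i - 1) (n - 1 - (i - 1)) x z r)))"
      unfolding sum.distrib[symmetric]
    proof (intro sum.cong refl)
      fix i assume i: "i \<in> {..n}"
      \<comment> \<open>At \<open>i = 0\<close> the truncated index expressions may differ, but both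
        sides carry the factor \<open>qi 0 = 0\<close>.\<close>
      have 1: "qi i * (r ^ (n - 1 - (i - 1)) * A (i - 1) (n - 1 - (i - 1)) x z r) =
          qi i * (r ^ (n - i) * A (i - 1) (n - i) x z r)"
        by (cases i) simp_all
      have 2: "Suc n - i = Suc (n - i)" using i by auto
      show "qb n i * (r ^ (n - i) * (x * A i (n - i) x z r)) =
          qb n i * (r ^ (Suc n - Suc i) * A (Suc i) (Suc n - Suc i) x z r)
          + q ^ i * qb n i * (r ^ (Suc n - i) * A i (Suc n - i) x z r)
          + qb n i * (qi i * (r ^ (n - 1 - (i - 1)) * A (i - 1) (n - 1 - (i - 1)) x z r))"
        unfolding 1 2 A_rec1[OF assms] by (simp add: algebra_simps)
    qed
    also have "\<dots> = X (Suc n) + qi n * X (n - 1)"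
      unfolding sum_q_binomial_absorb[of n "\<lambda>i. r ^ (n - 1 - i) * A i (n - 1 - i) x z r"]
      by (simp only: X_def sum_q_binomial_Suc)
    finally show ?thesis .
  qed
  have "X n = H n x * A 0 0 x z r"
  proof (induction n rule: less_induct)
    case (less n)
    show ?case
    proof (cases n)
      case (Suc m)
      have "X n = x * X m - qi m * X (m - 1)" using rec[of m] Suc by simp
      also have "\<dots> = x * (H m x * A 0 0 x z r) - qi m * (H (m - 1) x * A 0 0 x z r)"
        using less[of m] less[of "m - 1"] Suc by simp
      also have "\<dots> = H n x * A 0 0 x z r" by (simp add: Suc Hermite_Suc algebra_simps)
      finally show ?thesis .
    qed (simp add: X_def)
  qed
  then show ?thesis by (simp add: X_def)
qed

text \<open>One index for each pair of variables: \<open>a\<close> joins \<open>x\<close> and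
  \<open>y\<close>, \<open>b\<close> joins \<open>x\<close> and \<open>z\<close>, \<open>c\<close>
  joins \<open>y\<close> and \<open>z\<close>. This symmetry permits two groupings of the same
  series.\<close>

definition triple :: "real \<Rightarrow> real \<Rightarrow> real \<Rightarrow> real \<Rightarrow> real \<Rightarrow> real \<Rightarrow> nat \<times> nat \<times> nat \<Rightarrow> real" where
  "triple \<alpha> \<beta> \<gamma> x y z = (\<lambda>(a, b, c). \<alpha> ^ a * \<beta> ^ b * \<gamma> ^ c / (qf a * qf b * qf c)
     * (H (a + b) x * H (a + c) y * H (b + c) z))"

lemma triple_swap: "triple \<alpha> \<gamma> \<beta> y x z (a, c, b) = triple \<alpha> \<beta> \<gamma> x y z (a, b, c)"
  by (simp add: triple_def add.commute mult_ac)

lemma q_fact_add: "qf (a + b) = qb (a + b) a * qf a * qf b"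
  by (simp add: q_binomial_def)

end

context q_param_lt
begin

text \<open>The three factors \<open>sqrt (qf _)\<close> of the growth bounds exceed the denominator
  only by square roots of three bounded q-binomials, so a product of three geometric series is a
  majorant once \<open>s^2\<close> times each parameter is below 1 in modulus.\<close>

lemma summable_on_triple:
  assumes "x \<in> S q" "y \<in> S q" "z \<in> S q" "\<bar>\<alpha>\<bar> < 1" "\<bar>\<beta>\<bar> < 1" "\<bar>\<gamma>\<bar> < 1"
  shows "triple \<alpha> \<beta> \<gamma> x y z summable_on UNIV"
proof -
  define m where "m = max \<bar>\<alpha>\<bar> (max \<bar>\<beta>\<bar> \<bar>\<gamma>\<bar>)"
  have "m < 1" using assms by (simp add: m_def)
  then obtain s where s: "1 < s" "s ^ 2 * m < 1" using exists_power_mult_less_1 by blast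
  have s': "s ^ 2 * \<bar>v\<bar> < 1" if "\<bar>v\<bar> \<le> m" for v
    using s that by (smt (verit) mult_left_mono zero_le_power2)
  have bounds: "s ^ 2 * \<bar>\<alpha>\<bar> < 1" "s ^ 2 * \<bar>\<beta>\<bar> < 1" "s ^ 2 * \<bar>\<gamma>\<bar> < 1"
    by (rule s', simp add: m_def)+
  obtain C where C: "0 < C" "\<And>x n. x \<in> S q \<Longrightarrow> \<bar>H n x\<bar> \<le> C * s ^ n * sqrt (qf n)"
    using Hermite_growth_uniform[OF s(1)] by blast
  obtain K where K: "0 < K" "\<And>n k. qb n k \<le> K" using q_binomial_bounded by blast
  let ?f = "\<lambda>(a, b, c). (s ^ 2 * \<bar>\<alpha>\<bar>) ^ a * ((s ^ 2 * \<bar>\<beta>\<bar>) ^ b * (s ^ 2 * \<bar>\<gamma>\<bar>) ^ c)"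
  have "(\<lambda>abc. norm (triple \<alpha> \<beta> \<gamma> x y z abc)) summable_on UNIV"
  proof (rule summable_on_comparison_test)
    show "(\<lambda>abc. C ^ 3 * sqrt (K ^ 3) * ?f abc) summable_on UNIV"
      using bounds s by (intro summable_on_cmult_right summable_on_geometric3) auto
  next
    fix abc :: "nat \<times> nat \<times> nat"
    obtain a b c where abc: "abc = (a, b, c)" by (cases abc)
    define F where "F = qf a * qf b * qf c"
    have F: "0 < F" by (simp add: F_def)
    have "sqrt (qf (a + b)) * sqrt (qf (a + c)) * sqrt (qf (b + c)) =
        sqrt (qb (a + b) a * qb (a + c) a * qb (b + c) b * F\<^sup>2)"
      unfolding F_def by (simp add: q_fact_add real_sqrt_mult[symmetric] power2_eq_square mult_ac)
    also have "\<dots> \<le> sqrt (K * K * K * F\<^sup>2)"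
      using K by (intro real_sqrt_le_mono mult_right_mono mult_mono) (auto intro: less_imp_le)
    also have "\<dots> = sqrt (K ^ 3) * F"
      using F by (simp add: real_sqrt_mult power3_eq_cube)
    finally have sq: "sqrt (qf (a + b)) * sqrt (qf (a + c)) * sqrt (qf (b + c)) \<le> sqrt (K ^ 3) * F" .
    have "\<bar>H (a + b) x * H (a + c) y * H (b + c) z\<bar> \<le>
        (C * s ^ (a + b) * sqrt (qf (a + b))) * (C * s ^ (a + c) * sqrt (qf (a + c))) * (C * s ^ (b + c) * sqrt (qf (b + c)))"
      unfolding abs_mult using C assms(1-3) s by (intro mult_mono) auto
    also have "\<dots> = C ^ 3 * ((s ^ 2) ^ a * (s ^ 2) ^ b * (s ^ 2) ^ c) * (sqrt (qf (a + b)) * sqrt (qf (a + c)) * sqrt (qf (b + c)))"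
      by (simp add: power_add power2_eq_square power3_eq_cube power_mult_distrib)
    also have "\<dots> \<le> C ^ 3 * ((s ^ 2) ^ a * (s ^ 2) ^ b * (s ^ 2) ^ c) * (sqrt (K ^ 3) * F)"
      using C s by (intro mult_left_mono sq) auto
    finally have "\<bar>\<alpha>\<bar> ^ a * \<bar>\<beta>\<bar> ^ b * \<bar>\<gamma>\<bar> ^ c / F * \<bar>H (a + b) x * H (a + c) y * H (b + c) z\<bar> \<le>
        \<bar>\<alpha>\<bar> ^ a * \<bar>\<beta>\<bar> ^ b * \<bar>\<gamma>\<bar> ^ c / F * (C ^ 3 * ((s ^ 2) ^ a * (s ^ 2) ^ b * (s ^ 2) ^ c) * (sqrt (K ^ 3) * F))"
      using F by (intro mult_left_mono) auto
    also have "\<dots> = C ^ 3 * sqrt (K ^ 3) * ?f abc"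
      using F by (simp add: abc power_mult_distrib mult_ac)
    also have "\<bar>\<alpha>\<bar> ^ a * \<bar>\<beta>\<bar> ^ b * \<bar>\<gamma>\<bar> ^ c / F * \<bar>H (a + b) x * H (a + c) y * H (b + c) z\<bar> =
        norm (triple \<alpha> \<beta> \<gamma> x y z abc)"
      using F by (simp add: abc triple_def F_def abs_mult power_abs)
    finally show "norm (triple \<alpha> \<beta> \<gamma> x y z abc) \<le> C ^ 3 * sqrt (K ^ 3) * ?f abc" .
  qed simp
  then show ?thesis by (rule abs_summable_summable)
qed

text \<open>Summing over \<open>c\<close> first produces \<open>A i (n - i)\<close> in
  \<open>y\<close> and \<open>z\<close>; the finite diagonal \<open>a + b = n\<close> is summed
  next.\<close>

lemma triple_has_sum:
  assumes "x \<in> S q" "y \<in> S q" "z \<in> S q" "\<bar>\<alpha>\<bar> < 1" "\<bar>\<beta>\<bar> < 1" "\<bar>\<gamma>\<bar> < 1"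
  shows "((\<lambda>n. H n x / qf n * (\<Sum>i\<le>n. qb n i * (\<alpha> ^ i * \<beta> ^ (n - i) * A i (n - i) y z \<gamma>)))
    has_sum infsum (triple \<alpha> \<beta> \<gamma> x y z) UNIV) UNIV"
proof -
  let ?T = "infsum (triple \<alpha> \<beta> \<gamma> x y z) UNIV"
  let ?N = "Sigma (UNIV :: nat set) (\<lambda>n. {..n})"
  have "(triple \<alpha> \<beta> \<gamma> x y z has_sum ?T) UNIV"
    by (intro has_sum_infsum summable_on_triple assms)
  also have "?this \<longleftrightarrow> ((\<lambda>((n, i), c). triple \<alpha> \<beta> \<gamma> x y z (i, n - i, c)) has_sum ?T) (Sigma ?N (\<lambda>_. UNIV))"
    by (rule has_sum_reindex_bij_witness[of _ "\<lambda>((n, i), c). (i, n - i, c)" "\<lambda>(a, b, c). ((a + b, a), c)"]) auto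
  finally have 1: "((\<lambda>((n, i), c). triple \<alpha> \<beta> \<gamma> x y z (i, n - i, c)) has_sum ?T) (Sigma ?N (\<lambda>_. UNIV))" .
  have "((\<lambda>(n, i). \<alpha> ^ i * \<beta> ^ (n - i) / (qf i * qf (n - i)) * H n x * A i (n - i) y z \<gamma>) has_sum ?T) ?N"
  proof (rule has_sum_SigmaD[OF 1])
    fix ni assume "ni \<in> ?N"
    then obtain n i where ni: "ni = (n, i)" and i: "i \<le> n" by blast
    have "(A_term i (n - i) y z \<gamma> has_sum A i (n - i) y z \<gamma>) UNIV"
      using assms by (intro norm_summable_imp_has_sum sums_A) (simp_all add: summable_A_term_abs)
    from has_sum_cmult_right[OF this, of "\<alpha> ^ i * \<beta> ^ (n - i) / (qf i * qf (n - i)) * H n x"]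
    show "((\<lambda>c. (\<lambda>((n, i), c). triple \<alpha> \<beta> \<gamma> x y z (i, n - i, c)) (ni, c)) has_sum
        (\<lambda>(n, i). \<alpha> ^ i * \<beta> ^ (n - i) / (qf i * qf (n - i)) * H n x * A i (n - i) y z \<gamma>) ni) UNIV"
      using i by (simp add: ni A_term_def[abs_def] triple_def mult_ac)
  qed
  then show ?thesis
  proof (rule has_sum_SigmaD)
    fix n :: nat
    have "(\<Sum>i\<le>n. \<alpha> ^ i * \<beta> ^ (n - i) / (qf i * qf (n - i)) * H n x * A i (n - i) y z \<gamma>) =
        H n x / qf n * (\<Sum>i\<le>n. qb n i * (\<alpha> ^ i * \<beta> ^ (n - i) * A i (n - i) y z \<gamma>))"
      unfolding sum_distrib_left by (intro sum.cong refl) (simp add: q_binomial_def)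
    then show "((\<lambda>i. case (n, i) of (n, i) \<Rightarrow> \<alpha> ^ i * \<beta> ^ (n - i) / (qf i * qf (n - i)) * H n x * A i (n - i) y z \<gamma>) has_sum
        H n x / qf n * (\<Sum>i\<le>n. qb n i * (\<alpha> ^ i * \<beta> ^ (n - i) * A i (n - i) y z \<gamma>))) {..n}"
      using has_sum_finite[of "{..n}" "\<lambda>i. \<alpha> ^ i * \<beta> ^ (n - i) / (qf i * qf (n - i)) * H n x * A i (n - i) y z \<gamma>"] by simp
  qed
qed

text \<open>Grouping the triple series by \<open>a + b\<close> and by \<open>a + c\<close> gives the two sides.\<close>

lemma Mehler_product:
  assumes "x \<in> S q" "y \<in> S q" "z \<in> S q" "\<bar>\<rho>1\<bar> < 1" "\<bar>\<rho>2\<bar> < 1"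
  shows "(\<lambda>n. H n x / qf n * (poly2 (G n \<rho>1 \<rho>2) y z * A 0 0 y z (\<rho>1 * \<rho>2))) sums
    (A 0 0 x y \<rho>1 * A 0 0 x z \<rho>2)"
proof -
  have r: "\<bar>\<rho>1 * \<rho>2\<bar> < 1" by (rule abs_mult_less_1[OF assms(4,5)])
  let ?T = "infsum (triple \<rho>1 \<rho>2 (\<rho>1 * \<rho>2) x y z) UNIV"
  have "(\<lambda>n. H n x / qf n * (poly2 (G n \<rho>1 \<rho>2) y z * A 0 0 y z (\<rho>1 * \<rho>2))) sums ?T"
    unfolding poly2_G_A[OF assms(2,3) r]
    using has_sum_imp_sums[OF triple_has_sum[OF assms r]] by (simp add: mult.assoc)
  \<comment> \<open>Exchanging \<open>x\<close> with \<open>y\<close> and the index \<open>b\<close>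
    with \<open>c\<close> preserves the series and makes the diagonal \<open>a + c = n\<close>
    available.\<close>
  moreover have "?T = infsum (triple \<rho>1 (\<rho>1 * \<rho>2) \<rho>2 y x z) UNIV"
    by (rule infsum_reindex_bij_witness[of _ "\<lambda>(a, c, b). (a, b, c)" "\<lambda>(a, b, c). (a, c, b)"])
      (auto simp: triple_swap)
  moreover have "infsum (triple \<rho>1 (\<rho>1 * \<rho>2) \<rho>2 y x z) UNIV = A 0 0 x y \<rho>1 * A 0 0 x z \<rho>2"
  proof (rule sums_unique2)
    show "(\<lambda>n. H n y / qf n * (\<Sum>i\<le>n. qb n i * (\<rho>1 ^ i * (\<rho>1 * \<rho>2) ^ (n - i) * A i (n - i) x z \<rho>2)))
        sums infsum (triple \<rho>1 (\<rho>1 * \<rho>2) \<rho>2 y x z) UNIV"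
      using has_sum_imp_sums[OF triple_has_sum[OF assms(2,1,3,4) r assms(5)]] .
    have "H n y / qf n * (\<Sum>i\<le>n. qb n i * (\<rho>1 ^ i * (\<rho>1 * \<rho>2) ^ (n - i) * A i (n - i) x z \<rho>2)) =
        A_term 0 0 x y \<rho>1 n * A 0 0 x z \<rho>2" for n
    proof -
      \<comment> \<open>The parameters combine to \<open>\<rho>1 ^ n * \<rho>2 ^ (n - i)\<close>;
        what remains is evaluated by \<open>sum_q_binomial_A\<close>.\<close>
      have "(\<Sum>i\<le>n. qb n i * (\<rho>1 ^ i * (\<rho>1 * \<rho>2) ^ (n - i) * A i (n - i) x z \<rho>2)) =
          \<rho>1 ^ n * (\<Sum>i\<le>n. qb n i * (\<rho>2 ^ (n - i) * A i (n - i) x z \<rho>2))"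
        unfolding sum_distrib_left
      proof (intro sum.cong refl)
        fix i assume "i \<in> {..n}"
        then have "\<rho>1 ^ n = \<rho>1 ^ i * \<rho>1 ^ (n - i)" by (simp flip: power_add)
        then show "qb n i * (\<rho>1 ^ i * (\<rho>1 * \<rho>2) ^ (n - i) * A i (n - i) x z \<rho>2) =
            \<rho>1 ^ n * (qb n i * (\<rho>2 ^ (n - i) * A i (n - i) x z \<rho>2))"
          by (simp add: power_mult_distrib)
      qed
      also have "\<dots> = \<rho>1 ^ n * (H n x * A 0 0 x z \<rho>2)"
        by (simp only: sum_q_binomial_A[OF assms(1,3,5)])
      finally show ?thesis by (simp add: A_term_def)
    qed
    moreover have "(\<lambda>n. A_term 0 0 x y \<rho>1 n * A 0 0 x z \<rho>2) sums (A 0 0 x y \<rho>1 * A 0 0 x z \<rho>2)"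
      by (intro sums_mult2 sums_A assms)
    ultimately show "(\<lambda>n. H n y / qf n * (\<Sum>i\<le>n. qb n i * (\<rho>1 ^ i * (\<rho>1 * \<rho>2) ^ (n - i) * A i (n - i) x z \<rho>2)))
        sums (A 0 0 x y \<rho>1 * A 0 0 x z \<rho>2)" by simp
  qed
  ultimately show ?thesis by simp
qed

text \<open>The Mehler formula for each of the three products supplies exactly the three Pochhammer
  factors of the density.\<close>

lemma phi_eq_lt:
  assumes "x \<in> S q" "y \<in> S q" "z \<in> S q" "\<bar>\<rho>1\<bar> < 1" "\<bar>\<rho>2\<bar> < 1"
  shows "phi x y z \<rho>1 \<rho>2 q = q_normal x q * (A 0 0 x y \<rho>1 * A 0 0 x z \<rho>2 / A 0 0 y z (\<rho>1 * \<rho>2))"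
proof -
  have r: "\<bar>\<rho>1 * \<rho>2\<bar> < 1" by (rule abs_mult_less_1[OF assms(4,5)])
  let ?W = "\<lambda>y z r. prodinf (\<lambda>k. w k y z r q)"
  have "prodinf (\<lambda>k. w k y z (\<rho>1 * \<rho>2) q / (w k x y \<rho>1 q * w k x z \<rho>2 q)) =
      ?W y z (\<rho>1 * \<rho>2) / (?W x y \<rho>1 * ?W x z \<rho>2)"
    using assms r
    by (simp add: prodinf_mult prodinf_divide[symmetric] convergent_prod_mult convergent_prod_w)
  then show ?thesis using q_lt
    by (simp add: phi_def A_00_eq_lt assms r power_mult_distrib mult_ac)
qed

lemma phi_series:
  assumes "x \<in> S q" "y \<in> S q" "z \<in> S q" "\<bar>\<rho>1\<bar> < 1" "\<bar>\<rho>2\<bar> < 1"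
  shows "(\<lambda>n. H n x / qf n * poly2 (G n \<rho>1 \<rho>2) y z) sums
      (A 0 0 x y \<rho>1 * A 0 0 x z \<rho>2 / A 0 0 y z (\<rho>1 * \<rho>2))"
  using sums_divide[OF Mehler_product[OF assms], of "A 0 0 y z (\<rho>1 * \<rho>2)"]
    A_00_neq_0[OF assms(2,3) abs_mult_less_1[OF assms(4,5)]] by simp

text \<open>Decay relative to \<open>sqrt (qf n)\<close>, needed to integrate the series term by
  term. In the rate \<open>s^2 * m\<close> one factor \<open>s\<close> comes from the growth of
  \<open>A i (n - i)\<close>, the other from the \<open>n + 1\<close> summands.\<close>

lemma G_growth:
  assumes "y \<in> S q" "z \<in> S q" "\<bar>\<rho>1\<bar> < 1" "\<bar>\<rho>2\<bar> < 1"
  shows "\<exists>D \<tau>. 0 \<le> \<tau> \<and> \<tau> < 1 \<and> (\<forall>n. \<bar>poly2 (G n \<rho>1 \<rho>2) y z\<bar> \<le> D * \<tau> ^ n * sqrt (qf n))"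
proof -
  define r where "r = \<rho>1 * \<rho>2"
  have r: "\<bar>r\<bar> < 1" unfolding r_def by (rule abs_mult_less_1[OF assms(3,4)])
  define m where "m = max \<bar>\<rho>1\<bar> \<bar>\<rho>2\<bar>"
  have m: "\<bar>\<rho>1\<bar> \<le> m" "\<bar>\<rho>2\<bar> \<le> m" "0 \<le> m" "m < 1" using assms by (auto simp: m_def)
  have "max m \<bar>r\<bar> < 1" using m r by simp
  then obtain s where s: "1 < s" "s ^ 2 * max m \<bar>r\<bar> < 1" using exists_power_mult_less_1 by blast
  have s': "s ^ 2 * v < 1" if "v \<le> max m \<bar>r\<bar>" for v
    using s that by (smt (verit) mult_left_mono zero_le_power2)
  have sr: "s ^ 2 * \<bar>r\<bar> < 1" and sm: "s ^ 2 * m < 1" by (rule s', simp)+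
  obtain C where C: "0 < C" "\<And>x n. x \<in> S q \<Longrightarrow> \<bar>H n x\<bar> \<le> C * s ^ n * sqrt (qf n)"
    using Hermite_growth_uniform[OF s(1)] by blast
  obtain K where K: "0 < K" "\<And>n k. qb n k \<le> K" using q_binomial_bounded by blast
  obtain E where E: "0 < E" "\<And>n. real (Suc n) \<le> E * s ^ n" using Suc_le_geometric[OF s(1)] by blast
  have KK: "sqrt (qb n k) \<le> sqrt K" for n k using K by simp
  \<comment> \<open>The value of the geometric series over \<open>c\<close> that dominates each
    kernel.\<close>
  define Z where "Z = 1 / (1 - s ^ 2 * \<bar>r\<bar>)"
  have Z: "0 < Z" using sr by (simp add: Z_def)
  have A_bound: "\<bar>A a b y z r\<bar> \<le> C\<^sup>2 * K * s ^ (a + b) * sqrt (qf a * qf b) * Z" for a b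
  proof -
    have "\<bar>A a b y z r\<bar> \<le> (\<Sum>c. \<bar>A_term a b y z r c\<bar>)"
      unfolding A_def by (rule summable_rabs[OF summable_A_term_abs[OF assms(1,2) r]])
    also have "\<dots> \<le> (\<Sum>c. C\<^sup>2 * K * s ^ (a + b) * sqrt (qf a * qf b) * (s ^ 2 * \<bar>r\<bar>) ^ c)"
    proof (rule suminf_le[OF _ summable_A_term_abs[OF assms(1,2) r]])
      show "summable (\<lambda>c. C\<^sup>2 * K * s ^ (a + b) * sqrt (qf a * qf b) * (s ^ 2 * \<bar>r\<bar>) ^ c)"
        using sr s by (intro summable_mult summable_geometric) simp
      fix c
      have q: "sqrt (qf (a + c)) * sqrt (qf (b + c)) \<le> K * sqrt (qf a * qf b) * qf c"
      proof -
        have "sqrt (qf (a + c)) * sqrt (qf (b + c)) =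
            sqrt (qb (a + c) a) * sqrt (qb (b + c) b) * (sqrt (qf a * qf b) * (sqrt (qf c) * sqrt (qf c)))"
          by (simp add: q_fact_add real_sqrt_mult del: real_sqrt_mult_self real_sqrt_abs2)
        also have "\<dots> \<le> sqrt K * sqrt K * (sqrt (qf a * qf b) * (sqrt (qf c) * sqrt (qf c)))"
          using K by (intro mult_right_mono mult_mono KK) auto
        finally show ?thesis using K by simp
      qed
      have "\<bar>A_term a b y z r c\<bar> = \<bar>r\<bar> ^ c / qf c * (\<bar>H (a + c) y\<bar> * \<bar>H (b + c) z\<bar>)"
        by (simp add: A_term_def abs_mult power_abs)
      also have "\<dots> \<le> \<bar>r\<bar> ^ c / qf c * ((C * s ^ (a + c) * sqrt (qf (a + c))) * (C * s ^ (b + c) * sqrt (qf (b + c))))"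
        using C s assms by (intro mult_left_mono mult_mono) auto
      also have "\<dots> = \<bar>r\<bar> ^ c / qf c * (C\<^sup>2 * s ^ (a + b) * (s ^ 2) ^ c) * (sqrt (qf (a + c)) * sqrt (qf (b + c)))"
        by (simp add: power_add power2_eq_square power_mult_distrib)
      also have "\<dots> \<le> \<bar>r\<bar> ^ c / qf c * (C\<^sup>2 * s ^ (a + b) * (s ^ 2) ^ c) * (K * sqrt (qf a * qf b) * qf c)"
        using C s by (intro mult_left_mono q) auto
      also have "\<dots> = C\<^sup>2 * K * s ^ (a + b) * sqrt (qf a * qf b) * (s ^ 2 * \<bar>r\<bar>) ^ c"
        by (simp add: power_mult_distrib)
      finally show "\<bar>A_term a b y z r c\<bar> \<le> \<dots>" .
    qed
    also have "\<dots> = C\<^sup>2 * K * s ^ (a + b) * sqrt (qf a * qf b) * Z"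
    proof -
      have "(\<lambda>c. (s ^ 2 * \<bar>r\<bar>) ^ c) sums Z" unfolding Z_def using sr by (intro geometric_sums) simp
      from sums_unique[OF sums_mult[OF this]] show ?thesis by simp
    qed
    finally show ?thesis .
  qed
  define B where "B = E * (sqrt K * C\<^sup>2 * K * Z)"
  have G_bound: "\<bar>poly2 (G n \<rho>1 \<rho>2) y z * A 0 0 y z r\<bar> \<le> B * (s ^ 2 * m) ^ n * sqrt (qf n)" for n
  proof -
    have "\<bar>poly2 (G n \<rho>1 \<rho>2) y z * A 0 0 y z r\<bar> \<le>
        (\<Sum>i\<le>n. \<bar>qb n i * \<rho>1 ^ i * \<rho>2 ^ (n - i) * A i (n - i) y z r\<bar>)"
      using poly2_G_A[OF assms(1,2) r[unfolded r_def]] by (simp only: r_def sum_abs)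
    also have "\<dots> \<le> (\<Sum>i\<le>n. sqrt K * C\<^sup>2 * K * Z * (s * m) ^ n * sqrt (qf n))"
    proof (rule sum_mono)
      fix i assume "i \<in> {..n}"
      then have i: "i \<le> n" by simp
      have q: "qb n i * sqrt (qf i * qf (n - i)) \<le> sqrt K * sqrt (qf n)"
      proof -
        have "qb n i * sqrt (qf i * qf (n - i)) = sqrt (qb n i) * (sqrt (qb n i) * sqrt (qf i * qf (n - i)))"
          by simp
        also have "sqrt (qb n i) * sqrt (qf i * qf (n - i)) = sqrt (qf n)"
          using i by (simp add: q_binomial_def real_sqrt_mult[symmetric])
        finally show ?thesis using KK by (simp add: mult_right_mono)
      qed
      have p: "\<bar>\<rho>1\<bar> ^ i * \<bar>\<rho>2\<bar> ^ (n - i) \<le> m ^ n"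
      proof -
        have "\<bar>\<rho>1\<bar> ^ i * \<bar>\<rho>2\<bar> ^ (n - i) \<le> m ^ i * m ^ (n - i)"
          using m by (intro mult_mono power_mono) auto
        then show ?thesis using i by (simp flip: power_add)
      qed
      have "\<bar>qb n i * \<rho>1 ^ i * \<rho>2 ^ (n - i) * A i (n - i) y z r\<bar> =
          qb n i * (\<bar>\<rho>1\<bar> ^ i * \<bar>\<rho>2\<bar> ^ (n - i)) * \<bar>A i (n - i) y z r\<bar>"
        by (simp add: abs_mult power_abs)
      also have "\<dots> \<le> qb n i * m ^ n * (C\<^sup>2 * K * s ^ n * sqrt (qf i * qf (n - i)) * Z)"
        using A_bound[of i "n - i"] i p m C K s Z by (intro mult_mono mult_left_mono) auto
      also have "\<dots> = (C\<^sup>2 * K * Z * (s * m) ^ n) * (qb n i * sqrt (qf i * qf (n - i)))"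
        by (simp add: power_mult_distrib)
      also have "\<dots> \<le> (C\<^sup>2 * K * Z * (s * m) ^ n) * (sqrt K * sqrt (qf n))"
        using C K Z s m by (intro mult_left_mono q) auto
      finally show "\<bar>qb n i * \<rho>1 ^ i * \<rho>2 ^ (n - i) * A i (n - i) y z r\<bar> \<le>
          sqrt K * C\<^sup>2 * K * Z * (s * m) ^ n * sqrt (qf n)" by (simp add: mult_ac)
    qed
    also have "\<dots> = real (Suc n) * (sqrt K * C\<^sup>2 * K * Z * (s * m) ^ n * sqrt (qf n))"
      by simp
    also have "\<dots> \<le> (E * s ^ n) * (sqrt K * C\<^sup>2 * K * Z * (s * m) ^ n * sqrt (qf n))"
      using C K Z s m E(2)[of n] by (intro mult_right_mono) auto
    also have "\<dots> = B * (s ^ 2 * m) ^ n * sqrt (qf n)"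
      by (simp add: B_def power_mult_distrib power2_eq_square)
    finally show ?thesis .
  qed
  define a where "a = \<bar>A 0 0 y z r\<bar>"
  have a: "0 < a" using A_00_neq_0[OF assms(1,2) r] by (simp add: a_def)
  have "\<bar>poly2 (G n \<rho>1 \<rho>2) y z\<bar> \<le> B / a * (s ^ 2 * m) ^ n * sqrt (qf n)" for n
    using G_bound[of n] a by (simp add: abs_mult a_def[symmetric] field_simps)
  then show ?thesis using sm s m by (intro exI[of _ "B / a"] exI[of _ "s ^ 2 * m"]) auto
qed

end

section \<open>Trigonometric integrals of truncated weights\<close>

context q_param_lt
begin

definition q_poch :: "nat \<Rightarrow> real" where "q_poch n = (\<Prod>k<n. 1 - q ^ (k + 1))"

lemma q_poch_0 [simp]: "q_poch 0 = 1" and q_poch_Suc: "q_poch (Suc n) = q_poch n * (1 - q ^ Suc n)"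
  by (simp_all add: q_poch_def)

lemma q_poch_pos [simp]: "0 < q_poch n"
  unfolding q_poch_def by (intro prod_pos) (use q_power_less_1 in auto)

lemma q_poch_neq_0 [simp]: "q_poch n \<noteq> 0"
  using q_poch_pos[of n] by linarith

lemma q_poch_eq: "q_poch n = (1 - q) ^ n * qf n"
  unfolding q_poch_def by (rule prod_euler_eq)

lemma q_binomial_q_poch: "k \<le> n \<Longrightarrow> qb n k = q_poch n / (q_poch k * q_poch (n - k))"
proof -
  assume k: "k \<le> n"
  have "(1 - q) ^ n = (1 - q) ^ k * (1 - q) ^ (n - k)" using k by (simp flip: power_add)
  then show ?thesis using k q_lt by (simp add: q_binomial_def q_poch_eq)
qed

definition euler :: real where "euler = prodinf (\<lambda>k. 1 - q ^ (k + 1))"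

lemma q_poch_tendsto: "q_poch \<longlonglongrightarrow> euler"
  using convergent_prod_lessThan_LIMSEQ[OF convergent_prod_euler] by (simp add: q_poch_def[abs_def] euler_def)

lemma euler_neq_0: "euler \<noteq> 0"
proof -
  have "1 - q ^ (k + 1) \<noteq> 0" for k using q_power_less_1[of k] by simp
  then show ?thesis unfolding euler_def by (intro prodinf_nonzero[OF convergent_prod_euler])
qed

text \<open>The continuous q-Hermite polynomials at \<open>cos t\<close> in their classical
  normalisation.\<close>

definition Hermite_trig :: "nat \<Rightarrow> real \<Rightarrow> real" where "Hermite_trig n t = \<kappa> ^ n * H n (2 * cos t / \<kappa>)"

text \<open>Each factor is \<open>|1 - q ^ k * e^(2it)|^2\<close>; these are the first
  \<open>N\<close> factors of the orthogonality weight in the angle \<open>t\<close>.\<close>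

definition wt_trunc :: "nat \<Rightarrow> real \<Rightarrow> real" where "wt_trunc N t = (\<Prod>k<N. 1 + q ^ (2 * k) - 2 * q ^ k * cos (2 * t))"

text \<open>On this interval \<open>2 * cos t / \<kappa>\<close> increases from one end of
  \<open>S q\<close> to the other, which suits the later substitution.\<close>

definition wt_moment :: "nat \<Rightarrow> nat \<Rightarrow> real" where "wt_moment N n = set_lebesgue_integral lborel {-pi..0} (\<lambda>t. wt_trunc N t * Hermite_trig n t)"

lemma Hermite_trig_rec: "2 * cos t * Hermite_trig n t = Hermite_trig (Suc n) t + (1 - q ^ n) * Hermite_trig (n - 1) t"
proof (cases n)
  case 0
  then show ?thesis by (simp add: Hermite_trig_def)
next
  case (Suc m)
  have "Hermite_trig (Suc n) t = \<kappa> ^ n * (2 * cos t * H n (2 * cos t / \<kappa>)) - \<kappa>\<^sup>2 * qi n * (\<kappa> ^ m * H m (2 * cos t / \<kappa>))"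
    by (simp add: Hermite_trig_def Suc power2_eq_square algebra_simps)
  also have "\<kappa>\<^sup>2 * qi n = 1 - q ^ n" by (simp only: kappa_sq q_int_geometric)
  finally show ?thesis by (simp add: Hermite_trig_def Suc algebra_simps)
qed

lemma continuous_on_Hermite: "continuous_on U (\<lambda>x. H n x)"
proof -
  have "continuous_on U (\<lambda>x. H n x) \<and> continuous_on U (\<lambda>x. H (Suc n) x)"
    by (induction n) (auto intro!: continuous_intros)
  then show ?thesis by blast
qed

lemma continuous_on_Hermite_trig [continuous_intros]: "continuous_on U (Hermite_trig n)"
proof -
  have "continuous_on U (\<lambda>t. H n (2 * cos t / \<kappa>))"
    by (rule continuous_on_compose2[OF continuous_on_Hermite[of UNIV]]) (auto intro!: continuous_intros)
  then show ?thesis unfolding Hermite_trig_def[abs_def] by (intro continuous_intros)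
qed

lemma continuous_on_wt_trunc [continuous_intros]: "continuous_on U (wt_trunc N)"
  unfolding wt_trunc_def[abs_def] by (intro continuous_intros)

lemma set_integrable_wt_trunc: "set_integrable lborel {-pi..0} (\<lambda>t. wt_trunc N t * Hermite_trig n t)"
  by (intro borel_integrable_atLeastAtMost' continuous_intros)

text \<open>The new factor multiplies by \<open>2 * cos (2 * t) = (2 * cos t)^2 - 2\<close>, which
  two uses of the three-term recurrence turn into shifts of \<open>n\<close> by two. The coefficient
  of index \<open>n - 2\<close> vanishes for \<open>n = 0\<close> and \<open>n = 1\<close>, where
  that index is truncated.\<close>

lemma wt_trunc_rec:
  "wt_trunc (Suc N) t * Hermite_trig n t = (1 + q ^ (2 * N) + q ^ N * (q ^ n + q ^ Suc n)) * (wt_trunc N t * Hermite_trig n t)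
    - q ^ N * (wt_trunc N t * Hermite_trig (n + 2) t) - q ^ N * (1 - q ^ n) * (1 - q ^ (n - 1)) * (wt_trunc N t * Hermite_trig (n - 2) t)"
proof -
  have "(2 * cos t) * (2 * cos t * Hermite_trig n t) = 2 * cos t * Hermite_trig (Suc n) t + (1 - q ^ n) * (2 * cos t * Hermite_trig (n - 1) t)"
    unfolding Hermite_trig_rec[of t n] by (simp add: algebra_simps)
  also have "\<dots> = Hermite_trig (n + 2) t + (1 - q ^ Suc n) * Hermite_trig n t
      + (1 - q ^ n) * (Hermite_trig (Suc (n - 1)) t + (1 - q ^ (n - 1)) * Hermite_trig (n - 2) t)"
    unfolding Hermite_trig_rec[of t "Suc n"] Hermite_trig_rec[of t "n - 1"] by (simp add: numeral_2_eq_2)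
  also have "(1 - q ^ n) * (Hermite_trig (Suc (n - 1)) t + (1 - q ^ (n - 1)) * Hermite_trig (n - 2) t) =
      (1 - q ^ n) * (Hermite_trig n t + (1 - q ^ (n - 1)) * Hermite_trig (n - 2) t)"
    by (cases n) simp_all
  finally have "2 * cos (2 * t) * Hermite_trig n t = Hermite_trig (n + 2) t - (q ^ n + q ^ Suc n) * Hermite_trig n t
      + (1 - q ^ n) * (1 - q ^ (n - 1)) * Hermite_trig (n - 2) t"
    by (simp only: cos_double_cos power2_eq_square) (simp add: algebra_simps)
  then have *: "wt_trunc N t * (q ^ N * (2 * cos (2 * t) * Hermite_trig n t)) = wt_trunc N t * (q ^ N * (Hermite_trig (n + 2) t - (q ^ n + q ^ Suc n) * Hermite_trig n t
      + (1 - q ^ n) * (1 - q ^ (n - 1)) * Hermite_trig (n - 2) t))" by simp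
  have "wt_trunc (Suc N) t * Hermite_trig n t = (1 + q ^ (2 * N)) * (wt_trunc N t * Hermite_trig n t) - wt_trunc N t * (q ^ N * (2 * cos (2 * t) * Hermite_trig n t))"
    by (simp add: wt_trunc_def algebra_simps)
  then show ?thesis unfolding * by (simp only: ring_distribs mult_ac)
qed

lemma wt_moment_rec:
  "wt_moment (Suc N) n = (1 + q ^ (2 * N) + q ^ N * (q ^ n + q ^ Suc n)) * wt_moment N n
    - q ^ N * wt_moment N (n + 2) - q ^ N * (1 - q ^ n) * (1 - q ^ (n - 1)) * wt_moment N (n - 2)"
  unfolding wt_moment_def wt_trunc_rec
  by (simp only: set_integral_diff(2) set_integral_diff(1) set_integral_mult_right set_integrable_mult_right set_integrable_wt_trunc)

lemma integral_cos_int: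
  "set_lebesgue_integral lborel {-pi..0} (\<lambda>t. cos (real_of_int m * t)) = (if m = 0 then pi else 0)"
proof (cases "m = 0")
  case False
  have "(LBINT t. indicator {-pi..0} t *\<^sub>R cos (real_of_int m * t)) =
      sin (real_of_int m * 0) / real_of_int m - sin (real_of_int m * (- pi)) / real_of_int m"
    using False
    by (intro integral_FTC_atLeastAtMost)
       (auto intro!: continuous_intros derivative_eq_intros simp flip: has_real_derivative_iff_has_vector_derivative)
  then show ?thesis using False sin_npi_int[of m] by (simp add: set_lebesgue_integral_def mult.commute[of _ pi])
qed (simp add: set_lebesgue_integral_def)

lemma wt_moment_0: "wt_moment 0 n = (if even n then pi * qb n (n div 2) else 0)"
proof -
  have cont: "set_integrable lborel {-pi..0} (\<lambda>t. qb n j * cos (real_of_int (int n - 2 * int j) * t))" for j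
    by (intro borel_integrable_atLeastAtMost' continuous_intros)
  have "wt_moment 0 n = set_lebesgue_integral lborel {-pi..0} (\<lambda>t. \<Sum>j\<le>n. qb n j * cos (real_of_int (int n - 2 * int j) * t))"
    by (simp add: wt_moment_def wt_trunc_def Hermite_trig_def Hermite_cos)
  also have "\<dots> = (\<Sum>j\<le>n. qb n j * (if int n - 2 * int j = 0 then pi else 0))"
  proof -
    have "set_lebesgue_integral lborel {-pi..0} (\<lambda>t. \<Sum>j\<le>n. qb n j * cos (real_of_int (int n - 2 * int j) * t)) =
        (\<Sum>j\<le>n. set_lebesgue_integral lborel {-pi..0} (\<lambda>t. qb n j * cos (real_of_int (int n - 2 * int j) * t)))"
      unfolding set_lebesgue_integral_def scaleR_sum_right
      by (rule Bochner_Integration.integral_sum) (use cont in \<open>simp add: set_integrable_def\<close>)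
    then show ?thesis by (simp only: set_integral_mult_right integral_cos_int)
  qed
  also have "\<dots> = (\<Sum>j\<le>n. if j = n div 2 then (if even n then pi * qb n (n div 2) else 0) else 0)"
    by (intro sum.cong refl) (auto elim: evenE oddE)
  also have "\<dots> = (if even n then pi * qb n (n div 2) else 0)"
    by simp
  finally show ?thesis .
qed

text \<open>The shape of this closed form comes from the expansion of \<open>H\<^sub>n\<close> in the continuous
  \<open>q\<close>-ultraspherical polynomials with \<open>\<beta> = q\<^sup>N\<close>, which are orthogonal for the truncated weight.\<close>

definition wt_moment_even :: "nat \<Rightarrow> nat \<Rightarrow> real" where
  "wt_moment_even N p = 2 * pi * q_poch (2 * N) * q ^ (N * p) * q_poch (2 * p) / ((1 + q ^ N) * q_poch N * q_poch p * q_poch (N + p))"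

lemma abs_q_power_Suc_less_1: "\<bar>q ^ Suc n\<bar> < 1"
  unfolding power_abs using abs_q_lt by (intro power_less_one_iff[THEN iffD2]) auto

lemma one_plus_q_power_pos: "0 < 1 + q ^ N"
proof (cases N)
  case (Suc M)
  show ?thesis using abs_q_power_Suc_less_1[of M] unfolding Suc abs_less_iff by linarith
qed simp

text \<open>Ratios of neighbouring closed forms are rational in \<open>B = q ^ N\<close> and
  \<open>P = q ^ p\<close>. Stated without division, they reduce the recurrence in \<open>N\<close>
  to a polynomial identity.\<close>

lemma wt_moment_even_ratio_N:
  "wt_moment_even (Suc N) p * (1 - q * q ^ N * q ^ p) = wt_moment_even N p * ((1 - q * (q ^ N)\<^sup>2) * (1 + q ^ N) * q ^ p)"
proof -
  define B P where "B = q ^ N" and "P = q ^ p"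
  have d: "1 - q * B \<noteq> 0" "1 - q * B * P \<noteq> 0" "1 + B \<noteq> 0" "1 + q * B \<noteq> 0"
    using q_power_less_1[of N] q_power_less_1[of "N + p"] one_plus_q_power_pos[of N] one_plus_q_power_pos[of "Suc N"]
    by (auto simp: B_def P_def power_add mult_ac)
  have B2: "q ^ (2 * N) = B\<^sup>2" by (simp add: B_def power_mult[symmetric] mult.commute)
  have e: "q_poch (2 * Suc N) = q_poch (2 * N) * ((1 - q * B\<^sup>2) * (1 - q * B) * (1 + q * B))"
    "q_poch (Suc N) = q_poch N * (1 - q * B)" "q_poch (Suc N + p) = q_poch (N + p) * (1 - q * B * P)"
    "q ^ (Suc N * p) = q ^ (N * p) * P" "q ^ Suc N = q * B"
    by (simp add: q_poch_Suc B2, simp add: power2_eq_square algebra_simps)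
      (simp_all add: q_poch_Suc B_def P_def power_add algebra_simps)
  have "wt_moment_even (Suc N) p * (1 - q * B * P) = wt_moment_even N p * ((1 - q * B\<^sup>2) * (1 + B) * P)"
    unfolding wt_moment_even_def e B_def[symmetric] using d by (simp add: divide_simps)
  then show ?thesis by (simp add: B_def P_def)
qed

lemma wt_moment_even_ratio_p:
  "wt_moment_even N (Suc p) * (1 - q * q ^ N * q ^ p) = wt_moment_even N p * (q ^ N * (1 - q * (q ^ p)\<^sup>2) * (1 + q * q ^ p))"
proof -
  define B P where "B = q ^ N" and "P = q ^ p"
  have d: "1 - q * P \<noteq> 0" "1 - q * B * P \<noteq> 0" "1 + B \<noteq> 0"
    using q_power_less_1[of p] q_power_less_1[of "N + p"] one_plus_q_power_pos[of N]
    by (auto simp: B_def P_def power_add mult_ac)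
  have P2: "q ^ (2 * p) = P\<^sup>2" by (simp add: P_def power_mult[symmetric] mult.commute)
  have e: "q_poch (2 * Suc p) = q_poch (2 * p) * ((1 - q * P\<^sup>2) * (1 - q * P) * (1 + q * P))"
    "q_poch (Suc p) = q_poch p * (1 - q * P)" "q_poch (N + Suc p) = q_poch (N + p) * (1 - q * B * P)"
    "q ^ (N * Suc p) = q ^ (N * p) * B"
    by (simp add: q_poch_Suc P2, simp add: power2_eq_square algebra_simps)
      (simp_all add: q_poch_Suc B_def P_def power_add algebra_simps)
  have "wt_moment_even N (Suc p) * (1 - q * B * P) = wt_moment_even N p * (B * (1 - q * P\<^sup>2) * (1 + q * P))"
    unfolding wt_moment_even_def e B_def[symmetric] using d by (simp add: divide_simps)
  then show ?thesis by (simp add: B_def P_def)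
qed

lemma wt_moment_eq: "wt_moment N n = (if even n then wt_moment_even N (n div 2) else 0)"
proof (induction N arbitrary: n)
  case 0
  show ?case
    by (auto simp: wt_moment_0 wt_moment_even_def q_binomial_q_poch elim: evenE)
next
  case (Suc N)
  define B where "B = q ^ N"
  have d: "1 - q * B * q ^ p \<noteq> 0" for p
    using q_power_less_1[of "N + p"] by (auto simp: B_def power_add mult_ac)
  show ?case
  proof (cases "even n")
    case False
    \<comment> \<open>For \<open>n = 1\<close> the truncated \<open>n - 2\<close> is 0, whose moment
      is nonzero; the factor \<open>1 - q ^ 0\<close> removes it.\<close>
    have "n = 1 \<or> odd (n - 2)" using False by presburger
    then have "(1 - q ^ (n - 1)) * wt_moment N (n - 2) = 0" using Suc by auto
    then show ?thesis using False Suc[of n] Suc[of "n + 2"] by (simp add: wt_moment_rec)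
  next
    case True
    then obtain p where n: "n = 2 * p" by (elim evenE)
    define P where "P = q ^ p"
    define X where "X = wt_moment_even N p"
    have 1: "wt_moment_even (Suc N) p * (1 - q * B * P) = X * ((1 - q * B\<^sup>2) * (1 + B) * P)"
      unfolding X_def B_def P_def by (rule wt_moment_even_ratio_N)
    have 2: "wt_moment_even N (Suc p) * (1 - q * B * P) = X * (B * (1 - q * P\<^sup>2) * (1 + q * P))"
      unfolding X_def B_def P_def by (rule wt_moment_even_ratio_p)
    \<comment> \<open>The moment of index \<open>n - 2\<close> is brought back to \<open>X\<close>
      by the ratio in \<open>p\<close>, taken at \<open>p - 1\<close>; for \<open>p = 0\<close> both
      sides are zero.\<close>
    have 3: "B * (1 - q ^ n) * (1 - q ^ (n - 1)) * wt_moment N (n - 2) = X * ((1 - P) * (1 - B * P))"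
    proof (cases p)
      case (Suc m)
      define R where "R = q ^ m"
      have P: "P = q * R" by (simp add: P_def Suc R_def)
      have r: "X * (1 - q * B * R) = wt_moment_even N m * (B * (1 - q * R\<^sup>2) * (1 + q * R))"
        unfolding X_def B_def R_def Suc by (rule wt_moment_even_ratio_p)
      have wt_moment: "wt_moment N (n - 2) = wt_moment_even N m" using Suc.IH[of "n - 2"] by (simp add: n Suc)
      have q1: "q ^ n = P\<^sup>2" by (simp add: n P_def power_mult mult.commute[of 2])
      have q2: "q ^ (n - 1) = q * R\<^sup>2" by (simp add: n Suc R_def power_mult mult.commute[of 2])
      show ?thesis unfolding wt_moment q1 q2 using r P by algebra
    qed (simp add: n P_def)
    have J1: "wt_moment N n = X" "wt_moment N (n + 2) = wt_moment_even N (Suc p)"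
      using Suc.IH[of n] Suc.IH[of "n + 2"] by (simp_all add: n X_def)
    have q1: "q ^ n + q ^ Suc n = P\<^sup>2 * (1 + q)" "q ^ (2 * N) = B\<^sup>2"
      by (simp_all add: n P_def B_def power_mult mult.commute[of 2] algebra_simps)
    have "wt_moment (Suc N) n = (1 + B\<^sup>2 + B * (P\<^sup>2 * (1 + q))) * X - B * wt_moment_even N (Suc p) - X * ((1 - P) * (1 - B * P))"
      unfolding wt_moment_rec B_def[symmetric] 3 J1 q1 by simp
    then have "wt_moment (Suc N) n * (1 - q * B * P) =
        ((1 + B\<^sup>2 + B * (P\<^sup>2 * (1 + q))) * X - B * wt_moment_even N (Suc p) - X * ((1 - P) * (1 - B * P))) * (1 - q * B * P)"
      by (simp only:)
    also have "\<dots> = (1 + B\<^sup>2 + B * (P\<^sup>2 * (1 + q))) * X * (1 - q * B * P)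
        - B * (wt_moment_even N (Suc p) * (1 - q * B * P)) - X * ((1 - P) * (1 - B * P)) * (1 - q * B * P)"
      by (simp add: algebra_simps)
    also have "\<dots> = wt_moment_even (Suc N) p * (1 - q * B * P)"
      unfolding 1 2 by (simp add: power2_eq_square algebra_simps)
    finally have "wt_moment (Suc N) n = wt_moment_even (Suc N) p" using d[of p] by (simp add: P_def)
    then show ?thesis by (simp add: n)
  qed
qed

text \<open>The factor \<open>q ^ (N * p)\<close> kills every even moment except
  \<open>p = 0\<close>, where the quotient of finite products tends to
  \<open>1 / euler\<close>.\<close>

lemma wt_moment_tendsto: "(\<lambda>N. wt_moment N n) \<longlonglongrightarrow> (if n = 0 then 2 * pi / euler else 0)"
proof (cases "even n")
  case True
  then obtain p where n: "n = 2 * p" by (elim evenE)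
  have wt_moment: "wt_moment N n = 2 * pi * q_poch (2 * N) * (q ^ p) ^ N * q_poch (2 * p) / ((1 + q ^ N) * q_poch N * q_poch p * q_poch (N + p))" for N
    by (simp add: wt_moment_eq n wt_moment_even_def power_mult[symmetric] mult.commute[of N])
  have lim2: "(\<lambda>N. q_poch (2 * N)) \<longlonglongrightarrow> euler"
    using LIMSEQ_subseq_LIMSEQ[OF q_poch_tendsto, of "\<lambda>N. 2 * N"] by (simp add: strict_mono_def o_def)
  have limp: "(\<lambda>N. q_poch (N + p)) \<longlonglongrightarrow> euler"
    by (rule LIMSEQ_ignore_initial_segment[OF q_poch_tendsto])
  have limq: "(\<lambda>N. q ^ N) \<longlonglongrightarrow> 0" using abs_q_lt by (intro LIMSEQ_power_zero) simp
  have limqp: "(\<lambda>N. (q ^ p) ^ N) \<longlonglongrightarrow> (if n = 0 then 1 else 0)"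
  proof (cases p)
    case (Suc m)
    then show ?thesis using LIMSEQ_power_zero[of "q ^ p"] abs_q_power_Suc_less_1[of m] by (simp add: n)
  qed (simp add: n)
  have "(\<lambda>N. wt_moment N n) \<longlonglongrightarrow> 2 * pi * euler * (if n = 0 then 1 else 0) * q_poch (2 * p) / ((1 + 0) * euler * q_poch p * euler)"
    unfolding wt_moment using euler_neq_0 by (intro tendsto_intros lim2 limp limq limqp q_poch_tendsto) auto
  also have "2 * pi * euler * (if n = 0 then 1 else 0) * q_poch (2 * p) / ((1 + 0) * euler * q_poch p * euler) =
      (if n = 0 then 2 * pi / euler else 0)"
    using euler_neq_0 by (simp add: n)
  finally show ?thesis .
qed (auto simp: wt_moment_eq)

end

section \<open>Orthogonality and termwise integration\<close>

context q_param_lt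
begin

section \<open>Boundedness and measurability of the q-normal density\<close>

definition wt_factor :: "nat \<Rightarrow> real \<Rightarrow> real" where "wt_factor k x = (1 + q ^ k)\<^sup>2 - (1 - q) * x\<^sup>2 * q ^ k"

lemma q_normal_eq:
  "q_normal x q = indicator (S q) x * (\<kappa> / (2 * pi * sqrt (4 - (1 - q) * x\<^sup>2)) * prodinf (\<lambda>k. wt_factor k x) * euler)"
  using q_lt by (simp add: q_normal_def wt_factor_def \<kappa>_def euler_def)

lemma convergent_prod_wt_factor: "convergent_prod (\<lambda>k. wt_factor k x)"
proof (rule convergent_prod_one_plus)
  show "summable (\<lambda>k. \<bar>wt_factor k x - 1\<bar>)"
  proof (rule summable_comparison_test')
    show "summable (\<lambda>k. (3 + (1 - q) * x\<^sup>2) * \<bar>q\<bar> ^ k)"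
      by (intro summable_mult summable_abs_q_power)
    fix k
    have "wt_factor k x - 1 = q ^ k * (2 + q ^ k - (1 - q) * x\<^sup>2)"
      by (simp add: wt_factor_def power2_eq_square algebra_simps)
    moreover have "\<bar>2 + q ^ k - (1 - q) * x\<^sup>2\<bar> \<le> 3 + (1 - q) * x\<^sup>2"
    proof -
      have "0 \<le> (1 - q) * x\<^sup>2" using q_lt by simp
      then show ?thesis using abs_q_power_le[of k] by linarith
    qed
    ultimately have "\<bar>wt_factor k x - 1\<bar> \<le> \<bar>q\<bar> ^ k * (3 + (1 - q) * x\<^sup>2)"
      by (simp add: abs_mult power_abs mult_left_mono)
    then show "norm \<bar>wt_factor k x - 1\<bar> \<le> (3 + (1 - q) * x\<^sup>2) * \<bar>q\<bar> ^ k" by (simp add: mult.commute)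
  qed
qed

text \<open>On \<open>S q\<close> the number \<open>(1 - q) * x^2\<close> lies in
  \<open>[0, 4]\<close>, so the factor lies between \<open>(1 - q ^ k)^2\<close> and
  \<open>(1 + q ^ k)^2\<close>, in an order depending on the sign of \<open>q ^ k\<close>.\<close>

lemma wt_factor_bounds:
  assumes "x \<in> S q"
  shows "0 \<le> wt_factor k x" "wt_factor k x \<le> (1 + \<bar>q\<bar> ^ k)\<^sup>2"
proof -
  define X where "X = (1 - q) * x\<^sup>2"
  have X: "0 \<le> X" "X \<le> 4"
  proof -
    have "(\<kappa> * x)\<^sup>2 \<le> 2\<^sup>2" using power_mono[of "\<bar>\<kappa> * x\<bar>" 2 2] assms by (simp add: S_iff)
    then show "X \<le> 4" by (simp add: X_def power_mult_distrib kappa_sq)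
    show "0 \<le> X" using q_lt by (simp add: X_def)
  qed
  define Q where "Q = q ^ k"
  have wt_factor: "wt_factor k x = (1 + Q)\<^sup>2 - X * Q" by (simp add: wt_factor_def X_def Q_def)
  have "0 \<le> wt_factor k x \<and> wt_factor k x \<le> (1 + \<bar>Q\<bar>)\<^sup>2"
  proof (cases "0 \<le> Q")
    case True
    then have "0 \<le> X * Q" "X * Q \<le> 4 * Q" using X by (auto intro: mult_right_mono)
    moreover have "0 \<le> (1 - Q)\<^sup>2" by simp
    ultimately show ?thesis using True unfolding wt_factor by (simp add: power2_eq_square algebra_simps)
  next
    case False
    then have "X * Q \<le> 0" "4 * Q \<le> X * Q" using X by (auto intro: mult_right_mono_neg simp: mult_nonneg_nonpos)
    moreover have "0 \<le> (1 + Q)\<^sup>2" by simp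
    ultimately show ?thesis using False unfolding wt_factor by (simp add: power2_eq_square algebra_simps)
  qed
  then show "0 \<le> wt_factor k x" "wt_factor k x \<le> (1 + \<bar>q\<bar> ^ k)\<^sup>2" by (simp_all add: Q_def power_abs)
qed

text \<open>The offset \<open>m\<close> allows the factor \<open>k = 0\<close> to be split off,
  where it is played against the square root in the density.\<close>

lemma prod_wt_factor_bounded:
  obtains M where "0 < M" "\<And>x n. x \<in> S q \<Longrightarrow> (\<Prod>k<n. wt_factor (k + m) x) \<le> M"
proof -
  have "summable (\<lambda>k. \<bar>(1 + \<bar>q\<bar> ^ (k + m))\<^sup>2 - 1\<bar>)"
  proof (rule summable_comparison_test')
    show "summable (\<lambda>k. 3 * \<bar>q\<bar> ^ k)" by (intro summable_mult summable_abs_q_power)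
    fix k
    have Q: "0 \<le> \<bar>q\<bar> ^ (k + m)" "\<bar>q\<bar> ^ (k + m) \<le> \<bar>q\<bar> ^ k" "\<bar>q\<bar> ^ (k + m) \<le> 1"
      using abs_q_le by (auto intro: power_decreasing power_le_one)
    have "(1 + \<bar>q\<bar> ^ (k + m))\<^sup>2 - 1 = \<bar>q\<bar> ^ (k + m) * (2 + \<bar>q\<bar> ^ (k + m))"
      by (simp add: power2_eq_square algebra_simps)
    also have "\<bar>\<dots>\<bar> \<le> \<bar>q\<bar> ^ k * 3"
      unfolding abs_mult using Q by (intro mult_mono) auto
    finally show "norm \<bar>(1 + \<bar>q\<bar> ^ (k + m))\<^sup>2 - 1\<bar> \<le> 3 * \<bar>q\<bar> ^ k" by simp
  qed
  then have "convergent_prod (\<lambda>k. (1 + \<bar>q\<bar> ^ (k + m))\<^sup>2)" by (rule convergent_prod_one_plus)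
  moreover have "0 < (1 + \<bar>q\<bar> ^ (k + m))\<^sup>2" for k
    by (intro zero_less_power add_pos_nonneg) auto
  ultimately obtain c C where C: "0 < C" "\<And>n. (\<Prod>k<n. (1 + \<bar>q\<bar> ^ (k + m))\<^sup>2) \<le> C"
    by (rule convergent_prod_pos_bounds) blast
  have "(\<Prod>k<n. wt_factor (k + m) x) \<le> C" if "x \<in> S q" for x n
    by (rule order_trans[OF prod_mono C(2)]) (use wt_factor_bounds[OF that] in auto)
  with C(1) show ?thesis by (rule that)
qed

lemma q_normal_partial_tendsto:
  "(\<lambda>n. indicator (S q) x * (\<kappa> / (2 * pi * sqrt (4 - (1 - q) * x\<^sup>2)) * (\<Prod>k<n. wt_factor k x) * euler)) \<longlonglongrightarrow> q_normal x q"
  unfolding q_normal_eq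
  by (intro tendsto_mult tendsto_const convergent_prod_lessThan_LIMSEQ convergent_prod_wt_factor)

lemma S_sets [measurable]: "S q \<in> sets borel"
  by (simp add: S_eq)

lemma q_normal_measurable [measurable]: "(\<lambda>x. q_normal x q) \<in> borel_measurable borel"
  by (rule borel_measurable_LIMSEQ_real[OF q_normal_partial_tendsto]) (simp add: wt_factor_def)

lemma q_normal_bounded: "\<exists>B. \<forall>x. \<bar>q_normal x q\<bar> \<le> B"
proof -
  obtain M where M: "0 < M" "\<And>x n. x \<in> S q \<Longrightarrow> (\<Prod>k<n. wt_factor (k + 1) x) \<le> M"
    by (rule prod_wt_factor_bounded) blast
  define B where "B = \<kappa> / (2 * pi) * 2 * M * \<bar>euler\<bar>"
  have B: "0 \<le> B" using M by (simp add: B_def less_imp_le[OF kappa_pos])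
  have "\<bar>q_normal x q\<bar> \<le> B" for x
  proof (cases "x \<in> S q")
    case True
    define d where "d = 4 - (1 - q) * x\<^sup>2"
    \<comment> \<open>The factor \<open>k = 0\<close> is the number under the square root, so the
      singularity at the endpoints cancels to \<open>sqrt d\<close>; for \<open>d = 0\<close> the
      convention \<open>0 / 0 = 0\<close> agrees.\<close>
    have d: "d = wt_factor 0 x" by (simp add: d_def wt_factor_def)
    have d0: "0 \<le> d" "d \<le> 4" using wt_factor_bounds[OF True, of 0] by (auto simp: d)
    have "\<bar>indicator (S q) x * (\<kappa> / (2 * pi * sqrt d) * (\<Prod>k<Suc n. wt_factor k x) * euler)\<bar> \<le> B" for n
    proof -
      have p: "(\<Prod>k<Suc n. wt_factor k x) = d * (\<Prod>k<n. wt_factor (k + 1) x)"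
        unfolding prod.lessThan_Suc_shift d by simp
      have "d / sqrt d = sqrt d" using d0 by (simp add: real_div_sqrt)
      then have "\<kappa> / (2 * pi * sqrt d) * (d * (\<Prod>k<n. wt_factor (k + 1) x)) * euler =
          \<kappa> / (2 * pi) * sqrt d * (\<Prod>k<n. wt_factor (k + 1) x) * euler"
      proof -
        assume "d / sqrt d = sqrt d"
        have "\<kappa> / (2 * pi * sqrt d) * (d * (\<Prod>k<n. wt_factor (k + 1) x)) * euler =
            \<kappa> / (2 * pi) * (d / sqrt d) * (\<Prod>k<n. wt_factor (k + 1) x) * euler" by (simp add: mult_ac)
        then show ?thesis unfolding \<open>d / sqrt d = sqrt d\<close> .
      qed
      moreover have "\<bar>\<dots>\<bar> = \<kappa> / (2 * pi) * sqrt d * (\<Prod>k<n. wt_factor (k + 1) x) * \<bar>euler\<bar>"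
        using wt_factor_bounds(1)[OF True] d0 by (simp add: abs_mult prod_nonneg abs_of_nonneg less_imp_le[OF kappa_pos])
      moreover have "\<dots> \<le> B"
      proof -
        have "sqrt d \<le> 2" using d0 by (intro real_le_lsqrt) auto
        then show ?thesis unfolding B_def using M(2)[OF True, of n] d0 wt_factor_bounds(1)[OF True] M(1)
          by (intro mult_right_mono mult_mono) (auto intro!: prod_nonneg mult_nonneg_nonneg divide_nonneg_nonneg simp: less_imp_le[OF kappa_pos])
      qed
      ultimately show ?thesis using True unfolding p by simp
    qed
    moreover have "(\<lambda>n. \<bar>indicator (S q) x * (\<kappa> / (2 * pi * sqrt d) * (\<Prod>k<Suc n. wt_factor k x) * euler)\<bar>) \<longlonglongrightarrow> \<bar>q_normal x q\<bar>"
      unfolding d_def by (intro tendsto_rabs LIMSEQ_Suc q_normal_partial_tendsto)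
    ultimately show ?thesis by (intro LIMSEQ_le_const2) auto
  qed (simp add: q_normal_eq B)
  then show ?thesis by blast
qed

lemma set_integrable_q_normal:
  assumes "continuous_on (S q) h"
  shows "set_integrable lborel (S q) (\<lambda>x. q_normal x q * h x)"
proof -
  obtain B where B: "\<And>x. \<bar>q_normal x q\<bar> \<le> B" using q_normal_bounded by blast
  have h: "set_integrable lborel (S q) h"
    using assms unfolding S_eq by (rule borel_integrable_atLeastAtMost')
  have "set_integrable lborel (S q) (\<lambda>x. B * h x)" by (intro set_integrable_mult_right h)
  then show ?thesis
  proof (rule set_integrable_bound)
    have "(\<lambda>x. q_normal x q * (indicator (S q) x *\<^sub>R h x)) \<in> borel_measurable lborel"
      using h unfolding set_integrable_def by (intro borel_measurable_times) auto
    then show "set_borel_measurable lborel (S q) (\<lambda>x. q_normal x q * h x)"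
      unfolding set_borel_measurable_def by (simp add: mult_ac)
    show "AE x in lborel. x \<in> S q \<longrightarrow> norm (q_normal x q * h x) \<le> norm (B * h x)"
      using B by (intro AE_I2) (auto simp: abs_mult intro!: mult_right_mono order_trans[OF B])
  qed
qed

section \<open>Passage to the angle \<open>t\<close>\<close>

lemma wt_factor_param: "wt_factor k (2 * cos t / \<kappa>) = 1 + q ^ (2 * k) - 2 * q ^ k * cos (2 * t)"
proof -
  have "(1 - q) * (2 * cos t / \<kappa>)\<^sup>2 = 4 * (cos t)\<^sup>2"
    by (simp add: kappa_sq[symmetric] power_divide power_mult_distrib)
  then have "wt_factor k (2 * cos t / \<kappa>) = (1 + q ^ k)\<^sup>2 - 4 * (cos t)\<^sup>2 * q ^ k" by (simp add: wt_factor_def)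
  also have "\<dots> = 1 + q ^ (2 * k) - 2 * q ^ k * (2 * (cos t)\<^sup>2 - 1)"
      proof -
    have "q ^ (2 * k) = (q ^ k)\<^sup>2" by (rule power_even_eq)
    then show ?thesis by (simp only:) (simp add: power2_eq_square algebra_simps)
  qed
  finally show ?thesis by (simp only: cos_double_cos)
qed

lemma wt_trunc_eq: "wt_trunc N t = (\<Prod>k<N. wt_factor k (2 * cos t / \<kappa>))"
  by (simp only: wt_trunc_def wt_factor_param)

lemma param_in_S: "2 * cos t / \<kappa> \<in> S q"
proof -
  have "2 * \<bar>cos t\<bar> \<le> 2" by simp
  then show ?thesis by (simp add: S_iff abs_mult)
qed

text \<open>The derivative \<open>- 2 * sin t / \<kappa>\<close> of the substitution cancels the
  prefactor \<open>\<kappa> / sqrt (4 - (1 - q) * x^2)\<close> and leaves the infinite trigonometric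
  weight.\<close>

lemma integral_q_normal_eq:
  assumes "continuous_on (S q) h"
  shows "set_lebesgue_integral lborel (S q) (\<lambda>x. q_normal x q * h x) =
    euler / (2 * pi) * set_lebesgue_integral lborel {-pi..0} (\<lambda>t. prodinf (\<lambda>k. wt_factor k (2 * cos t / \<kappa>)) * h (2 * cos t / \<kappa>))"
proof -
  define x where "x = (\<lambda>t. 2 * cos t / \<kappa>)"
  define x' where "x' = (\<lambda>t. - 2 * sin t / \<kappa>)"
  have Sx: "S q = {x (- pi)..x 0}" by (simp add: S_eq x_def)
  have sin: "sin t \<le> 0" if "t \<in> {-pi..0}" for t
    using sin_ge_zero[of "- t"] that by simp
  have "(LBINT y. q_normal y q * h y * indicator {x (- pi)..x 0} y) =
      (LBINT t. q_normal (x t) q * h (x t) * x' t * indicator {-pi..0} t)"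
  proof (rule integral_substitution(2))
    show "set_integrable lborel {x (- pi)..x 0} (\<lambda>y. q_normal y q * h y)"
      using set_integrable_q_normal[OF assms] by (simp only: Sx)
    show "(x has_real_derivative x' t) (at t)" for t
      unfolding x_def x'_def by (auto intro!: derivative_eq_intros)
    show "continuous_on {-pi..0} x'" unfolding x'_def by (intro continuous_intros) auto
    show "0 \<le> x' t" if "t \<in> {-pi..0}" for t
      using sin[OF that] by (simp add: x'_def divide_nonpos_pos)
  qed simp
  also have "(\<lambda>t. q_normal (x t) q * h (x t) * x' t * indicator {-pi..0} t) =
      (\<lambda>t. indicator {-pi..0} t *\<^sub>R (euler / (2 * pi) * (prodinf (\<lambda>k. wt_factor k (x t)) * h (x t))))"
  proof
    fix t
    show "q_normal (x t) q * h (x t) * x' t * indicator {-pi..0} t =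
        indicator {-pi..0} t *\<^sub>R (euler / (2 * pi) * (prodinf (\<lambda>k. wt_factor k (x t)) * h (x t)))"
    proof (cases "t \<in> {-pi..0}")
      case True
      have "4 - (1 - q) * (x t)\<^sup>2 = 4 - 4 * (cos t)\<^sup>2"
        by (simp add: x_def kappa_sq[symmetric] power_divide power_mult_distrib)
      also have "\<dots> = (- 2 * sin t)\<^sup>2" by (simp add: power_mult_distrib sin_squared_eq)
      finally have s: "sqrt (4 - (1 - q) * (x t)\<^sup>2) = - 2 * sin t"
        using sin[OF True] by (simp only: real_sqrt_abs)
      have xS: "x t \<in> S q" by (simp add: x_def param_in_S)
      show ?thesis
      proof (cases "sin t = 0")
        case False
        have "q_normal (x t) q = \<kappa> / (2 * pi * (- 2 * sin t)) * prodinf (\<lambda>k. wt_factor k (x t)) * euler"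
          unfolding q_normal_eq s using xS by simp
        then have N: "q_normal (x t) q * x' t = euler / (2 * pi) * prodinf (\<lambda>k. wt_factor k (x t))"
          using False by (simp add: x'_def field_simps)
        have "q_normal (x t) q * h (x t) * x' t = (q_normal (x t) q * x' t) * h (x t)" by simp
        then show ?thesis using True unfolding N by simp
      next
        \<comment> \<open>At the ends of the interval the derivative makes the left side zero; the
          right side is zero because the factor \<open>k = 0\<close> of the infinite product
          vanishes.\<close>
        case s0: True
        have "cos (2 * t) = 1" using s0 by (simp add: cos_double_sin)
        then have "wt_factor 0 (x t) = 0" unfolding x_def wt_factor_param by simp
        then have "(\<Prod>k<Suc n. wt_factor k (x t)) = 0" for n by (intro prod_zero) auto
        then have "(\<lambda>n. \<Prod>k<Suc n. wt_factor k (x t)) \<longlonglongrightarrow> 0" by (simp only: tendsto_const)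
        then have "prodinf (\<lambda>k. wt_factor k (x t)) = 0"
          using LIMSEQ_unique[OF LIMSEQ_Suc[OF convergent_prod_lessThan_LIMSEQ[OF convergent_prod_wt_factor]]] by blast
        then show ?thesis using s0 by (simp add: x'_def)
      qed
    qed simp
  qed
  finally show ?thesis
    unfolding set_integral_mult_right[symmetric] unfolding set_lebesgue_integral_def
    by (simp add: Sx mult.commute x_def)
qed

text \<open>Dominated convergence applies since the truncated weights are uniformly bounded, and the
  limit of their moments is \<open>wt_moment_tendsto\<close>.\<close>

lemma integral_q_normal_Hermite:
  "set_lebesgue_integral lborel (S q) (\<lambda>x. q_normal x q * H n x) = (if n = 0 then 1 else 0)"
proof -
  let ?x = "\<lambda>t. 2 * cos t / \<kappa>"
  let ?P = "\<lambda>t. prodinf (\<lambda>k. wt_factor k (?x t))"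
  obtain M where M: "0 < M" "\<And>x n. x \<in> S q \<Longrightarrow> (\<Prod>k<n. wt_factor (k + 0) x) \<le> M"
    by (rule prod_wt_factor_bounded) blast
  have lim: "(\<lambda>N. wt_trunc N t) \<longlonglongrightarrow> ?P t" for t
    unfolding wt_trunc_eq by (rule convergent_prod_lessThan_LIMSEQ[OF convergent_prod_wt_factor])
  have wt_trunc: "\<bar>wt_trunc N t\<bar> \<le> M" for N t
    using M(2)[OF param_in_S[of t], of N] wt_factor_bounds(1)[OF param_in_S] by (simp add: wt_trunc_eq prod_nonneg)
  have "(\<lambda>N. wt_moment N n) \<longlonglongrightarrow> set_lebesgue_integral lborel {-pi..0} (\<lambda>t. ?P t * Hermite_trig n t)"
    unfolding wt_moment_def set_lebesgue_integral_def
  proof (rule integral_dominated_convergence[where w = "\<lambda>t. indicator {-pi..0} t *\<^sub>R (M * \<bar>Hermite_trig n t\<bar>)"])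
    have meas: "(\<lambda>t. indicator {-pi..0} t *\<^sub>R (wt_trunc N t * Hermite_trig n t)) \<in> borel_measurable lborel" for N
      using set_integrable_wt_trunc[of N n] unfolding set_integrable_def by (rule borel_measurable_integrable)
    show lim': "AE t in lborel. (\<lambda>N. indicator {-pi..0} t *\<^sub>R (wt_trunc N t * Hermite_trig n t)) \<longlonglongrightarrow> indicator {-pi..0} t *\<^sub>R (?P t * Hermite_trig n t)"
      by (intro AE_I2 tendsto_intros lim)
    show "(\<lambda>t. indicator {-pi..0} t *\<^sub>R (?P t * Hermite_trig n t)) \<in> borel_measurable lborel"
    proof (rule borel_measurable_LIMSEQ_real)
      show "(\<lambda>N. indicator {-pi..0} t *\<^sub>R (wt_trunc N t * Hermite_trig n t)) \<longlonglongrightarrow> indicator {-pi..0} t *\<^sub>R (?P t * Hermite_trig n t)" for t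
        by (intro tendsto_intros lim)
    qed (rule meas)
    show "(\<lambda>t. indicator {-pi..0} t *\<^sub>R (wt_trunc N t * Hermite_trig n t)) \<in> borel_measurable lborel" for N by (rule meas)
    have "set_integrable lborel {-pi..0} (\<lambda>t. M * \<bar>Hermite_trig n t\<bar>)"
      by (intro borel_integrable_atLeastAtMost' continuous_intros)
    then show "integrable lborel (\<lambda>t. indicator {-pi..0} t *\<^sub>R (M * \<bar>Hermite_trig n t\<bar>))"
      by (simp only: set_integrable_def)
    show "AE t in lborel. norm (indicator {-pi..0} t *\<^sub>R (wt_trunc N t * Hermite_trig n t)) \<le> indicator {-pi..0} t *\<^sub>R (M * \<bar>Hermite_trig n t\<bar>)" for N
      using wt_trunc by (intro AE_I2) (auto simp: indicator_def abs_mult intro!: mult_right_mono)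
  qed
  from LIMSEQ_unique[OF this wt_moment_tendsto]
  have eq: "set_lebesgue_integral lborel {-pi..0} (\<lambda>t. ?P t * Hermite_trig n t) = (if n = 0 then 2 * pi / euler else 0)" .
  have "\<kappa> ^ n * set_lebesgue_integral lborel (S q) (\<lambda>x. q_normal x q * H n x) =
      euler / (2 * pi) * (\<kappa> ^ n * set_lebesgue_integral lborel {-pi..0} (\<lambda>t. ?P t * H n (?x t)))"
    by (subst integral_q_normal_eq) (simp_all add: continuous_on_Hermite)
  also have "\<kappa> ^ n * set_lebesgue_integral lborel {-pi..0} (\<lambda>t. ?P t * H n (?x t)) =
      set_lebesgue_integral lborel {-pi..0} (\<lambda>t. ?P t * Hermite_trig n t)"
    unfolding set_integral_mult_right[symmetric] by (simp add: Hermite_trig_def mult_ac)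
  finally show ?thesis unfolding eq using euler_neq_0 by (auto split: if_splits)
qed

definition Hermite_inner :: "nat \<Rightarrow> nat \<Rightarrow> real" where
  "Hermite_inner n m = set_lebesgue_integral lborel (S q) (\<lambda>x. q_normal x q * (H n x * H m x))"

lemma set_integrable_Hermite_mult: "set_integrable lborel (S q) (\<lambda>x. q_normal x q * (H n x * H m x))"
  by (intro set_integrable_q_normal continuous_intros continuous_on_Hermite)

text \<open>Multiplication by \<open>x\<close> is symmetric for the inner product, so raising
  \<open>n\<close> is traded for changing \<open>m\<close>; the induction for orthogonality thus
  ends at the integral of a single polynomial.\<close>

lemma Hermite_inner_rec: "Hermite_inner (Suc n) m = Hermite_inner n (Suc m) + qi m * Hermite_inner n (m - 1) - qi n * Hermite_inner (n - 1) m"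
proof -
  have "H (Suc n) x * H m x = H n x * H (Suc m) x + qi m * (H n x * H (m - 1) x) - qi n * (H (n - 1) x * H m x)" for x
    unfolding Hermite_Suc by (simp add: algebra_simps)
  then have "q_normal x q * (H (Suc n) x * H m x) = q_normal x q * (H n x * H (Suc m) x)
      + qi m * (q_normal x q * (H n x * H (m - 1) x)) - qi n * (q_normal x q * (H (n - 1) x * H m x))" for x
    by (simp only: ring_distribs mult.left_commute)
  then have "(\<lambda>x. q_normal x q * (H (Suc n) x * H m x)) =
      (\<lambda>x. q_normal x q * (H n x * H (Suc m) x) + qi m * (q_normal x q * (H n x * H (m - 1) x))
        - qi n * (q_normal x q * (H (n - 1) x * H m x)))"
    by (rule ext)
  then show ?thesis
    unfolding Hermite_inner_def
    by (simp only: set_integral_diff(2) set_integral_add set_integral_mult_right set_integrable_mult_right set_integrable_Hermite_mult)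
qed

lemma Hermite_inner_eq: "Hermite_inner n m = (if n = m then qf n else 0)"
proof (induction n arbitrary: m rule: less_induct)
  case (less n)
  show ?case
  proof (cases n)
    case 0
    then show ?thesis using integral_q_normal_Hermite[of m] by (simp add: Hermite_inner_def)
  next
    case (Suc k)
    have 1: "Hermite_inner k (Suc m) = (if k = Suc m then qf k else 0)" and 2: "Hermite_inner k (m - 1) = (if k = m - 1 then qf k else 0)"
      and 3: "Hermite_inner (k - 1) m = (if k - 1 = m then qf (k - 1) else 0)"
      using less[of k] less[of "k - 1"] Suc by auto
    show ?thesis unfolding Suc Hermite_inner_rec 1 2 3
      by (cases k; cases m) (auto simp: q_fact_Suc)
  qed
qed

lemma q_normal_phi_series:
  assumes "y \<in> S q" "z \<in> S q" "\<bar>\<rho>1\<bar> < 1" "\<bar>\<rho>2\<bar> < 1"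
  shows "set_integrable lborel (S q) (\<lambda>x. H m x * phi x y z \<rho>1 \<rho>2 q)"
    and "g m y z \<rho>1 \<rho>2 q = poly2 (G m \<rho>1 \<rho>2) y z"
proof -
  define a where "a n = poly2 (G n \<rho>1 \<rho>2) y z" for n
  obtain D \<tau> where \<tau>: "0 \<le> \<tau>" "\<tau> < 1" "\<And>n. \<bar>a n\<bar> \<le> D * \<tau> ^ n * sqrt (qf n)"
    using G_growth[OF assms] unfolding a_def by blast
  \<comment> \<open>Growth of \<open>H n\<close> at rate \<open>s\<close> is beaten by decay of the
    coefficients at rate \<open>\<tau>\<close>; the two factors \<open>sqrt (qf n)\<close> cancel
    \<open>qf n\<close>.\<close>
  obtain s where s: "1 < s" "s ^ 1 * \<tau> < 1" using exists_power_mult_less_1[OF \<tau>(2)] by blast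
  obtain C where C: "0 < C" "\<And>x n. x \<in> S q \<Longrightarrow> \<bar>H n x\<bar> \<le> C * s ^ n * sqrt (qf n)"
    using Hermite_growth_uniform[OF s(1)] by blast
  obtain B where B: "\<And>x. \<bar>q_normal x q\<bar> \<le> B" using q_normal_bounded by blast
  have "0 \<le> B" using B[of 0] by simp
  define f where "f n x = indicator (S q) x *\<^sub>R (q_normal x q * (H m x * H n x) * (a n / qf n))" for n x
  define E where "E = B * (C * s ^ m * sqrt (qf m)) * C * D"
  have f_bound: "norm (f n x) \<le> indicator (S q) x * (E * (s * \<tau>) ^ n)" for n x
  proof (cases "x \<in> S q")
    case True
    have "norm (f n x) = \<bar>q_normal x q\<bar> * \<bar>H m x\<bar> * \<bar>H n x\<bar> * \<bar>a n\<bar> / qf n"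
      using True by (simp add: f_def abs_mult)
    also have "\<dots> \<le> B * (C * s ^ m * sqrt (qf m)) * (C * s ^ n * sqrt (qf n)) * (D * \<tau> ^ n * sqrt (qf n)) / qf n"
      using B C(1) C(2)[OF True] \<tau>(3) \<open>0 \<le> B\<close> s
      by (intro divide_right_mono mult_mono) auto
    also have "\<dots> = E * (s * \<tau>) ^ n * (sqrt (qf n) * sqrt (qf n) / qf n)"
      by (simp only: E_def power_mult_distrib) (simp add: mult_ac)
    finally show ?thesis using True by simp
  qed (simp add: f_def)
  have f_int: "integrable lborel (f n)" for n
    using set_integrable_mult_left[OF set_integrable_Hermite_mult[of m n], of "a n / qf n"]
    unfolding set_integrable_def f_def[abs_def] by blast
  have geo: "summable (\<lambda>n. E * (s * \<tau>) ^ n)"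
    using s \<tau> by (intro summable_mult summable_geometric) simp
  have summ: "summable (\<lambda>n. norm (f n x))" for x
  proof (rule summable_comparison_test'[OF geo])
    \<comment> \<open>\<open>G_growth\<close> does not state the sign of \<open>D\<close>, so
      nonnegativity is read off from the bound at a point of \<open>S q\<close>.\<close>
    have nn: "0 \<le> E * (s * \<tau>) ^ n" for n
    proof -
      have "2 / \<kappa> \<in> S q" by (simp add: S_iff)
      then show ?thesis using order_trans[OF norm_ge_zero f_bound[of n "2 / \<kappa>"]] by simp
    qed
    show "norm (norm (f n x)) \<le> E * (s * \<tau>) ^ n" for n
      using f_bound[of n x] nn[of n] by (cases "x \<in> S q") (auto simp: f_def)
  qed
  have Si: "integrable lborel (\<lambda>x. indicator (S q) x * (c::real))" for c
    using borel_integrable_atLeastAtMost'[of "- 2 / \<kappa>" "2 / \<kappa>" "\<lambda>_. c"]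
    unfolding set_integrable_def S_eq by simp
  have summ_int: "summable (\<lambda>n. LINT x|lborel. norm (f n x))"
  proof (rule summable_comparison_test'[OF summable_mult2[OF geo]])
    fix n
    have "(LINT x|lborel. norm (f n x)) \<le> (LINT x|lborel. indicator (S q) x * (E * (s * \<tau>) ^ n))"
      using f_bound Si by (intro integral_mono integrable_norm f_int) auto
    also have "\<dots> = E * (s * \<tau>) ^ n * (LINT x|lborel. indicator (S q) x)"
      by (simp add: mult.commute)
    finally show "norm (LINT x|lborel. norm (f n x)) \<le> E * (s * \<tau>) ^ n * (LINT x|lborel. indicator (S q) x)"
      by (simp add: integral_nonneg_AE)
  qed
  have phi: "(\<Sum>n. f n x) = indicator (S q) x *\<^sub>R (H m x * phi x y z \<rho>1 \<rho>2 q)" for x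
  proof (cases "x \<in> S q")
    case True
    have "(\<lambda>n. q_normal x q * H m x * (H n x / qf n * a n)) sums
        (q_normal x q * H m x * (A 0 0 x y \<rho>1 * A 0 0 x z \<rho>2 / A 0 0 y z (\<rho>1 * \<rho>2)))"
      unfolding a_def by (intro sums_mult phi_series True assms)
    also have "(\<lambda>n. q_normal x q * H m x * (H n x / qf n * a n)) = (\<lambda>n. f n x)"
      using True by (simp add: f_def mult_ac)
    finally show ?thesis using True
      by (simp add: phi_eq_lt[OF True assms] sums_iff mult_ac)
  qed (simp add: f_def)
  have f_integral: "integral\<^sup>L lborel (f n) = (if n = m then a m else 0)" for n
  proof -
    have "integral\<^sup>L lborel (f n) = Hermite_inner m n * (a n / qf n)"
      unfolding Hermite_inner_def f_def[abs_def] set_integral_mult_left[symmetric] by (simp only: set_lebesgue_integral_def)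
    then show ?thesis by (auto simp: Hermite_inner_eq)
  qed
  have "integrable lborel (\<lambda>x. \<Sum>n. f n x)"
    by (rule integrable_suminf[OF f_int _ summ_int]) (use summ in simp)
  then show "set_integrable lborel (S q) (\<lambda>x. H m x * phi x y z \<rho>1 \<rho>2 q)"
    by (simp only: phi set_integrable_def)
  have "g m y z \<rho>1 \<rho>2 q = (LINT x|lborel. (\<Sum>n. f n x))"
    by (simp only: phi g_def set_lebesgue_integral_def)
  also have "\<dots> = (\<Sum>n. integral\<^sup>L lborel (f n))"
    by (rule integral_suminf[OF f_int _ summ_int]) (use summ in simp)
  also have "\<dots> = (\<Sum>n. if n = m then a m else 0)" by (simp only: f_integral)
  also have "\<dots> = a m"
    using suminf_finite[of "{m}" "\<lambda>n. if n = m then a m else 0"] by simp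
  finally show "g m y z \<rho>1 \<rho>2 q = poly2 (G m \<rho>1 \<rho>2) y z" by (simp add: a_def)
qed

end

section \<open>The Gaussian case and the theorem\<close>

text \<open>Stein's identity for powers: odd central moments vanish, and neighbouring even ones have
  ratio \<open>\<sigma>^2 * k\<close>.\<close>

lemma normal_moment_rec:
  assumes "0 < \<sigma>"
  shows "(LBINT x. normal_density m \<sigma> x * (x - m) ^ Suc k) =
    \<sigma>\<^sup>2 * (real k * (LBINT x. normal_density m \<sigma> x * (x - m) ^ (k - 1)))"
proof (cases "even k")
  case True
  then obtain j where k: "k = 2 * j" by (elim evenE)
  have "k = 0 \<or> k - 1 = 2 * (j - 1) + 1" using k by (cases j) auto
  then have "real k * (LBINT x. normal_density m \<sigma> x * (x - m) ^ (k - 1)) = 0"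
    using integral_normal_moment_odd[OF assms, of m "j - 1"] by auto
  then show ?thesis using integral_normal_moment_odd[OF assms, of m j] by (simp add: k)
next
  case False
  then obtain j where k: "k = 2 * j + 1" by (elim oddE)
  define a where "a = (2 / \<sigma>\<^sup>2) ^ j"
  have a: "a \<noteq> 0" using assms by (simp add: a_def)
  have f: "fact (2 * Suc j) = (2 * real j + 2) * ((2 * real j + 1) * fact (2 * j))"
    by (simp add: algebra_simps)
  have ks: "Suc k = 2 * Suc j" "k - 1 = 2 * j" by (simp_all add: k)
  have "((2 * real j + 2) * ((2 * real j + 1) * F)) / (2 / \<sigma>\<^sup>2 * a * ((real j + 1) * b)) =
      \<sigma>\<^sup>2 * ((2 * real j + 1) * (F / (a * b)))" if "b \<noteq> 0" for F b :: real
  proof -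
    have "real j + 1 \<noteq> 0" by linarith
    then show ?thesis using a assms that by (simp add: divide_simps)
  qed
  from this[of "fact j" "fact (2 * j)"] show ?thesis
    unfolding ks integral_normal_moment_even[OF assms] f power_Suc a_def[symmetric] fact_Suc[of j]
    by (simp add: k add.commute)
qed

section \<open>Mixed moments of the normal law and the recurrence at \<open>q = 1\<close>\<close>

context q_param
begin

lemma normal_Hermite_integrable:
  assumes "0 < \<sigma>"
  shows "integrable lborel (\<lambda>x. normal_density m \<sigma> x * ((x - m) ^ k * H n x))"
proof (induction n arbitrary: k rule: less_induct)
  case (less n)
  show ?case
  proof (cases n)
    case 0
    then show ?thesis using integrable_normal_moment[OF assms] by simp
  next
    case (Suc j)
    have "integrable lborel (\<lambda>x. normal_density m \<sigma> x * ((x - m) ^ Suc k * H j x)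
        + m * (normal_density m \<sigma> x * ((x - m) ^ k * H j x))
        - qi j * (normal_density m \<sigma> x * ((x - m) ^ k * H (j - 1) x)))"
      using less[of j] less[of "j - 1"] Suc
      by (intro Bochner_Integration.integrable_diff Bochner_Integration.integrable_add integrable_mult_right)
        (auto simp del: power_Suc)
    also have "(\<lambda>x. normal_density m \<sigma> x * ((x - m) ^ Suc k * H j x)
        + m * (normal_density m \<sigma> x * ((x - m) ^ k * H j x))
        - qi j * (normal_density m \<sigma> x * ((x - m) ^ k * H (j - 1) x))) =
        (\<lambda>x. normal_density m \<sigma> x * ((x - m) ^ k * H n x))"
      unfolding Suc Hermite_Suc by (rule ext) (simp add: algebra_simps)
    finally show ?thesis .
  qed
qed

text \<open>Powers of \<open>x - m\<close> are carried along because the Hermite recurrence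
  multiplies by \<open>x = (x - m) + m\<close>.\<close>

definition \<mu> :: "real \<Rightarrow> real \<Rightarrow> nat \<Rightarrow> nat \<Rightarrow> real" where
  "\<mu> m \<sigma> k n = (LBINT x. normal_density m \<sigma> x * ((x - m) ^ k * H n x))"

lemma mu_rec:
  assumes "0 < \<sigma>"
  shows "\<mu> m \<sigma> k (Suc n) = \<mu> m \<sigma> (Suc k) n + m * \<mu> m \<sigma> k n - qi n * \<mu> m \<sigma> k (n - 1)"
proof -
  have eq: "(\<lambda>x. normal_density m \<sigma> x * ((x - m) ^ k * H (Suc n) x)) =
      (\<lambda>x. normal_density m \<sigma> x * ((x - m) ^ Suc k * H n x)
        + m * (normal_density m \<sigma> x * ((x - m) ^ k * H n x))
        - qi n * (normal_density m \<sigma> x * ((x - m) ^ k * H (n - 1) x)))"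
    unfolding Hermite_Suc by (rule ext) (simp add: algebra_simps)
  show ?thesis unfolding \<mu>_def eq
    using normal_Hermite_integrable[OF assms] by (simp del: power_Suc)
qed

text \<open>Gaussian integration by parts, with \<open>n * H (n - 1)\<close> as the derivative of
  \<open>H n\<close> at \<open>q = 1\<close>. The induction derives it from the power moments;
  \<open>k\<close> stays general because \<open>mu_rec\<close> raises it.\<close>

lemma mu_Stein:
  assumes "0 < \<sigma>" and q: "q = 1"
  shows "\<mu> m \<sigma> (Suc k) n = \<sigma>\<^sup>2 * (real k * \<mu> m \<sigma> (k - 1) n + real n * \<mu> m \<sigma> k (n - 1))"
proof (induction n arbitrary: k rule: less_induct)
  case (less n)
  have qi: "qi n = real n" for n by (simp add: q_int_def q)
  show ?case
  proof (cases n)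
    case 0
    then show ?thesis using normal_moment_rec[OF assms(1), of m k] by (simp add: \<mu>_def)
  next
    case (Suc j)
    have IH: "\<mu> m \<sigma> (Suc k) j = \<sigma>\<^sup>2 * (real k * \<mu> m \<sigma> (k - 1) j + real j * \<mu> m \<sigma> k (j - 1))" for k
      using less[of j] Suc by simp
    have IH': "real j * \<mu> m \<sigma> (Suc k) (j - 1) =
        real j * (\<sigma>\<^sup>2 * (real k * \<mu> m \<sigma> (k - 1) (j - 1) + real (j - 1) * \<mu> m \<sigma> k (j - 1 - 1)))"
      using less[of "j - 1"] Suc by simp
    note rec = mu_rec[OF assms(1), where m = m, unfolded qi]
    have e1: "\<mu> m \<sigma> (Suc k) n = \<mu> m \<sigma> (Suc (Suc k)) j + m * \<mu> m \<sigma> (Suc k) j - real j * \<mu> m \<sigma> (Suc k) (j - 1)"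
      unfolding Suc by (rule rec)
    have e2: "real k * \<mu> m \<sigma> (k - 1) n =
        real k * (\<mu> m \<sigma> k j + m * \<mu> m \<sigma> (k - 1) j - real j * \<mu> m \<sigma> (k - 1) (j - 1))"
      unfolding Suc rec by (cases k) simp_all
    have e3: "real j * \<mu> m \<sigma> k j =
        real j * (\<mu> m \<sigma> (Suc k) (j - 1) + m * \<mu> m \<sigma> k (j - 1) - real (j - 1) * \<mu> m \<sigma> k (j - 1 - 1))"
      using rec[of k "j - 1"] by (cases j) simp_all
    have e4: "\<mu> m \<sigma> (Suc (Suc k)) j = \<sigma>\<^sup>2 * ((real k + 1) * \<mu> m \<sigma> k j + real j * \<mu> m \<sigma> (Suc k) (j - 1))"
      using IH[of "Suc k"] by (simp add: algebra_simps)
    have "\<mu> m \<sigma> (Suc k) n = \<sigma>\<^sup>2 * (real k * (\<mu> m \<sigma> k j + m * \<mu> m \<sigma> (k - 1) j - real j * \<mu> m \<sigma> (k - 1) (j - 1))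
        + (\<mu> m \<sigma> k j + real j * (\<mu> m \<sigma> (Suc k) (j - 1) + m * \<mu> m \<sigma> k (j - 1) - real (j - 1) * \<mu> m \<sigma> k (j - 1 - 1))))"
      unfolding e1 e4 IH[of k] using IH' by algebra
    also have "\<dots> = \<sigma>\<^sup>2 * (real k * \<mu> m \<sigma> (k - 1) n + (\<mu> m \<sigma> k j + real j * \<mu> m \<sigma> k j))"
      unfolding e2[symmetric] e3[symmetric] ..
    also have "\<dots> = \<sigma>\<^sup>2 * (real k * \<mu> m \<sigma> (k - 1) n + real n * \<mu> m \<sigma> k (n - 1))"
      by (simp add: Suc algebra_simps)
    finally show ?thesis .
  qed
qed

lemma mu_0_rec:
  assumes "0 < \<sigma>" and q: "q = 1"
  shows "\<mu> m \<sigma> 0 (Suc n) = m * \<mu> m \<sigma> 0 n - (1 - \<sigma>\<^sup>2) * (real n * \<mu> m \<sigma> 0 (n - 1))"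
proof -
  have qi: "qi n = real n" by (simp add: q_int_def q)
  show ?thesis using mu_rec[OF assms(1), where m = m and k = 0 and n = n] mu_Stein[OF assms, where m = m and k = 0 and n = n]
    by (simp add: qi algebra_simps)
qed

lemma poly2_G_0: "poly2 (G 0 \<rho>1 \<rho>2) y z = 1"
  by (simp add: poly2_G)

text \<open>With \<open>r = \<rho>1 * \<rho>2\<close> the numerator of the mean is
  \<open>(\<rho>1 - r * \<rho>2) * y + (\<rho>2 - r * \<rho>1) * z\<close>. This combination of the
  two recurrences of \<open>Theta\<close> yields the recurrence of the Gaussian moments, cleared of
  its denominator.\<close>

lemma poly2_G_rec:
  fixes y z \<rho>1 \<rho>2 :: real
  assumes q: "q = 1" and \<rho>: "\<bar>\<rho>1\<bar> < 1" "\<bar>\<rho>2\<bar> < 1"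
  defines "p \<equiv> \<lambda>n. poly2 (G n \<rho>1 \<rho>2) y z"
  shows "(1 - \<rho>1\<^sup>2 * \<rho>2\<^sup>2) * p (Suc n) = (y * \<rho>1 * (1 - \<rho>2\<^sup>2) + z * \<rho>2 * (1 - \<rho>1\<^sup>2)) * p n
    - (\<rho>1\<^sup>2 + \<rho>2\<^sup>2 - 2 * \<rho>1\<^sup>2 * \<rho>2\<^sup>2) * (real n * p (n - 1))"
proof -
  define r where "r = \<rho>1 * \<rho>2"
  have r: "\<bar>r\<bar> < 1" unfolding r_def by (rule abs_mult_less_1[OF \<rho>])
  have S: "y \<in> S q" "z \<in> S q" by (simp_all add: S_def q)
  have qi: "qi n = real n" for n by (simp add: q_int_def q)
  define \<theta> where "\<theta> a b = poly2 (Theta q r a b) y z" for a b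
  define t where "t n i = \<rho>1 ^ i * \<rho>2 ^ (n - i) * \<theta> i (n - i)" for n i
  have p: "p n = (\<Sum>i\<le>n. qb n i * t n i)" for n
    by (simp add: p_def poly2_G t_def \<theta>_def r_def atLeast0AtMost mult.assoc)
  \<comment> \<open>The neighbours \<open>(a + 1, b)\<close> and \<open>(a, b + 1)\<close> receive
    the coefficients \<open>\<rho>1 * (1 - r^2)\<close> and \<open>\<rho>2 * (1 - r^2)\<close>, in
    the proportion that the Pascal rule requires for index \<open>n + 1\<close>.\<close>
  have step: "(1 - r\<^sup>2) * (\<rho>1 * \<theta> (Suc a) b + \<rho>2 * \<theta> a (Suc b)) =
      (y * \<rho>1 * (1 - \<rho>2\<^sup>2) + z * \<rho>2 * (1 - \<rho>1\<^sup>2)) * \<theta> a b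
      - (\<rho>1 - r * \<rho>2) * (real a * \<theta> (a - 1) b) - (\<rho>2 - r * \<rho>1) * (real b * \<theta> a (b - 1))" for a b
  proof -
    have 1: "y * \<theta> a b = \<theta> (Suc a) b + real a * \<theta> (a - 1) b + r * \<theta> a (Suc b)"
      using Theta_rec(1)[OF S r, where a = a and b = b] by (simp add: \<theta>_def q qi[unfolded q] del: Theta.simps)
    have 2: "z * \<theta> a b = \<theta> a (Suc b) + real b * \<theta> a (b - 1) + r * \<theta> (Suc a) b"
      using Theta_rec(2)[OF S r, where a = a and b = b] by (simp add: \<theta>_def q qi[unfolded q] del: Theta.simps)
    have "(y * \<rho>1 * (1 - \<rho>2\<^sup>2) + z * \<rho>2 * (1 - \<rho>1\<^sup>2)) * \<theta> a b =
        (\<rho>1 - r * \<rho>2) * (y * \<theta> a b) + (\<rho>2 - r * \<rho>1) * (z * \<theta> a b)"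
      by (simp add: r_def power2_eq_square algebra_simps)
    then show ?thesis unfolding 1 2 by (simp add: r_def power2_eq_square algebra_simps)
  qed
  have "p (Suc n) = (\<Sum>i\<le>n. qb n i * t (Suc n) (Suc i)) + (\<Sum>i\<le>n. qb n i * t (Suc n) i)"
    unfolding p sum_q_binomial_Suc by (simp add: q)
  also have "\<dots> = (\<Sum>i\<le>n. qb n i * (\<rho>1 ^ i * \<rho>2 ^ (n - i) * (\<rho>1 * \<theta> (Suc i) (n - i) + \<rho>2 * \<theta> i (Suc (n - i)))))"
    unfolding sum.distrib[symmetric] by (intro sum.cong) (simp_all add: t_def Suc_diff_le algebra_simps)
  finally have "(1 - r\<^sup>2) * p (Suc n) = (\<Sum>i\<le>n. qb n i * (\<rho>1 ^ i * \<rho>2 ^ (n - i) *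
      ((1 - r\<^sup>2) * (\<rho>1 * \<theta> (Suc i) (n - i) + \<rho>2 * \<theta> i (Suc (n - i))))))"
    by (simp only: sum_distrib_left mult_ac)
  also have "\<dots> = (y * \<rho>1 * (1 - \<rho>2\<^sup>2) + z * \<rho>2 * (1 - \<rho>1\<^sup>2)) * p n
      - (\<rho>1 - r * \<rho>2) * (\<Sum>i\<le>n. qb n i * (real i * (\<rho>1 ^ i * \<rho>2 ^ (n - i) * \<theta> (i - 1) (n - i))))
      - (\<rho>2 - r * \<rho>1) * (\<Sum>i\<le>n. qb n i * (real (n - i) * (\<rho>1 ^ i * \<rho>2 ^ (n - i) * \<theta> i (n - i - 1))))"
    unfolding step p sum_distrib_left sum_subtractf[symmetric]
    by (intro sum.cong refl) (simp only: t_def right_diff_distrib mult_ac)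
  also have "(\<Sum>i\<le>n. qb n i * (real i * (\<rho>1 ^ i * \<rho>2 ^ (n - i) * \<theta> (i - 1) (n - i)))) = \<rho>1 * (real n * p (n - 1))"
  proof -
    have "(\<Sum>i\<le>n. qb n i * (real i * (\<rho>1 ^ i * \<rho>2 ^ (n - i) * \<theta> (i - 1) (n - i)))) =
        (\<Sum>i\<le>n. qb n i * (qi i * (\<rho>1 * t (n - 1) (i - 1))))"
    proof (intro sum.cong refl)
      fix i
      show "qb n i * (real i * (\<rho>1 ^ i * \<rho>2 ^ (n - i) * \<theta> (i - 1) (n - i))) = qb n i * (qi i * (\<rho>1 * t (n - 1) (i - 1)))"
        by (cases i) (simp_all add: qi t_def)
    qed
    also have "\<dots> = qi n * (\<Sum>i\<le>n - 1. qb (n - 1) i * (\<rho>1 * t (n - 1) i))"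
      by (rule sum_q_binomial_absorb)
    finally show ?thesis by (simp add: p qi sum_distrib_left mult_ac)
  qed
  also have "(\<Sum>i\<le>n. qb n i * (real (n - i) * (\<rho>1 ^ i * \<rho>2 ^ (n - i) * \<theta> i (n - i - 1)))) = \<rho>2 * (real n * p (n - 1))"
  proof -
    have "(\<Sum>i\<le>n. qb n i * (real (n - i) * (\<rho>1 ^ i * \<rho>2 ^ (n - i) * \<theta> i (n - i - 1)))) =
        (\<Sum>i\<le>n. qb n i * (real i * (\<rho>1 ^ (n - i) * \<rho>2 ^ i * \<theta> (n - i) (i - 1))))"
      by (rule sum.reindex_bij_witness[of _ "\<lambda>i. n - i" "\<lambda>i. n - i"]) (auto simp: q_binomial_symmetric)
    also have "\<dots> = (\<Sum>i\<le>n. qb n i * (qi i * (\<rho>2 * t (n - 1) (n - 1 - (i - 1)))))"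
    proof (intro sum.cong refl)
      fix i assume "i \<in> {..n}"
      then show "qb n i * (real i * (\<rho>1 ^ (n - i) * \<rho>2 ^ i * \<theta> (n - i) (i - 1))) =
          qb n i * (qi i * (\<rho>2 * t (n - 1) (n - 1 - (i - 1))))"
        by (cases i) (simp_all add: qi t_def)
    qed
    also have "\<dots> = qi n * (\<Sum>i\<le>n - 1. qb (n - 1) i * (\<rho>2 * t (n - 1) (n - 1 - i)))"
      by (rule sum_q_binomial_absorb)
    also have "(\<Sum>i\<le>n - 1. qb (n - 1) i * (\<rho>2 * t (n - 1) (n - 1 - i))) =
        (\<Sum>i\<le>n - 1. qb (n - 1) i * (\<rho>2 * t (n - 1) i))"
    proof (rule sum.reindex_bij_witness[of _ "\<lambda>i. n - 1 - i" "\<lambda>i. n - 1 - i"])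
      fix i assume "i \<in> {..n - 1}"
      then show "qb (n - 1) (n - 1 - i) * (\<rho>2 * t (n - 1) (n - 1 - i)) = qb (n - 1) i * (\<rho>2 * t (n - 1) (n - 1 - i))"
        by (simp only: q_binomial_symmetric atMost_iff)
    qed auto
    finally show ?thesis by (simp add: p qi sum_distrib_left mult_ac)
  qed
  finally show ?thesis by (simp add: r_def power2_eq_square algebra_simps)
qed

lemma normal_params:
  fixes \<rho>1 \<rho>2 :: real
  assumes "\<bar>\<rho>1\<bar> < 1" "\<bar>\<rho>2\<bar> < 1"
  shows "0 < 1 - \<rho>1\<^sup>2 * \<rho>2\<^sup>2" "0 < (1 - \<rho>1\<^sup>2) * (1 - \<rho>2\<^sup>2) / (1 - \<rho>1\<^sup>2 * \<rho>2\<^sup>2)"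
proof -
  have sq: "\<rho>1\<^sup>2 < 1" "\<rho>2\<^sup>2 < 1" using assms by (simp_all add: abs_square_less_1)
  show 1: "0 < 1 - \<rho>1\<^sup>2 * \<rho>2\<^sup>2"
    using abs_mult_less_1[OF assms] by (simp add: power_mult_distrib[symmetric] abs_square_less_1)
  show "0 < (1 - \<rho>1\<^sup>2) * (1 - \<rho>2\<^sup>2) / (1 - \<rho>1\<^sup>2 * \<rho>2\<^sup>2)" using 1 sq by simp
qed

lemma phi_one:
  assumes q: "q = 1" and \<rho>: "\<bar>\<rho>1\<bar> < 1" "\<bar>\<rho>2\<bar> < 1"
  shows "set_integrable lborel (S q) (\<lambda>x. H n x * phi x y z \<rho>1 \<rho>2 q)"
    and "g n y z \<rho>1 \<rho>2 q = poly2 (G n \<rho>1 \<rho>2) y z"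
    and "\<rho>1 \<noteq> 0 \<Longrightarrow> \<exists>P. (\<lambda>n. H n x / qf n * poly2 (G n \<rho>1 \<rho>2) y z) sums P \<and> phi x y z \<rho>1 \<rho>2 q = q_normal x q * P"
proof -
  define d where "d = 1 - \<rho>1\<^sup>2 * \<rho>2\<^sup>2"
  define m where "m = (y * \<rho>1 * (1 - \<rho>2\<^sup>2) + z * \<rho>2 * (1 - \<rho>1\<^sup>2)) / d"
  define \<sigma> where "\<sigma> = sqrt ((1 - \<rho>1\<^sup>2) * (1 - \<rho>2\<^sup>2) / d)"
  have d: "0 < d" unfolding d_def by (rule normal_params[OF \<rho>])
  have \<sigma>: "0 < \<sigma>" using normal_params(2)[OF \<rho>] by (simp only: \<sigma>_def d_def real_sqrt_gt_zero)
  have \<sigma>2: "\<sigma>\<^sup>2 = (1 - \<rho>1\<^sup>2) * (1 - \<rho>2\<^sup>2) / d"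
    using normal_params(2)[OF \<rho>] by (simp add: \<sigma>_def d_def less_imp_le)
  have phi: "phi x y z \<rho>1 \<rho>2 q = normal_density m \<sigma> x" for x
    by (simp add: phi_def q m_def \<sigma>_def d_def)
  have S: "S q = UNIV" by (simp add: S_def q)
  have eq: "H n x * phi x y z \<rho>1 \<rho>2 q = normal_density m \<sigma> x * ((x - m) ^ 0 * H n x)" for n x
    by (simp add: phi)
  show "set_integrable lborel (S q) (\<lambda>x. H n x * phi x y z \<rho>1 \<rho>2 q)"
    unfolding eq S set_integrable_def using normal_Hermite_integrable[OF \<sigma>, of m 0 n] by simp
  have g: "g n y z \<rho>1 \<rho>2 q = \<mu> m \<sigma> 0 n" for n
    unfolding g_def eq S set_lebesgue_integral_def \<mu>_def by simp
  \<comment> \<open>The squared parameter of the Mehler kernel below, unrelated to the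
    \<open>sqrt (1 - q)\<close> of the case \<open>|q| < 1\<close>.\<close>
  define \<kappa> where "\<kappa> = 1 - \<sigma>\<^sup>2"
  have \<kappa>: "d * \<kappa> = \<rho>1\<^sup>2 + \<rho>2\<^sup>2 - 2 * \<rho>1\<^sup>2 * \<rho>2\<^sup>2"
  proof -
    have "d * \<sigma>\<^sup>2 = (1 - \<rho>1\<^sup>2) * (1 - \<rho>2\<^sup>2)" using d by (simp add: \<sigma>2)
    then have "d * \<kappa> = d - (1 - \<rho>1\<^sup>2) * (1 - \<rho>2\<^sup>2)"
      by (simp only: \<kappa>_def right_diff_distrib mult_1_right)
    then show ?thesis by (simp only: d_def) (simp add: algebra_simps)
  qed
  have dm: "y * \<rho>1 * (1 - \<rho>2\<^sup>2) + z * \<rho>2 * (1 - \<rho>1\<^sup>2) = d * m" using d by (simp add: m_def)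
  have rec: "poly2 (G (Suc n) \<rho>1 \<rho>2) y z = m * poly2 (G n \<rho>1 \<rho>2) y z - \<kappa> * (real n * poly2 (G (n - 1) \<rho>1 \<rho>2) y z)" for n
  proof -
    have "d * poly2 (G (Suc n) \<rho>1 \<rho>2) y z =
        d * (m * poly2 (G n \<rho>1 \<rho>2) y z - \<kappa> * (real n * poly2 (G (n - 1) \<rho>1 \<rho>2) y z))"
      using poly2_G_rec[OF q \<rho>, of n y z, folded d_def \<kappa>, unfolded dm] by (simp only: right_diff_distrib mult.assoc)
    then show ?thesis using d by simp
  qed
  \<comment> \<open>Applied to the moments it identifies \<open>g n\<close>; applied to
    \<open>t ^ n * H n (m / t)\<close> it identifies the coefficients of the Mehler series.\<close>
  have unique: "a n = poly2 (G n \<rho>1 \<rho>2) y z"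
    if "a 0 = 1" "\<And>n. a (Suc n) = m * a n - \<kappa> * (real n * a (n - 1))" for a n
  proof (induction n rule: less_induct)
    case (less n)
    show ?case
    proof (cases n)
      case (Suc k)
      then show ?thesis using less[of k] less[of "k - 1"] by (simp add: that(2) rec)
    qed (simp add: that(1) poly2_G_0)
  qed
  have "\<mu> m \<sigma> 0 0 = 1" using integral_normal_density[OF \<sigma>] by (simp add: \<mu>_def)
  then have "\<mu> m \<sigma> 0 n = poly2 (G n \<rho>1 \<rho>2) y z"
    by (rule unique) (simp add: mu_0_rec[OF \<sigma> q] \<kappa>_def)
  then show "g n y z \<rho>1 \<rho>2 q = poly2 (G n \<rho>1 \<rho>2) y z" by (simp add: g)
  show "\<exists>P. (\<lambda>n. H n x / qf n * poly2 (G n \<rho>1 \<rho>2) y z) sums P \<and> phi x y z \<rho>1 \<rho>2 q = q_normal x q * P"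
    if "\<rho>1 \<noteq> 0"
  proof -
    have "0 < d * \<kappa>"
    proof -
      have "d * \<kappa> = \<rho>1\<^sup>2 * (1 - \<rho>2\<^sup>2) + \<rho>2\<^sup>2 * (1 - \<rho>1\<^sup>2)" unfolding \<kappa> by (simp add: algebra_simps)
      moreover have "0 < \<rho>1\<^sup>2 * (1 - \<rho>2\<^sup>2)" using that \<rho>(2) by (simp add: abs_square_less_1)
      moreover have "0 \<le> \<rho>2\<^sup>2 * (1 - \<rho>1\<^sup>2)" using \<rho>(1) by (simp add: abs_square_le_1)
      ultimately show ?thesis by linarith
    qed
    then have "0 < \<kappa>" using d by (simp add: zero_less_mult_iff)
    have "\<kappa> < 1" using \<sigma> by (simp add: \<kappa>_def)
    \<comment> \<open>The normal law of mean \<open>m\<close> and variance \<open>1 - t^2\<close>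
      has density \<open>q_normal x q\<close> times the kernel at \<open>x\<close>,
      \<open>m / t\<close> with parameter \<open>t\<close>. Here \<open>\<rho>1 \<noteq> 0\<close>
      guarantees \<open>t > 0\<close>.\<close>
    define t where "t = sqrt \<kappa>"
    have t: "0 < t" "t\<^sup>2 = \<kappa>" "\<bar>t\<bar> < 1" using \<open>0 < \<kappa>\<close> \<open>\<kappa> < 1\<close> by (simp_all add: t_def)
    have Gt: "poly2 (G n \<rho>1 \<rho>2) y z = t ^ n * H n (m / t)" for n
    proof (rule unique[symmetric])
      fix n
      have "qi n = real n" by (simp add: q_int_def q)
      then show "t ^ Suc n * H (Suc n) (m / t) = m * (t ^ n * H n (m / t)) - \<kappa> * (real n * (t ^ (n - 1) * H (n - 1) (m / t)))"
        using t(1) unfolding Hermite_Suc t(2)[symmetric]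
        by (cases n) (simp_all add: power2_eq_square field_simps)
    qed simp
    have "A_term 0 0 x (m / t) t sums A 0 0 x (m / t) t"
      by (rule sums_A) (simp_all add: S t)
    then have "(\<lambda>n. H n x / qf n * poly2 (G n \<rho>1 \<rho>2) y z) sums A 0 0 x (m / t) t"
      by (simp add: Gt A_term_def[abs_def] mult_ac)
    moreover have "phi x y z \<rho>1 \<rho>2 q = q_normal x q * A 0 0 x (m / t) t"
    proof -
      have \<sigma>t: "1 - t\<^sup>2 = \<sigma>\<^sup>2" by (simp add: t \<kappa>_def)
      have e: "t * (x * (m / t)) - t\<^sup>2 * (x\<^sup>2 + (m / t)\<^sup>2) / 2 = x * m - (\<kappa> * x\<^sup>2 + m\<^sup>2) / 2"
        using t(1) by (simp add: t(2)[symmetric] power_divide algebra_simps add_divide_distrib)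
      have "A 0 0 x (m / t) t = exp ((x * m - (\<kappa> * x\<^sup>2 + m\<^sup>2) / 2) / \<sigma>\<^sup>2) / \<sigma>"
        using Mehler_one[OF q t(3), of x "m / t"] \<sigma> unfolding \<sigma>t e by simp
      moreover have "- x\<^sup>2 / 2 + (x * m - (\<kappa> * x\<^sup>2 + m\<^sup>2) / 2) / \<sigma>\<^sup>2 = - (x - m)\<^sup>2 / (2 * \<sigma>\<^sup>2)"
        using \<sigma> by (simp add: \<kappa>_def field_simps power2_eq_square)
      ultimately have "q_normal x q * A 0 0 x (m / t) t = exp (- (x - m)\<^sup>2 / (2 * \<sigma>\<^sup>2)) / (sqrt (2 * pi) * \<sigma>)"
        by (simp add: q_normal_def q std_normal_density_def exp_add[symmetric])
      then show ?thesis using \<sigma> by (simp add: phi normal_density_def real_sqrt_mult)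
    qed
    ultimately show ?thesis by blast
  qed
qed

lemma phi_expansion:
  assumes "y \<in> S q" "z \<in> S q" "\<bar>\<rho>1\<bar> < 1" "\<bar>\<rho>2\<bar> < 1"
  shows "set_integrable lborel (S q) (\<lambda>x. H n x * phi x y z \<rho>1 \<rho>2 q)"
    and "g n y z \<rho>1 \<rho>2 q = poly2 (G n \<rho>1 \<rho>2) y z"
    and "x \<in> S q \<Longrightarrow> \<rho>1 \<noteq> 0 \<Longrightarrow>
      \<exists>P. (\<lambda>n. H n x / qf n * g n y z \<rho>1 \<rho>2 q) sums P \<and> phi x y z \<rho>1 \<rho>2 q = q_normal x q * P"
proof -
  have "set_integrable lborel (S q) (\<lambda>x. H n x * phi x y z \<rho>1 \<rho>2 q) \<and>
    g n y z \<rho>1 \<rho>2 q = poly2 (G n \<rho>1 \<rho>2) y z \<and>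
    (x \<in> S q \<longrightarrow> \<rho>1 \<noteq> 0 \<longrightarrow>
      (\<exists>P. (\<lambda>n. H n x / qf n * poly2 (G n \<rho>1 \<rho>2) y z) sums P \<and> phi x y z \<rho>1 \<rho>2 q = q_normal x q * P))" for n x
  proof (cases "q = 1")
    case True
    then show ?thesis using phi_one[OF True assms(3,4)] by blast
  next
    case False
    then interpret q_param_lt q using q_le by unfold_locales simp
    show ?thesis using q_normal_phi_series[OF assms] phi_series[OF _ assms] phi_eq_lt[OF _ assms] by blast
  qed
  then show "set_integrable lborel (S q) (\<lambda>x. H n x * phi x y z \<rho>1 \<rho>2 q)"
    and "g n y z \<rho>1 \<rho>2 q = poly2 (G n \<rho>1 \<rho>2) y z"
    and "x \<in> S q \<Longrightarrow> \<rho>1 \<noteq> 0 \<Longrightarrow>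
      \<exists>P. (\<lambda>n. H n x / qf n * g n y z \<rho>1 \<rho>2 q) sums P \<and> phi x y z \<rho>1 \<rho>2 q = q_normal x q * P"
    by simp_all
qed

end

theorem theorem1:
  fixes q :: real
  assumes "-1 < q" and "q \<le> 1"
  shows
    "(\<forall>\<rho>1\<in>{-1<..<1}. \<forall>\<rho>2\<in>{-1<..<1}. \<forall>y\<in>S q. \<forall>z\<in>S q. \<forall>n.
       set_integrable lborel (S q) (\<lambda>x. q_Hermite n x q * phi x y z \<rho>1 \<rho>2 q)) \<and>
     (\<forall>\<rho>1\<in>{-1<..<1} - {0}. \<forall>\<rho>2\<in>{-1<..<1} - {0}.
       (\<forall>x\<in>S q. \<forall>y\<in>S q. \<forall>z\<in>S q.
          summable (\<lambda>n. q_Hermite n x q / q_fact n q * g n y z \<rho>1 \<rho>2 q) \<and>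
          phi x y z \<rho>1 \<rho>2 q =
            q_normal x q * (\<Sum>n. q_Hermite n x q / q_fact n q * g n y z \<rho>1 \<rho>2 q)) \<and>
       (\<forall>n. \<exists>p. has_total_degree p n \<and>
          (\<forall>y\<in>S q. \<forall>z\<in>S q. g n y z \<rho>1 \<rho>2 q = poly2 p y z))) \<and>
     (\<exists>\<Theta> :: nat \<Rightarrow> nat \<Rightarrow> real \<Rightarrow> real poly poly.
       (\<forall>k l. has_order (\<Theta> k l) k l) \<and>
       (\<forall>n\<ge>1. \<forall>\<rho>1\<in>{-1<..<1}. \<forall>\<rho>2\<in>{-1<..<1}. \<forall>y\<in>S q. \<forall>z\<in>S q.
          g n y z \<rho>1 \<rho>2 q =
            (\<Sum>i=0..n. q_binomial n i q * \<rho>1 ^ i * \<rho>2 ^ (n - i) *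
               poly2 (\<Theta> i (n - i) (\<rho>1 * \<rho>2)) y z)) \<and>
       (\<forall>n y z. poly2 (\<Theta> 0 n 0) y z = q_Hermite n z q \<and>
                poly2 (\<Theta> n 0 0) y z = q_Hermite n y q))"
proof -
  interpret q_param q by (unfold_locales) (rule assms)+
  have abs: "\<bar>\<rho>\<bar> < 1" if "\<rho> \<in> {-1<..<1}" for \<rho> :: real using that by auto
  show ?thesis
  proof (intro conjI ballI allI impI exI[of _ "\<lambda>k l r. Theta q r k l"])
    fix \<rho>1 \<rho>2 y z :: real and n
    assume *: "\<rho>1 \<in> {-1<..<1}" "\<rho>2 \<in> {-1<..<1}" "y \<in> S q" "z \<in> S q"
    note exp = phi_expansion[OF *(3,4) abs[OF *(1)] abs[OF *(2)]]
    show "set_integrable lborel (S q) (\<lambda>x. q_Hermite n x q * phi x y z \<rho>1 \<rho>2 q)"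
      by (rule exp(1))
    show "g n y z \<rho>1 \<rho>2 q = (\<Sum>i=0..n. q_binomial n i q * \<rho>1 ^ i * \<rho>2 ^ (n - i) *
        poly2 (Theta q (\<rho>1 * \<rho>2) i (n - i)) y z)"
      unfolding exp(2) poly2_G ..
  next
    fix \<rho>1 \<rho>2 x y z :: real
    assume *: "\<rho>1 \<in> {-1<..<1} - {0}" "\<rho>2 \<in> {-1<..<1} - {0}" "x \<in> S q" "y \<in> S q" "z \<in> S q"
    then obtain P where "(\<lambda>n. H n x / qf n * g n y z \<rho>1 \<rho>2 q) sums P" "phi x y z \<rho>1 \<rho>2 q = q_normal x q * P"
      using phi_expansion(3)[OF *(4,5) abs abs *(3), of \<rho>1 \<rho>2] by blast
    then show "summable (\<lambda>n. q_Hermite n x q / q_fact n q * g n y z \<rho>1 \<rho>2 q)"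
      and "phi x y z \<rho>1 \<rho>2 q = q_normal x q * (\<Sum>n. q_Hermite n x q / q_fact n q * g n y z \<rho>1 \<rho>2 q)"
      by (simp_all add: sums_iff)
  next
    fix \<rho>1 \<rho>2 :: real and n
    assume *: "\<rho>1 \<in> {-1<..<1} - {0}" "\<rho>2 \<in> {-1<..<1} - {0}"
    then have "has_total_degree (G n \<rho>1 \<rho>2) n" by (intro has_total_degree_G abs) auto
    moreover have "\<forall>y\<in>S q. \<forall>z\<in>S q. g n y z \<rho>1 \<rho>2 q = poly2 (G n \<rho>1 \<rho>2) y z"
      using * by (intro ballI phi_expansion(2) abs) auto
    ultimately show "\<exists>p. has_total_degree p n \<and> (\<forall>y\<in>S q. \<forall>z\<in>S q. g n y z \<rho>1 \<rho>2 q = poly2 p y z)"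
      by blast
  next
    show "has_order (\<lambda>r. Theta q r k l) k l" for k l by (rule has_order_Theta)
    show "poly2 (Theta q 0 0 n) y z = q_Hermite n z q" "poly2 (Theta q 0 n 0) y z = q_Hermite n y q" for n y z
      by (rule poly2_Theta_0)+
  qed
qed

end
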